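(* Let $\mathcal{S}=\langle\mathcal{X},\mathcal{Y},\alpha_s\wedge\alpha_c,\varphi\rangle$ be a constrained $\mathsf{LTL_f}$ specification where $\alpha_s$ is a safe and $\alpha_c$ a co-safe $\mathsf{LTL}$ formula over $\mathcal{X}\cup\mathcal{Y}$, and let $\mathcal{G}=\langle\mathcal{X},\mathcal{Y}\cup\{\mathsf{end}\},\mathcal{A}^{\alpha_s,\alpha_c}_{\varphi}\rangle$ be the associated DBA game. Then: (1) $\mathcal{S}$ is realizable iff $\mathcal{G}$ is winning; (2) every winning strategy for $\mathcal{G}$ is a winning strategy for $\mathcal{S}$, and vice versa; (3) deciding whether $\mathcal{G}$ is winning, and constructing a winning strategy when one exists, can be done in doubly exponential time.
   Context: Formulas are built from $\top,\bot,p,\neg,\wedge,\vee,\mathsf{X},\mathsf{U},\mathsf{R}$. Safe formulas: $\psi::=\top\mid\bot\mid p\mid\neg p\mid\psi\wedge\psi\mid\psi\vee\psi\mid\mathsf{X}\psi\mid\psi\mathsf{R}\psi$; co-safe: same with $\mathsf{U}$ instead of $\mathsf{R}$. $\mathsf{LTL}$ is interpreted on infinite traces as usual; $\mathsf{LTL_f}$ on finite traces with $\pi\models_i\mathsf{X}\psi$ iff $|\pi|>i$ and $\pi\models_{i+1}\psi$, and $\mathsf{U},\mathsf{R}$ ranging over positions $\le|\pi|$. Constrained specification $\langle\mathcal{X},\mathcal{Y},\alpha,\varphi\rangle$ ($\mathcal{X},\mathcal{Y}$ disjoint): a strategy is $\sigma:(2^{\mathcal{X}})^*\to2^{\mathcal{Y}\cup\{\mathsf{end}\}}$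 with, for every infinite $\mathbf{X}=X_1X_2\dots$ of subsets of $\mathcal{X}$, at most one $n=n_{\sigma,\mathbf{X}}$ with $\mathsf{end}\in\sigma(X_1\cdots X_n)$; induced infinite trace $(X_1\cup\sigma(X_1))(X_2\cup\sigma(X_1X_2))\cdots$; if $n<\infty$ induced finite trace = its first $n$ letters with $\mathsf{end}$ removed. Winning iff for each $\mathbf{X}$: $n_{\sigma,\mathbf{X}}=\infty$ and the induced infinite trace falsifies $\alpha$, or $n_{\sigma,\mathbf{X}}<\infty$ and the induced finite trace satisfies $\varphi$. DBA game $\langle\mathcal{X},\mathcal{Y}',\mathcal{A}\rangle$ with $\mathcal{A}$ a deterministic Büchi automaton over $2^{\mathcal{X}\cup\mathcal{Y}'}$: a strategy $\sigma:(2^{\mathcal{X}})^*\to2^{\mathcal{Y}'}$ is winning if for every $\mathbf{X}$, the word $(X_1\cup\sigma(X_1))(X_2\cup\sigma(X_1X_2))\cdots$ is accepted by $\mathcal{A}$ (run visits accepting states infinitely often); the game is winning if such a strategy exists. The DBA $\mathcal{A}^{\alpha_s,\alpha_c}_{\varphi}$ (with $\mathcal{P}=\mathcal{X}\cup\mathcal{Y}$): take DFAs $\mathcal{A}_s=\langle2^{\mathcal{P}},Q_s,\delta_s,q^s_0,F_s\rangle$ accepting the bad prefixes of $\alpha_s$ (finite words all of whose infinite extensions falsify $\alpha_s$), $\mathcal{A}_c=\langle2^{\mathcal{P}},Q_c,\delta_c,q^c_0,F_c\rangle$ accepting the good prefixes of $\alpha_c$ (finite words all of whose infinite extensions satisfy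 $\alpha_c$), and $\mathcal{A}_g=\langle2^{\mathcal{P}},Q_g,\delta_g,q^g_0,F_g\rangle$ accepting the finite traces satisfying $\varphi$, each of doubly exponential size. States: $((Q_s\cup\{q_{\mathsf{bad}}\})\times(Q_c\cup\{q_{\mathsf{good}}\})\times Q_g)\cup\{q_\top,q_\bot\}$; initial $(q^s_0,q^c_0,q^g_0)$; accepting $\{(q_s,q_c,q_g):q_s=q_{\mathsf{bad}}\text{ or }q_c\ne q_{\mathsf{good}}\}\cup\{q_\top\}$. For $\mathsf{end}\notin\theta$: $\delta((q_s,q_c,q_g),\theta)=(\delta^*_s(q_s,\theta),\delta^*_c(q_c,\theta),\delta_g(q_g,\theta))$ with $\delta^*_s(q_s,\theta)=q_{\mathsf{bad}}$ if $q_s=q_{\mathsf{bad}}$ or $\delta_s(q_s,\theta)\in F_s$, else $\delta_s(q_s,\theta)$, and $\delta^*_c(q_c,\theta)=q_{\mathsf{good}}$ if $q_c=q_{\mathsf{good}}$ or $\delta_c(q_c,\theta)\in F_c$, else $\delta_c(q_c,\theta)$. For $\mathsf{end}\in\theta$: go to $q_\top$ if $\delta_g(q_g,\theta\setminus\{\mathsf{end}\})\in F_g$, else to $q_\bot$. From $q_\top$: stay in $q_\top$ on symbols without $\mathsf{end}$, go to $q_\bot$ otherwise; $q_\bot$ is absorbing. Complexity is measured in $|\alpha_s|+|\alpha_c|+|\varphi|$. *)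

theory Defs
  imports Main "HOL-Library.Omega_Words_Fun"
begin

section \<open>Formulas and traces\<close>

datatype (atoms: 'a) ltl =
    LTrue | LFalse | LProp 'a | LNot "'a ltl"
  | LAnd "'a ltl" "'a ltl" | LOr "'a ltl" "'a ltl"
  | LNext "'a ltl" | LUntil "'a ltl" "'a ltl" | LRelease "'a ltl" "'a ltl"

fun ltl_size :: "'a ltl \<Rightarrow> nat" where
  "ltl_size LTrue = 1"
| "ltl_size LFalse = 1"
| "ltl_size (LProp p) = 1"
| "ltl_size (LNot \<psi>) = ltl_size \<psi> + 1"
| "ltl_size (LAnd \<psi> \<chi>) = ltl_size \<psi> + ltl_size \<chi> + 1"
| "ltl_size (LOr \<psi> \<chi>) = ltl_size \<psi> + ltl_size \<chi> + 1"
| "ltl_size (LNext \<psi>) = ltl_size \<psi> + 1"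
| "ltl_size (LUntil \<psi> \<chi>) = ltl_size \<psi> + ltl_size \<chi> + 1"
| "ltl_size (LRelease \<psi> \<chi>) = ltl_size \<psi> + ltl_size \<chi> + 1"

fun safe :: "'a ltl \<Rightarrow> bool" where
  "safe LTrue = True"
| "safe LFalse = True"
| "safe (LProp p) = True"
| "safe (LNot \<psi>) = (\<exists>p. \<psi> = LProp p)"
| "safe (LAnd \<psi> \<chi>) = (safe \<psi> \<and> safe \<chi>)"
| "safe (LOr \<psi> \<chi>) = (safe \<psi> \<and> safe \<chi>)"
| "safe (LNext \<psi>) = safe \<psi>"
| "safe (LUntil \<psi> \<chi>) = False"
| "safe (LRelease \<psi> \<chi>) = (safe \<psi> \<and> safe \<chi>)"

fun cosafe :: "'a ltl \<Rightarrow> bool" where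
  "cosafe LTrue = True"
| "cosafe LFalse = True"
| "cosafe (LProp p) = True"
| "cosafe (LNot \<psi>) = (\<exists>p. \<psi> = LProp p)"
| "cosafe (LAnd \<psi> \<chi>) = (cosafe \<psi> \<and> cosafe \<chi>)"
| "cosafe (LOr \<psi> \<chi>) = (cosafe \<psi> \<and> cosafe \<chi>)"
| "cosafe (LNext \<psi>) = cosafe \<psi>"
| "cosafe (LUntil \<psi> \<chi>) = (cosafe \<psi> \<and> cosafe \<chi>)"
| "cosafe (LRelease \<psi> \<chi>) = False"

text \<open>Positions are counted from 0, on infinite and on finite traces.\<close>

fun ltl_sat :: "'a set word \<Rightarrow> nat \<Rightarrow> 'a ltl \<Rightarrow> bool" where
  "ltl_sat w i LTrue = True"
| "ltl_sat w i LFalse = False"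
| "ltl_sat w i (LProp p) = (p \<in> w i)"
| "ltl_sat w i (LNot \<psi>) = (\<not> ltl_sat w i \<psi>)"
| "ltl_sat w i (LAnd \<psi> \<chi>) = (ltl_sat w i \<psi> \<and> ltl_sat w i \<chi>)"
| "ltl_sat w i (LOr \<psi> \<chi>) = (ltl_sat w i \<psi> \<or> ltl_sat w i \<chi>)"
| "ltl_sat w i (LNext \<psi>) = ltl_sat w (Suc i) \<psi>"
| "ltl_sat w i (LUntil \<psi> \<chi>) =
     (\<exists>j\<ge>i. ltl_sat w j \<chi> \<and> (\<forall>k. i \<le> k \<and> k < j \<longrightarrow> ltl_sat w k \<psi>))"
| "ltl_sat w i (LRelease \<psi> \<chi>) =
     (\<forall>j\<ge>i. ltl_sat w j \<chi> \<or> (\<exists>k. i \<le> k \<and> k < j \<and> ltl_sat w k \<psi>))"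

definition ltl_models :: "'a set word \<Rightarrow> 'a ltl \<Rightarrow> bool" where
  "ltl_models w \<psi> \<longleftrightarrow> ltl_sat w 0 \<psi>"

fun ltlf_sat :: "'a set list \<Rightarrow> nat \<Rightarrow> 'a ltl \<Rightarrow> bool" where
  "ltlf_sat \<pi> i LTrue = True"
| "ltlf_sat \<pi> i LFalse = False"
| "ltlf_sat \<pi> i (LProp p) = (p \<in> \<pi> ! i)"
| "ltlf_sat \<pi> i (LNot \<psi>) = (\<not> ltlf_sat \<pi> i \<psi>)"
| "ltlf_sat \<pi> i (LAnd \<psi> \<chi>) = (ltlf_sat \<pi> i \<psi> \<and> ltlf_sat \<pi> i \<chi>)"
| "ltlf_sat \<pi> i (LOr \<psi> \<chi>) = (ltlf_sat \<pi> i \<psi> \<or> ltlf_sat \<pi> i \<chi>)"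
| "ltlf_sat \<pi> i (LNext \<psi>) = (Suc i < length \<pi> \<and> ltlf_sat \<pi> (Suc i) \<psi>)"
| "ltlf_sat \<pi> i (LUntil \<psi> \<chi>) =
     (\<exists>j. i \<le> j \<and> j < length \<pi> \<and> ltlf_sat \<pi> j \<chi> \<and>
        (\<forall>k. i \<le> k \<and> k < j \<longrightarrow> ltlf_sat \<pi> k \<psi>))"
| "ltlf_sat \<pi> i (LRelease \<psi> \<chi>) =
     (\<forall>j. i \<le> j \<and> j < length \<pi> \<longrightarrow>
        ltlf_sat \<pi> j \<chi> \<or> (\<exists>k. i \<le> k \<and> k < j \<and> ltlf_sat \<pi> k \<psi>))"

text \<open>Finite traces are non-empty.\<close>

definition ltlf_models :: "'a set list \<Rightarrow> 'a ltl \<Rightarrow> bool" where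
  "ltlf_models \<pi> \<psi> \<longleftrightarrow> \<pi> \<noteq> [] \<and> ltlf_sat \<pi> 0 \<psi>"

definition bad_prefixes :: "'a set \<Rightarrow> 'a ltl \<Rightarrow> 'a set list set" where
  "bad_prefixes P \<psi> =
     {u \<in> lists (Pow P). \<forall>w. range w \<subseteq> Pow P \<longrightarrow> \<not> ltl_models (u \<frown> w) \<psi>}"

definition good_prefixes :: "'a set \<Rightarrow> 'a ltl \<Rightarrow> 'a set list set" where
  "good_prefixes P \<psi> =
     {u \<in> lists (Pow P). \<forall>w. range w \<subseteq> Pow P \<longrightarrow> ltl_models (u \<frown> w) \<psi>}"

definition ltlf_language :: "'a set \<Rightarrow> 'a ltl \<Rightarrow> 'a set list set" where
  "ltlf_language P \<psi> = {\<pi> \<in> lists (Pow P). ltlf_models \<pi> \<psi>}"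


section \<open>Deterministic automata\<close>

record ('q, 'l) automaton =
  alphabet :: "'l set"
  states :: "'q set"
  initial :: 'q
  delta :: "'q \<Rightarrow> 'l \<Rightarrow> 'q"
  accepting :: "'q set"

definition det_automaton :: "('q, 'l) automaton \<Rightarrow> bool" where
  "det_automaton A \<longleftrightarrow>
     finite (states A) \<and> initial A \<in> states A \<and> accepting A \<subseteq> states A \<and>
     (\<forall>q\<in>states A. \<forall>a\<in>alphabet A. delta A q a \<in> states A)"

definition dfa_language :: "('q, 'l) automaton \<Rightarrow> 'l list set" where
  "dfa_language A = {u \<in> lists (alphabet A). foldl (delta A) (initial A) u \<in> accepting A}"

fun run :: "('q, 'l) automaton \<Rightarrow> 'l word \<Rightarrow> 'q word" where
  "run A w 0 = initial A"
| "run A w (Suc i) = delta A (run A w i) (w i)"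

definition dba_language :: "('q, 'l) automaton \<Rightarrow> 'l word set" where
  "dba_language A = {w. range w \<subseteq> alphabet A \<and> (\<exists>\<^sub>\<infinity>i. run A w i \<in> accepting A)}"

definition dfa_for :: "'l set \<Rightarrow> 'l list set \<Rightarrow> ('q, 'l) automaton \<Rightarrow> bool" where
  "dfa_for \<Sigma> L A \<longleftrightarrow> det_automaton A \<and> alphabet A = \<Sigma> \<and> dfa_language A = L"


section \<open>Strategies, constrained specifications and DBA games\<close>

definition strategy :: "'a set \<Rightarrow> 'a set \<Rightarrow> ('a set list \<Rightarrow> 'a set) \<Rightarrow> bool" where
  "strategy X Z \<sigma> \<longleftrightarrow> (\<forall>u\<in>lists (Pow X). \<sigma> u \<subseteq> Z)"

definition induced :: "('a set list \<Rightarrow> 'a set) \<Rightarrow> 'a set word \<Rightarrow> 'a set word" where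
  "induced \<sigma> \<xi> = (\<lambda>i. \<xi> i \<union> \<sigma> (prefix (Suc i) \<xi>))"

text \<open>The first move of the system answers the first input letter, so the value of a strategy
  at the empty word is never used and the stopping index \<open>n\<close> is at least 1. The special
  variable \<open>end\<close> is an element \<open>e\<close> of the type of variables outside \<open>X \<union> Y\<close>.\<close>

definition stops_at :: "'a \<Rightarrow> ('a set list \<Rightarrow> 'a set) \<Rightarrow> 'a set word \<Rightarrow> nat \<Rightarrow> bool" where
  "stops_at e \<sigma> \<xi> n \<longleftrightarrow> n \<ge> 1 \<and> e \<in> \<sigma> (prefix n \<xi>)"

definition constrained_strategy ::
  "'a \<Rightarrow> 'a set \<Rightarrow> 'a set \<Rightarrow> ('a set list \<Rightarrow> 'a set) \<Rightarrow> bool" where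
  "constrained_strategy e X Y \<sigma> \<longleftrightarrow>
     strategy X (Y \<union> {e}) \<sigma> \<and>
     (\<forall>\<xi>. range \<xi> \<subseteq> Pow X \<longrightarrow> (\<exists>\<^sub>\<le>\<^sub>1 n. stops_at e \<sigma> \<xi> n))"

definition induced_finite ::
  "'a \<Rightarrow> ('a set list \<Rightarrow> 'a set) \<Rightarrow> 'a set word \<Rightarrow> nat \<Rightarrow> 'a set list" where
  "induced_finite e \<sigma> \<xi> n = map (\<lambda>\<theta>. \<theta> - {e}) (prefix n (induced \<sigma> \<xi>))"

definition spec_winning_strategy ::
  "'a \<Rightarrow> 'a set \<Rightarrow> 'a set \<Rightarrow> 'a ltl \<Rightarrow> 'a ltl \<Rightarrow> ('a set list \<Rightarrow> 'a set) \<Rightarrow> bool" where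
  "spec_winning_strategy e X Y \<alpha> \<phi> \<sigma> \<longleftrightarrow>
     constrained_strategy e X Y \<sigma> \<and>
     (\<forall>\<xi>. range \<xi> \<subseteq> Pow X \<longrightarrow>
        (\<nexists>n. stops_at e \<sigma> \<xi> n) \<and> \<not> ltl_models (induced \<sigma> \<xi>) \<alpha> \<or>
        (\<exists>n. stops_at e \<sigma> \<xi> n \<and> ltlf_models (induced_finite e \<sigma> \<xi> n) \<phi>))"

definition realizable :: "'a \<Rightarrow> 'a set \<Rightarrow> 'a set \<Rightarrow> 'a ltl \<Rightarrow> 'a ltl \<Rightarrow> bool" where
  "realizable e X Y \<alpha> \<phi> \<longleftrightarrow> (\<exists>\<sigma>. spec_winning_strategy e X Y \<alpha> \<phi> \<sigma>)"

definition game_winning_strategy ::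
  "'a set \<Rightarrow> 'a set \<Rightarrow> ('q, 'a set) automaton \<Rightarrow> ('a set list \<Rightarrow> 'a set) \<Rightarrow> bool" where
  "game_winning_strategy X Z A \<sigma> \<longleftrightarrow>
     strategy X Z \<sigma> \<and> (\<forall>\<xi>. range \<xi> \<subseteq> Pow X \<longrightarrow> induced \<sigma> \<xi> \<in> dba_language A)"

definition game_winning :: "'a set \<Rightarrow> 'a set \<Rightarrow> ('q, 'a set) automaton \<Rightarrow> bool" where
  "game_winning X Z A \<longleftrightarrow> (\<exists>\<sigma>. game_winning_strategy X Z A \<sigma>)"


section \<open>The product DBA\<close>

text \<open>\<open>None\<close> in the first component of \<open>Prod\<close> is the state \<open>bad\<close>, in the second one the
  state \<open>good\<close>.\<close>

datatype ('s, 'c, 'g) dba_state = Prod "'s option" "'c option" 'g | Top | Bot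

text \<open>Used for both safety and co-safety components: reaching an accepting state of the DFA is
  recorded in the absorbing state \<open>None\<close>.\<close>

definition absorb :: "('q, 'l) automaton \<Rightarrow> 'q option \<Rightarrow> 'l \<Rightarrow> 'q option" where
  "absorb A q \<theta> =
     (case q of None \<Rightarrow> None
      | Some q' \<Rightarrow> if delta A q' \<theta> \<in> accepting A then None else Some (delta A q' \<theta>))"

fun product_delta ::
  "'a \<Rightarrow> ('s, 'a set) automaton \<Rightarrow> ('c, 'a set) automaton \<Rightarrow> ('g, 'a set) automaton \<Rightarrow>
   ('s, 'c, 'g) dba_state \<Rightarrow> 'a set \<Rightarrow> ('s, 'c, 'g) dba_state" where
  "product_delta e As Ac Ag (Prod qs qc qg) \<theta> =
     (if e \<notin> \<theta> then Prod (absorb As qs \<theta>) (absorb Ac qc \<theta>) (delta Ag qg \<theta>)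
      else if delta Ag qg (\<theta> - {e}) \<in> accepting Ag then Top else Bot)"
| "product_delta e As Ac Ag Top \<theta> = (if e \<notin> \<theta> then Top else Bot)"
| "product_delta e As Ac Ag Bot \<theta> = Bot"

definition product_dba ::
  "'a \<Rightarrow> 'a set \<Rightarrow> ('s, 'a set) automaton \<Rightarrow> ('c, 'a set) automaton \<Rightarrow> ('g, 'a set) automaton \<Rightarrow>
   (('s, 'c, 'g) dba_state, 'a set) automaton" where
  "product_dba e P As Ac Ag =
     \<lparr> alphabet = Pow (P \<union> {e}),
       states = {Prod qs qc qg | qs qc qg.
                   qs \<in> insert None (Some ` states As) \<and>
                   qc \<in> insert None (Some ` states Ac) \<and>
                   qg \<in> states Ag} \<union> {Top, Bot},
       initial = Prod (Some (initial As)) (Some (initial Ac)) (initial Ag),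
       delta = product_delta e As Ac Ag,
       accepting = {Prod qs qc qg | qs qc qg.
                   qs \<in> insert None (Some ` states As) \<and>
                   qc \<in> insert None (Some ` states Ac) \<and>
                   qg \<in> states Ag \<and> (qs = None \<or> qc \<noteq> None)} \<union> {Top} \<rparr>"

definition spec_with_dfas ::
  "'a \<Rightarrow> 'a set \<Rightarrow> 'a set \<Rightarrow> 'a ltl \<Rightarrow> 'a ltl \<Rightarrow> 'a ltl \<Rightarrow>
   ('s, 'a set) automaton \<Rightarrow> ('c, 'a set) automaton \<Rightarrow> ('g, 'a set) automaton \<Rightarrow> bool" where
  "spec_with_dfas e X Y \<alpha>s \<alpha>c \<phi> As Ac Ag \<longleftrightarrow>
     X \<inter> Y = {} \<and> e \<notin> X \<union> Y \<and>
     atoms \<alpha>s \<subseteq> X \<union> Y \<and> atoms \<alpha>c \<subseteq> X \<union> Y \<and> atoms \<phi> \<subseteq> X \<union> Y \<and>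
     safe \<alpha>s \<and> cosafe \<alpha>c \<and>
     dfa_for (Pow (X \<union> Y)) (bad_prefixes (X \<union> Y) \<alpha>s) As \<and>
     dfa_for (Pow (X \<union> Y)) (good_prefixes (X \<union> Y) \<alpha>c) Ac \<and>
     dfa_for (Pow (X \<union> Y)) (ltlf_language (X \<union> Y) \<phi>) Ag"


section \<open>Model of computation\<close>

text \<open>
  A first-order functional language over binary trees with opaque atoms at the leaves (pure Lisp,
  or Jones's language F). Time is the number of evaluation steps; only atoms can be compared in
  one step. A computation of \<open>t\<close> steps allocates at most \<open>t\<close> pairs, so running times agree with
  those of Turing machines up to a polynomial.

  A program consists of the bodies of its functions, which may call each other recursively, and a
  main expression. Variables are de Bruijn indices into the list of arguments, extended in front
  by \<open>ELet\<close>. \<open>VNil\<close> is false, all other values are true.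
\<close>

datatype 'a val = VNil | VAtom 'a | VPair "'a val" "'a val"

datatype expr =
    Var nat
  | ENil
  | EPair expr expr
  | EFst expr
  | ESnd expr
  | EIsPair expr
  | EEqAtom expr expr
  | EIf expr expr expr
  | ELet expr expr
  | ECall nat "expr list"

type_synonym prog = "expr list \<times> expr"

definition bool_val :: "bool \<Rightarrow> 'a val" where
  "bool_val b = (if b then VPair VNil VNil else VNil)"

fun val_fst :: "'a val \<Rightarrow> 'a val" where
  "val_fst (VPair u v) = u"
| "val_fst _ = VNil"

fun val_snd :: "'a val \<Rightarrow> 'a val" where
  "val_snd (VPair u v) = v"
| "val_snd _ = VNil"

inductive eval :: "expr list \<Rightarrow> 'a val list \<Rightarrow> expr \<Rightarrow> 'a val \<Rightarrow> nat \<Rightarrow> bool"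
  and evals :: "expr list \<Rightarrow> 'a val list \<Rightarrow> expr list \<Rightarrow> 'a val list \<Rightarrow> nat \<Rightarrow> bool"
  for fs :: "expr list" where
  eval_Var: "i < length \<rho> \<Longrightarrow> eval fs \<rho> (Var i) (\<rho> ! i) 1"
| eval_Nil: "eval fs \<rho> ENil VNil 1"
| eval_Pair: "eval fs \<rho> a u s \<Longrightarrow> eval fs \<rho> b v t \<Longrightarrow>
    eval fs \<rho> (EPair a b) (VPair u v) (s + t + 1)"
| eval_Fst: "eval fs \<rho> a u s \<Longrightarrow> eval fs \<rho> (EFst a) (val_fst u) (s + 1)"
| eval_Snd: "eval fs \<rho> a u s \<Longrightarrow> eval fs \<rho> (ESnd a) (val_snd u) (s + 1)"
| eval_IsPair: "eval fs \<rho> a u s \<Longrightarrow>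
    eval fs \<rho> (EIsPair a) (bool_val (\<exists>v w. u = VPair v w)) (s + 1)"
| eval_EqAtom: "eval fs \<rho> a u s \<Longrightarrow> eval fs \<rho> b v t \<Longrightarrow>
    eval fs \<rho> (EEqAtom a b) (bool_val (\<exists>x. u = VAtom x \<and> v = VAtom x)) (s + t + 1)"
| eval_IfTrue: "eval fs \<rho> c u s \<Longrightarrow> u \<noteq> VNil \<Longrightarrow> eval fs \<rho> a v t \<Longrightarrow>
    eval fs \<rho> (EIf c a b) v (s + t + 1)"
| eval_IfFalse: "eval fs \<rho> c VNil s \<Longrightarrow> eval fs \<rho> b v t \<Longrightarrow>
    eval fs \<rho> (EIf c a b) v (s + t + 1)"
| eval_Let: "eval fs \<rho> a u s \<Longrightarrow> eval fs (u # \<rho>) b v t \<Longrightarrow>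
    eval fs \<rho> (ELet a b) v (s + t + 1)"
| eval_Call: "evals fs \<rho> as us s \<Longrightarrow> f < length fs \<Longrightarrow> eval fs us (fs ! f) v t \<Longrightarrow>
    eval fs \<rho> (ECall f as) v (s + t + 1)"
| evals_Nil: "evals fs \<rho> [] [] 0"
| evals_Cons: "eval fs \<rho> a u s \<Longrightarrow> evals fs \<rho> as us t \<Longrightarrow>
    evals fs \<rho> (a # as) (u # us) (s + t)"

definition computes_within :: "prog \<Rightarrow> 'a val \<Rightarrow> 'a val \<Rightarrow> nat \<Rightarrow> bool" where
  "computes_within p input output T \<longleftrightarrow> (\<exists>t\<le>T. eval (fst p) [input] (snd p) output t)"

inductive_cases eval_elims:
  "eval fs \<rho> (Var i) v t"
  "eval fs \<rho> ENil v t"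
  "eval fs \<rho> (EPair a b) v t"
  "eval fs \<rho> (EFst a) v t"
  "eval fs \<rho> (ESnd a) v t"
  "eval fs \<rho> (EIsPair a) v t"
  "eval fs \<rho> (EEqAtom a b) v t"
  "eval fs \<rho> (EIf a b c) v t"
  "eval fs \<rho> (ELet a b) v t"
  "eval fs \<rho> (ECall f as) v t"
  "evals fs \<rho> [] vs t"
  "evals fs \<rho> (a # as) vs t"

lemma eval_deterministic:
  "eval fs \<rho> a u s \<Longrightarrow> eval fs \<rho> a u' s' \<Longrightarrow> u' = u \<and> s' = s"
  "evals fs \<rho> as us t \<Longrightarrow> evals fs \<rho> as us' t' \<Longrightarrow> us' = us \<and> t' = t"
proof (induction arbitrary: u' s' and us' t' rule: eval_evals.inducts)
  case eval_Var then show ?case by (auto elim: eval_elims)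
next
  case eval_Nil then show ?case by (auto elim: eval_elims)
next
  case eval_Pair from eval_Pair.prems eval_Pair.IH show ?case by (elim eval_elims) (metis Suc_eq_plus1)
next
  case eval_Fst from eval_Fst.prems eval_Fst.IH show ?case by (elim eval_elims) (metis Suc_eq_plus1)
next
  case eval_Snd from eval_Snd.prems eval_Snd.IH show ?case by (elim eval_elims) (metis Suc_eq_plus1)
next
  case eval_IsPair from eval_IsPair.prems eval_IsPair.IH show ?case by (elim eval_elims) (metis Suc_eq_plus1)
next
  case eval_EqAtom from eval_EqAtom.prems eval_EqAtom.IH show ?case by (elim eval_elims) (metis Suc_eq_plus1)
next
  case eval_IfTrue from eval_IfTrue.prems eval_IfTrue.IH eval_IfTrue.hyps
  show ?case by (elim eval_elims) (metis Suc_eq_plus1)+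
next
  case eval_IfFalse from eval_IfFalse.prems eval_IfFalse.IH show ?case by (elim eval_elims) (metis Suc_eq_plus1)+
next
  case eval_Let from eval_Let.prems eval_Let.IH show ?case by (elim eval_elims) (metis Suc_eq_plus1)
next
  case eval_Call from eval_Call.prems eval_Call.IH show ?case by (elim eval_elims) (metis Suc_eq_plus1)
next
  case evals_Nil then show ?case by (auto elim: eval_elims)
next
  case evals_Cons from evals_Cons.prems evals_Cons.IH show ?case by (elim eval_elims) (metis Suc_eq_plus1)
qed


section \<open>Encodings\<close>

fun list_val :: "'a val list \<Rightarrow> 'a val" where
  "list_val [] = VNil"
| "list_val (v # vs) = VPair v (list_val vs)"

definition nat_val :: "nat \<Rightarrow> 'a val" where
  "nat_val n = list_val (replicate n VNil)"

definition vars_val :: "'a list \<Rightarrow> 'a val" where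
  "vars_val xs = list_val (map VAtom xs)"

fun ltl_val :: "'a ltl \<Rightarrow> 'a val" where
  "ltl_val LTrue = list_val [nat_val 0]"
| "ltl_val LFalse = list_val [nat_val 1]"
| "ltl_val (LProp p) = list_val [nat_val 2, VAtom p]"
| "ltl_val (LNot \<psi>) = list_val [nat_val 3, ltl_val \<psi>]"
| "ltl_val (LAnd \<psi> \<chi>) = list_val [nat_val 4, ltl_val \<psi>, ltl_val \<chi>]"
| "ltl_val (LOr \<psi> \<chi>) = list_val [nat_val 5, ltl_val \<psi>, ltl_val \<chi>]"
| "ltl_val (LNext \<psi>) = list_val [nat_val 6, ltl_val \<psi>]"
| "ltl_val (LUntil \<psi> \<chi>) = list_val [nat_val 7, ltl_val \<psi>, ltl_val \<chi>]"
| "ltl_val (LRelease \<psi> \<chi>) = list_val [nat_val 8, ltl_val \<psi>, ltl_val \<chi>]"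

text \<open>The input lists those input and output variables that occur in the formulas. Any further
  variables of the specification do not influence the game, and listing them would make the
  input longer than the measure \<open>|\<alpha>s| + |\<alpha>c| + |\<phi>|\<close> accounts for.\<close>

definition enumerates_inputs ::
  "'a set \<Rightarrow> 'a set \<Rightarrow> 'a ltl \<Rightarrow> 'a ltl \<Rightarrow> 'a ltl \<Rightarrow> 'a list \<Rightarrow> 'a list \<Rightarrow> bool" where
  "enumerates_inputs X Y \<alpha>s \<alpha>c \<phi> xs ys \<longleftrightarrow>
     distinct xs \<and> set xs = X \<inter> (atoms \<alpha>s \<union> atoms \<alpha>c \<union> atoms \<phi>) \<and>
     distinct ys \<and> set ys = Y \<inter> (atoms \<alpha>s \<union> atoms \<alpha>c \<union> atoms \<phi>)"

definition spec_val ::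
  "'a \<Rightarrow> 'a list \<Rightarrow> 'a list \<Rightarrow> 'a ltl \<Rightarrow> 'a ltl \<Rightarrow> 'a ltl \<Rightarrow> 'a val" where
  "spec_val e xs ys \<alpha>s \<alpha>c \<phi> =
     list_val [VAtom e, vars_val xs, vars_val ys, ltl_val \<alpha>s, ltl_val \<alpha>c, ltl_val \<phi>]"

text \<open>Strategies are output as finite-state transducers, given by an initial state and an
  explicit transition table. Letters are lists of variables. With states in unary, the size of
  the encoded transducer is polynomial in the number of pairs allocated for it, even if the
  subtrees share memory.\<close>

record 'a transition =
  source :: nat
  reads :: "'a list"
  writes :: "'a list"
  target :: nat

type_synonym 'a transducer = "nat \<times> 'a transition list"

definition transition_val :: "'a transition \<Rightarrow> 'a val" where
  "transition_val \<tau> =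
     list_val [nat_val (source \<tau>), vars_val (reads \<tau>), vars_val (writes \<tau>), nat_val (target \<tau>)]"

definition transducer_val :: "'a transducer \<Rightarrow> 'a val" where
  "transducer_val M = VPair (nat_val (fst M)) (list_val (map transition_val (snd M)))"

text \<open>Only the variables in \<open>V\<close> are read. If no transition applies, the transducer outputs the
  empty set and keeps its state.\<close>

definition transducer_step ::
  "'a set \<Rightarrow> 'a transition list \<Rightarrow> nat \<Rightarrow> 'a set \<Rightarrow> 'a set \<times> nat" where
  "transducer_step V \<Delta> q I =
     (case find (\<lambda>\<tau>. source \<tau> = q \<and> set (reads \<tau>) = I \<inter> V) \<Delta> of
        None \<Rightarrow> ({}, q)
      | Some \<tau> \<Rightarrow> (set (writes \<tau>), target \<tau>))"

definition transducer_strategy :: "'a set \<Rightarrow> 'a transducer \<Rightarrow> 'a set list \<Rightarrow> 'a set" where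
  "transducer_strategy V M u =
     fst (foldl (\<lambda>(out, q) I. transducer_step V (snd M) q I) ({}, fst M) u)"

end

theory Submission
  imports Defs
begin

text \<open>
  A word over \<open>P\<close> without \<open>end\<close> is accepted by the product automaton iff it has a bad prefix for
  \<open>\<alpha>s\<close> or no good prefix for \<open>\<alpha>c\<close>. For syntactically safe and co-safe formulas such prefixes are
  witnesses for falsity and truth, and they can be recognised by evaluating a finite word with all
  pending obligations read as true, respectively as false.

  For the complexity bound, evaluation is organised backwards: the set of closure formulas that hold
  at a position is determined by the letter and by the set at the next position. After a finite
  word \<open>u\<close> the only relevant information is, for every set \<open>S\<close> of closure formulas, which of the three
  formulas hold initially if \<open>u\<close> is followed by a continuation of type \<open>S\<close>. These truth tables are
  the states of a game with doubly exponentially many states, whatever the given DFAs are. The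
  system has to reach a won state (\<open>\<phi>\<close> holds now, so that it can stop, or \<open>\<alpha>s\<close> is falsified) or to
  avoid forever the states in which \<open>\<alpha>c\<close> is satisfied. A least fixpoint \<open>R\<close> followed by a greatest fixpoint
  \<open>V\<close> solves this game, and the approximants of \<open>R\<close> followed by \<open>V\<close> yield a positional strategy:
  move into the first of these sets that can be enforced.

  All values and lists handled by the program are bounded by \<open>N = 2^2^(20 n)\<close>, and each of its
  functions runs in time \<open>N^k\<close> for a fixed \<open>k\<close>.
\<close>


section \<open>Monitoring formulas by truth tables\<close>

text \<open>The programs receive formulas only, while the three DFAs are arbitrary automata of any
  size over any state type. So the solver never touches the product automaton. The link is
  realizability, to which both the product game and the game on tables are shown equivalent. The two
  games need not agree on finite words: a table may notice the falsity of \<alpha>s or the truth of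
  \<alpha>c later than the shortest bad or good prefix does, but it notices eventually and never
  wrongly.

  A table has an entry for every type \<open>S\<close>, not just for the few that are consulted,
  because letters arrive at the end of the word while evaluation proceeds towards its start. A
  continuation of type \<open>S\<close> after \<open>u @ [a]\<close> is a continuation of type
  \<open>pull C a S\<close> after \<open>u\<close>, so a new letter merely redirects the entries.
  This makes the game deterministic and costs the second exponential.

  Once \<alpha>s is falsified or \<alpha>c is satisfied, this cannot be undone. Hence the Buchi
  condition needs no nested fixpoint.\<close>

fun subformulas :: "'a ltl \<Rightarrow> 'a ltl list" where
  "subformulas (LNot \<psi>) = LNot \<psi> # subformulas \<psi>"
| "subformulas (LAnd \<psi> \<chi>) = LAnd \<psi> \<chi> # subformulas \<psi> @ subformulas \<chi>"
| "subformulas (LOr \<psi> \<chi>) = LOr \<psi> \<chi> # subformulas \<psi> @ subformulas \<chi>"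
| "subformulas (LNext \<psi>) = LNext \<psi> # subformulas \<psi>"
| "subformulas (LUntil \<psi> \<chi>) = LUntil \<psi> \<chi> # subformulas \<psi> @ subformulas \<chi>"
| "subformulas (LRelease \<psi> \<chi>) = LRelease \<psi> \<chi> # subformulas \<psi> @ subformulas \<chi>"
| "subformulas \<psi> = [\<psi>]"

text \<open>\<open>S\<close> records what is deferred to the next position: \<open>X \<psi> \<in> S\<close> says that \<open>\<psi>\<close> holds there,
  and a formula \<open>U\<close> or \<open>R\<close> is in \<open>S\<close> if it holds there itself.\<close>

fun holds :: "'a set \<Rightarrow> 'a ltl set \<Rightarrow> 'a ltl \<Rightarrow> bool" where
  "holds a S LTrue = True"
| "holds a S LFalse = False"
| "holds a S (LProp p) = (p \<in> a)"
| "holds a S (LNot \<psi>) = (\<not> holds a S \<psi>)"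
| "holds a S (LAnd \<psi> \<chi>) = (holds a S \<psi> \<and> holds a S \<chi>)"
| "holds a S (LOr \<psi> \<chi>) = (holds a S \<psi> \<or> holds a S \<chi>)"
| "holds a S (LNext \<psi>) = (LNext \<psi> \<in> S)"
| "holds a S (LUntil \<psi> \<chi>) = (holds a S \<chi> \<or> holds a S \<psi> \<and> LUntil \<psi> \<chi> \<in> S)"
| "holds a S (LRelease \<psi> \<chi>) = (holds a S \<chi> \<and> (holds a S \<psi> \<or> LRelease \<psi> \<chi> \<in> S))"

fun obligation :: "'a ltl \<Rightarrow> 'a ltl" where
  "obligation (LNext \<psi>) = \<psi>"
| "obligation \<psi> = \<psi>"

fun is_release :: "'a ltl \<Rightarrow> bool" where
  "is_release (LRelease \<psi> \<chi>) = True"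
| "is_release _ = False"

text \<open>Filtering the fixed list \<open>C\<close> makes types canonical: a type obtained this
  way is an entry of \<open>subseqs C\<close>, and two such types with the same members are the same
  list.\<close>

definition pull :: "'a ltl list \<Rightarrow> 'a set \<Rightarrow> 'a ltl list \<Rightarrow> 'a ltl list" where
  "pull C a S = filter (\<lambda>\<theta>. holds a (set S) (obligation \<theta>)) C"

definition pulls :: "'a ltl list \<Rightarrow> 'a set list \<Rightarrow> 'a ltl list \<Rightarrow> 'a ltl list" where
  "pulls C u S = foldr (pull C) u S"

lemma pulls_simps [simp]:
  "pulls C [] S = S"
  "pulls C (a # u) S = pull C a (pulls C u S)"
  "pulls C (u @ v) S = pulls C u (pulls C v S)"
  by (simp_all add: pulls_def)

lemma in_pull: "\<theta> \<in> set (pull C a S) \<longleftrightarrow> \<theta> \<in> set C \<and> holds a (set S) (obligation \<theta>)"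
  by (auto simp: pull_def)

lemma self_in_subformulas [simp]: "\<psi> \<in> set (subformulas \<psi>)"
  by (cases \<psi>) auto

lemma atoms_subformulas: "\<theta> \<in> set (subformulas \<psi>) \<Longrightarrow> atoms \<theta> \<subseteq> atoms \<psi>"
  by (induction \<psi>) auto

lemma length_subformulas: "length (subformulas \<psi>) = ltl_size \<psi>"
  by (induction \<psi>) auto

lemma ltl_size_subformulas: "\<theta> \<in> set (subformulas \<psi>) \<Longrightarrow> ltl_size \<theta> \<le> ltl_size \<psi>"
  by (induction \<psi>) auto

lemma holds_cong: "a \<inter> atoms \<psi> = b \<inter> atoms \<psi> \<Longrightarrow> holds a S \<psi> = holds b S \<psi>"
proof (induction \<psi>)
  case (LProp p) then show ?case by auto
qed (simp_all; blast)+

lemma atoms_obligation: "atoms (obligation \<theta>) = atoms \<theta>"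
  by (cases \<theta>) auto

lemma pull_cong:
  assumes "\<And>\<theta>. \<theta> \<in> set C \<Longrightarrow> atoms \<theta> \<subseteq> P" "a \<inter> P = b \<inter> P"
  shows "pull C a S = pull C b S"
  unfolding pull_def
proof (rule filter_cong)
  fix \<theta> assume "\<theta> \<in> set C"
  then have "atoms (obligation \<theta>) \<subseteq> P" using assms(1) by (simp add: atoms_obligation)
  then have "a \<inter> atoms (obligation \<theta>) = b \<inter> atoms (obligation \<theta>)" using assms(2) by blast
  then show "holds a (set S) (obligation \<theta>) = holds b (set S) (obligation \<theta>)" by (rule holds_cong)
qed simp

text \<open>The type at position \<open>i\<close> if the type \<open>E\<close> is assumed at the
  horizon \<open>n\<close>. The guess \<open>E = C\<close> is optimistic and \<open>E = []\<close>
  pessimistic; from the horizon on, the guess itself is returned.\<close>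

definition ahead :: "'a ltl list \<Rightarrow> 'a set word \<Rightarrow> nat \<Rightarrow> 'a ltl list \<Rightarrow> nat \<Rightarrow> 'a ltl list" where
  "ahead C w n E i = pulls C (map w [i..<n]) E"

lemma ahead_end: "n \<le> i \<Longrightarrow> ahead C w n E i = E"
  by (simp add: ahead_def)

lemma ahead_step: "i < n \<Longrightarrow> ahead C w n E i = pull C (w i) (ahead C w n E (Suc i))"
  by (simp add: ahead_def upt_conv_Cons)

lemma in_ahead:
  "i < n \<Longrightarrow> \<theta> \<in> set (ahead C w n E i) \<longleftrightarrow>
     \<theta> \<in> set C \<and> holds (w i) (set (ahead C w n E (Suc i))) (obligation \<theta>)"
  by (simp add: ahead_step in_pull)

section \<open>Safe and co-safe formulas on infinite words\<close>

lemma ltl_sat_until: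
  "ltl_sat w i (LUntil \<psi> \<chi>) \<longleftrightarrow> ltl_sat w i \<chi> \<or> ltl_sat w i \<psi> \<and> ltl_sat w (Suc i) (LUntil \<psi> \<chi>)"
proof (cases "ltl_sat w i \<chi>")
  case True
  then show ?thesis by auto
next
  case False
  have "(\<forall>k. i \<le> k \<and> k < j \<longrightarrow> ltl_sat w k \<psi>) \<longleftrightarrow>
    ltl_sat w i \<psi> \<and> (\<forall>k. Suc i \<le> k \<and> k < j \<longrightarrow> ltl_sat w k \<psi>)" if "Suc i \<le> j" for j
    using that by (metis Suc_le_eq le_eq_less_or_eq less_le_trans order_refl)
  moreover have "(j \<ge> i \<and> ltl_sat w j \<chi>) \<longleftrightarrow> (j \<ge> Suc i \<and> ltl_sat w j \<chi>)" for j
    using False by (metis Suc_leD le_neq_implies_less Suc_leI)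
  ultimately show ?thesis using False by (simp; blast)
qed

lemma ltl_sat_release:
  "ltl_sat w i (LRelease \<psi> \<chi>) \<longleftrightarrow> ltl_sat w i \<chi> \<and> (ltl_sat w i \<psi> \<or> ltl_sat w (Suc i) (LRelease \<psi> \<chi>))"
  \<comment> \<open>Release is the dual of until, so its expansion law is the negated one for
    until.\<close>
  using ltl_sat_until[of w i "LNot \<psi>" "LNot \<chi>"] by (simp; blast)

text \<open>Negation occurs only on propositions, so for safe formulas \<open>holds\<close> is
  monotone in the type, and an optimistic guess cannot turn truth into falsity. A release may hand
  its obligation on to itself at the next position; this is what the inner induction on the distance
  to the horizon is for.\<close>

lemma safe_holds:
  assumes "safe \<psi>" "set (subformulas \<psi>) \<subseteq> set C" "ltl_sat w i \<psi>" "i < n"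
  shows "holds (w i) (set (ahead C w n C (Suc i))) \<psi>"
  using assms
proof (induction \<psi> arbitrary: i)
  case (LNot \<psi>) then show ?case by auto
next
  case (LNext \<psi>)
  then show ?case by (cases "Suc i < n") (auto simp: in_ahead ahead_end)
next
  case (LRelease \<psi> \<chi>)
  show ?case using LRelease.prems
  proof (induction "n - i" arbitrary: i rule: less_induct)
    case less
    have s: "ltl_sat w i \<chi>" "ltl_sat w i \<psi> \<or> ltl_sat w (Suc i) (LRelease \<psi> \<chi>)"
      using less.prems(3) ltl_sat_release by blast+
    have "LRelease \<psi> \<chi> \<in> set (ahead C w n C (Suc i))" if "ltl_sat w (Suc i) (LRelease \<psi> \<chi>)"
    proof (cases "Suc i < n")
      case True
      then show ?thesis using less.hyps[of "Suc i"] less.prems that by (auto simp: in_ahead)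
    next
      case False
      then show ?thesis using less.prems by (simp add: ahead_end)
    qed
    with s show ?case using LRelease.IH less.prems by auto
  qed
qed auto

text \<open>Refuting a safe formula takes finitely many positions: a release fails because
  \<open>\<chi>\<close> fails at some \<open>j\<close> and \<open>\<psi>\<close> fails at all
  positions before. Each of these failures has its own horizon. The claim covers all later horizons
  as well, so that several of them can be combined by taking the maximum.\<close>

lemma safe_refuted:
  assumes "safe \<psi>" "set (subformulas \<psi>) \<subseteq> set C" "\<not> ltl_sat w i \<psi>"
  shows "\<exists>n0. \<forall>n\<ge>n0. i < n \<and> \<not> holds (w i) (set (ahead C w n C (Suc i))) \<psi>"
  using assms
proof (induction \<psi> arbitrary: i)
  case LTrue then show ?case by simp
next
  case LFalse then show ?case by (auto intro: exI[of _ "Suc i"])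
next
  case (LProp p) then show ?case by (auto intro: exI[of _ "Suc i"])
next
  case (LNot \<psi>) then show ?case by (auto intro: exI[of _ "Suc i"])
next
  case (LAnd \<psi> \<chi>)
  then have "\<not> ltl_sat w i \<psi> \<or> \<not> ltl_sat w i \<chi>" by simp
  then show ?case using LAnd.IH[of i] LAnd.prems by (simp; blast)
next
  case (LOr \<psi> \<chi>)
  then obtain m n where "\<forall>k\<ge>m. i < k \<and> \<not> holds (w i) (set (ahead C w k C (Suc i))) \<psi>"
    "\<forall>k\<ge>n. i < k \<and> \<not> holds (w i) (set (ahead C w k C (Suc i))) \<chi>" by fastforce
  then show ?case by (intro exI[of _ "max m n"]) simp
next
  case (LNext \<psi>)
  then obtain m where "\<forall>k\<ge>m. Suc i < k \<and> \<not> holds (w (Suc i)) (set (ahead C w k C (Suc (Suc i)))) \<psi>"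
    by fastforce
  then show ?case by (intro exI[of _ m]) (simp add: in_ahead Suc_lessD)
next
  case (LUntil \<psi> \<chi>) then show ?case by simp
next
  case (LRelease \<psi> \<chi>)
  then obtain j where j: "i \<le> j" "\<not> ltl_sat w j \<chi>" "\<And>k. i \<le> k \<Longrightarrow> k < j \<Longrightarrow> \<not> ltl_sat w k \<psi>" by auto
  from j show ?case
  \<comment> \<open>The failure is carried back from \<open>j\<close> towards the given position,
    one letter at a time.\<close>
  proof (induction i rule: inc_induct)
    case base
    then show ?case using LRelease.IH(2)[of j] LRelease.prems by (simp; blast)
  next
    case (step k)
    then obtain m where m: "\<forall>n\<ge>m. Suc k < n \<and>
        \<not> holds (w (Suc k)) (set (ahead C w n C (Suc (Suc k)))) (LRelease \<psi> \<chi>)"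
      by (metis Suc_leD)
    obtain l where "\<forall>n\<ge>l. k < n \<and> \<not> holds (w k) (set (ahead C w n C (Suc k))) \<psi>"
      using LRelease.IH(1)[of k] LRelease.prems step by auto
    with m show ?case by (intro exI[of _ "max l m"]) (simp add: in_ahead)
  qed
qed

text \<open>Dual to \<open>safe_refuted\<close>: the truth of a co-safe formula has a finite
  witness, so it survives the pessimistic guess as soon as the horizon lies behind that
  witness.\<close>

lemma cosafe_holds:
  assumes "cosafe \<psi>" "set (subformulas \<psi>) \<subseteq> set C" "ltl_sat w i \<psi>"
  shows "\<exists>n0. \<forall>n\<ge>n0. i < n \<and> holds (w i) (set (ahead C w n [] (Suc i))) \<psi>"
  using assms
proof (induction \<psi> arbitrary: i)
  case LTrue then show ?case by (auto intro: exI[of _ "Suc i"])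
next
  case LFalse then show ?case by simp
next
  case (LProp p) then show ?case by (auto intro: exI[of _ "Suc i"])
next
  case (LNot \<psi>) then show ?case by (auto intro: exI[of _ "Suc i"])
next
  case (LAnd \<psi> \<chi>)
  then obtain m n where "\<forall>k\<ge>m. i < k \<and> holds (w i) (set (ahead C w k [] (Suc i))) \<psi>"
    "\<forall>k\<ge>n. i < k \<and> holds (w i) (set (ahead C w k [] (Suc i))) \<chi>" by fastforce
  then show ?case by (intro exI[of _ "max m n"]) simp
next
  case (LOr \<psi> \<chi>)
  then have "ltl_sat w i \<psi> \<or> ltl_sat w i \<chi>" by simp
  then show ?case using LOr.IH[of i] LOr.prems by (simp; blast)
next
  case (LNext \<psi>)
  then obtain m where "\<forall>k\<ge>m. Suc i < k \<and> holds (w (Suc i)) (set (ahead C w k [] (Suc (Suc i)))) \<psi>"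
    by fastforce
  then show ?case using LNext.prems by (intro exI[of _ m]) (simp add: in_ahead Suc_lessD)
next
  case (LRelease \<psi> \<chi>) then show ?case by simp
next
  case (LUntil \<psi> \<chi>)
  then obtain j where j: "i \<le> j" "ltl_sat w j \<chi>" "\<And>k. i \<le> k \<Longrightarrow> k < j \<Longrightarrow> ltl_sat w k \<psi>" by auto
  from j show ?case
  proof (induction i rule: inc_induct)
    case base
    then show ?case using LUntil.IH(2)[of j] LUntil.prems by (simp; blast)
  next
    case (step k)
    then obtain m where m: "\<forall>n\<ge>m. Suc k < n \<and>
        holds (w (Suc k)) (set (ahead C w n [] (Suc (Suc k)))) (LUntil \<psi> \<chi>)"
      by (metis Suc_leD)
    obtain l where "\<forall>n\<ge>l. k < n \<and> holds (w k) (set (ahead C w n [] (Suc k))) \<psi>"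
      using LUntil.IH(1)[of k] LUntil.prems step by auto
    with m show ?case using LUntil.prems by (intro exI[of _ "max l m"]) (simp add: in_ahead)
  qed
qed

lemma cosafe_refuted:
  assumes "cosafe \<psi>" "set (subformulas \<psi>) \<subseteq> set C" "\<not> ltl_sat w i \<psi>" "i < n"
  shows "\<not> holds (w i) (set (ahead C w n [] (Suc i))) \<psi>"
  using assms
proof (induction \<psi> arbitrary: i)
  case (LNot \<psi>) then show ?case by auto
next
  case (LNext \<psi>)
  then show ?case by (cases "Suc i < n") (auto simp: in_ahead ahead_end)
next
  case (LUntil \<psi> \<chi>)
  show ?case using LUntil.prems
  proof (induction "n - i" arbitrary: i rule: less_induct)
    case less
    have s: "\<not> ltl_sat w i \<chi>" "ltl_sat w i \<psi> \<Longrightarrow> \<not> ltl_sat w (Suc i) (LUntil \<psi> \<chi>)"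
      using less.prems(3) ltl_sat_until by blast+
    have "LUntil \<psi> \<chi> \<notin> set (ahead C w n [] (Suc i))" if "\<not> ltl_sat w (Suc i) (LUntil \<psi> \<chi>)"
    proof (cases "Suc i < n")
      case True
      then show ?thesis using less.hyps[of "Suc i"] less.prems that by (auto simp: in_ahead)
    next
      case False
      then show ?thesis by (simp add: ahead_end)
    qed
    with s show ?case using LUntil.IH less.prems by auto
  qed
qed auto

lemma prefix_as_ahead: "pulls C (prefix n w) E = ahead C w n E 0"
  by (simp add: ahead_def subsequence_def)

text \<open>The root tested is \<open>LNext \<psi>\<close> because membership in a type speaks of
  the \<open>obligation\<close>: for \<open>\<psi>\<close> of the form \<open>LNext \<chi>\<close>,
  the test \<open>\<psi> \<in> S\<close> would ask for \<open>\<chi>\<close>. For the empty prefix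
  the type is the guess \<open>C\<close> itself, which contains the root.\<close>

lemma safe_monitor:
  assumes "safe \<psi>" "set (subformulas (LNext \<psi>)) \<subseteq> set C"
  shows "ltl_models w \<psi> \<longleftrightarrow> (\<forall>n. LNext \<psi> \<in> set (pulls C (prefix n w) C))"
proof -
  have "LNext \<psi> \<in> set (ahead C w n C 0)" if "ltl_sat w 0 \<psi>" for n
    using safe_holds[OF assms(1) _ that, of C n] assms(2) by (cases n) (auto simp: in_ahead ahead_end)
  moreover have "\<exists>n. LNext \<psi> \<notin> set (ahead C w n C 0)" if "\<not> ltl_sat w 0 \<psi>"
    using safe_refuted[OF assms(1) _ that, of C] assms(2)
    by simp (metis in_ahead obligation.simps(1) order_refl)
  ultimately show ?thesis unfolding ltl_models_def prefix_as_ahead by blast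
qed

text \<open>All sufficiently long prefixes expose the falsity, not just one. The argument about
  winning strategies needs this because it observes a play only from a given history on.\<close>

lemma safe_monitor_eventually:
  assumes "safe \<psi>" "set (subformulas (LNext \<psi>)) \<subseteq> set C" "\<not> ltl_models w \<psi>"
  shows "\<exists>m. \<forall>n\<ge>m. LNext \<psi> \<notin> set (pulls C (prefix n w) C)"
proof -
  obtain m where "\<forall>n\<ge>m. 0 < n \<and> \<not> holds (w 0) (set (ahead C w n C (Suc 0))) \<psi>"
    using safe_refuted[OF assms(1), of C w 0] assms(2,3) by (auto simp: ltl_models_def)
  then show ?thesis unfolding prefix_as_ahead by (intro exI[of _ m]) (simp add: in_ahead)
qed

lemma cosafe_monitor:
  assumes "cosafe \<psi>" "set (subformulas (LNext \<psi>)) \<subseteq> set C"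
  shows "ltl_models w \<psi> \<longleftrightarrow> (\<exists>n. LNext \<psi> \<in> set (pulls C (prefix n w) []))"
proof -
  have "LNext \<psi> \<notin> set (ahead C w n [] 0)" if "\<not> ltl_sat w 0 \<psi>" for n
    using cosafe_refuted[OF assms(1) _ that, of C n] assms(2) by (cases n) (auto simp: in_ahead ahead_end)
  moreover have "\<exists>n. LNext \<psi> \<in> set (ahead C w n [] 0)" if "ltl_sat w 0 \<psi>"
    using cosafe_holds[OF assms(1) _ that, of C] assms(2)
    by simp (metis in_ahead obligation.simps(1) order_refl)
  ultimately show ?thesis unfolding ltl_models_def prefix_as_ahead by blast
qed

section \<open>Finite traces\<close>

lemma ltlf_sat_until:
  assumes "i < length \<pi>"
  shows "ltlf_sat \<pi> i (LUntil \<psi> \<chi>) \<longleftrightarrow> ltlf_sat \<pi> i \<chi> \<or> ltlf_sat \<pi> i \<psi> \<and> ltlf_sat \<pi> (Suc i) (LUntil \<psi> \<chi>)"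
proof (cases "ltlf_sat \<pi> i \<chi>")
  case True
  then show ?thesis using assms by auto
next
  case False
  have 1: "(\<forall>k. i \<le> k \<and> k < j \<longrightarrow> ltlf_sat \<pi> k \<psi>) \<longleftrightarrow>
    ltlf_sat \<pi> i \<psi> \<and> (\<forall>k. Suc i \<le> k \<and> k < j \<longrightarrow> ltlf_sat \<pi> k \<psi>)" if "Suc i \<le> j" for j
    using that by (metis Suc_le_eq le_eq_less_or_eq less_le_trans order_refl)
  have 2: "(i \<le> j \<and> j < length \<pi> \<and> ltlf_sat \<pi> j \<chi>) \<longleftrightarrow>
    (Suc i \<le> j \<and> j < length \<pi> \<and> ltlf_sat \<pi> j \<chi>)" for j
    using False by (metis Suc_leD le_neq_implies_less Suc_leI)
  have "ltlf_sat \<pi> i (LUntil \<psi> \<chi>) \<longleftrightarrow> (\<exists>j. (i \<le> j \<and> j < length \<pi> \<and> ltlf_sat \<pi> j \<chi>) \<and>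
      (\<forall>k. i \<le> k \<and> k < j \<longrightarrow> ltlf_sat \<pi> k \<psi>))" by simp
  also have "\<dots> \<longleftrightarrow> (\<exists>j. (Suc i \<le> j \<and> j < length \<pi> \<and> ltlf_sat \<pi> j \<chi>) \<and>
      ltlf_sat \<pi> i \<psi> \<and> (\<forall>k. Suc i \<le> k \<and> k < j \<longrightarrow> ltlf_sat \<pi> k \<psi>))"
    unfolding 2 by (rule ex_cong1) (use 1 in blast)
  also have "\<dots> \<longleftrightarrow> ltlf_sat \<pi> i \<psi> \<and> ltlf_sat \<pi> (Suc i) (LUntil \<psi> \<chi>)"
    unfolding ltlf_sat.simps by blast
  finally show ?thesis using False by blast
qed

lemma ltlf_sat_release:
  assumes "i < length \<pi>"
  shows "ltlf_sat \<pi> i (LRelease \<psi> \<chi>) \<longleftrightarrow>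
    ltlf_sat \<pi> i \<chi> \<and> (ltlf_sat \<pi> i \<psi> \<or> ltlf_sat \<pi> (Suc i) (LRelease \<psi> \<chi>))"
  using ltlf_sat_until[OF assms, of "LNot \<psi>" "LNot \<chi>"] by (simp; blast)

text \<open>Behind the last position a next or an until is false and a release holds vacuously, and
  \<open>holds\<close> consults a type for these three operators only. So the releases of
  \<open>C\<close> form the exact type after the end, and the equivalence covers arbitrary
  formulas.\<close>

lemma ltlf_holds:
  assumes "set (subformulas \<psi>) \<subseteq> set C" "i < length u"
  shows "holds (u ! i) (set (pulls C (drop (Suc i) u) (filter is_release C))) \<psi> \<longleftrightarrow> ltlf_sat u i \<psi>"
  using assms
proof (induction \<psi> arbitrary: i)
  case (LNext \<psi>)
  then show ?case
    by (cases "Suc i < length u") (auto simp: Cons_nth_drop_Suc[symmetric] in_pull)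
next
  case (LUntil \<psi> \<chi>)
  show ?case using LUntil.prems
  proof (induction "length u - i" arbitrary: i rule: less_induct)
    case less
    have "LUntil \<psi> \<chi> \<in> set (pulls C (drop (Suc i) u) (filter is_release C)) \<longleftrightarrow>
      ltlf_sat u (Suc i) (LUntil \<psi> \<chi>)"
    proof (cases "Suc i < length u")
      case True
      then show ?thesis using less.hyps[of "Suc i"] less.prems
        by (auto simp: Cons_nth_drop_Suc[symmetric] in_pull)
    qed auto
    then show ?case using LUntil.IH[of i] less.prems ltlf_sat_until[OF less.prems(2)] by (simp del: ltlf_sat.simps(8))
  qed
next
  case (LRelease \<psi> \<chi>)
  show ?case using LRelease.prems
  proof (induction "length u - i" arbitrary: i rule: less_induct)
    case less
    have "LRelease \<psi> \<chi> \<in> set (pulls C (drop (Suc i) u) (filter is_release C)) \<longleftrightarrow>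
      ltlf_sat u (Suc i) (LRelease \<psi> \<chi>)"
    proof (cases "Suc i < length u")
      case True
      then show ?thesis using less.hyps[of "Suc i"] less.prems
        by (auto simp: Cons_nth_drop_Suc[symmetric] in_pull)
    qed (use less.prems in auto)
    then show ?case using LRelease.IH[of i] less.prems ltlf_sat_release[OF less.prems(2)] by (simp del: ltlf_sat.simps(9))
  qed
qed auto

lemma ltlf_monitor:
  assumes "set (subformulas (LNext \<psi>)) \<subseteq> set C"
  shows "ltlf_models u \<psi> \<longleftrightarrow> LNext \<psi> \<in> set (pulls C u (filter is_release C))"
proof (cases u)
  case (Cons a v)
  then show ?thesis using ltlf_holds[of \<psi> C 0 u] assms by (auto simp: ltlf_models_def in_pull)
\<comment> \<open>For the empty trace both sides are false: \<open>LNext \<psi>\<close> is no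
  release, which matches the requirement that traces are non-empty.\<close>
qed (simp add: ltlf_models_def)


section \<open>The product automaton\<close>

lemma lists_prefix: "range w \<subseteq> A \<Longrightarrow> prefix n w \<in> lists A"
  by (simp add: subsequence_def image_subset_iff in_lists_conv_set)

lemma range_conc: "u \<in> lists A \<Longrightarrow> range w \<subseteq> A \<Longrightarrow> range (u \<frown> w) \<subseteq> A"
  by (auto simp: conc_def in_lists_conv_set)

text \<open>At length \<open>n\<close> the monitor has read the first \<open>n\<close> letters only.
  If it refutes \<open>\<psi>\<close> there, it refutes every continuation of that prefix, which is
  what makes the prefix bad.\<close>

lemma ex_bad_prefix:
  assumes "safe \<psi>" "range w \<subseteq> Pow P"
  shows "\<not> ltl_models w \<psi> \<longleftrightarrow> (\<exists>n. prefix n w \<in> bad_prefixes P \<psi>)"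
proof
  let ?C = "subformulas (LNext \<psi>)"
  assume "\<not> ltl_models w \<psi>"
  then obtain n where "LNext \<psi> \<notin> set (pulls ?C (prefix n w) ?C)"
    using safe_monitor[of \<psi> ?C] assms(1) by blast
  then have "\<not> ltl_models (prefix n w \<frown> v) \<psi>" for v
    using safe_monitor[of \<psi> ?C "prefix n w \<frown> v"] assms(1) prefix_conc_length[of "prefix n w" v]
    by (metis order_refl subsequence_length diff_zero)
  then show "\<exists>n. prefix n w \<in> bad_prefixes P \<psi>"
    using lists_prefix[OF assms(2)] by (auto simp: bad_prefixes_def)
next
  assume "\<exists>n. prefix n w \<in> bad_prefixes P \<psi>"
  then obtain n where "\<And>v. range v \<subseteq> Pow P \<Longrightarrow> \<not> ltl_models (prefix n w \<frown> v) \<psi>"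
    by (auto simp: bad_prefixes_def)
  moreover have "range (suffix n w) \<subseteq> Pow P" using assms(2) by (auto simp: suffix_def)
  ultimately show "\<not> ltl_models w \<psi>" using prefix_suffix[of w n] by metis
qed

lemma ex_good_prefix:
  assumes "cosafe \<psi>" "range w \<subseteq> Pow P"
  shows "ltl_models w \<psi> \<longleftrightarrow> (\<exists>n. prefix n w \<in> good_prefixes P \<psi>)"
proof
  let ?C = "subformulas (LNext \<psi>)"
  assume "ltl_models w \<psi>"
  then obtain n where "LNext \<psi> \<in> set (pulls ?C (prefix n w) [])"
    using cosafe_monitor[of \<psi> ?C] assms(1) by blast
  then have "ltl_models (prefix n w \<frown> v) \<psi>" for v
    using cosafe_monitor[of \<psi> ?C "prefix n w \<frown> v"] assms(1) prefix_conc_length[of "prefix n w" v]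
    by (metis order_refl subsequence_length diff_zero)
  then show "\<exists>n. prefix n w \<in> good_prefixes P \<psi>"
    using lists_prefix[OF assms(2)] by (auto simp: good_prefixes_def)
next
  assume "\<exists>n. prefix n w \<in> good_prefixes P \<psi>"
  then obtain n where "\<And>v. range v \<subseteq> Pow P \<Longrightarrow> ltl_models (prefix n w \<frown> v) \<psi>"
    by (auto simp: good_prefixes_def)
  moreover have "range (suffix n w) \<subseteq> Pow P" using assms(2) by (auto simp: suffix_def)
  ultimately show "ltl_models w \<psi>" using prefix_suffix[of w n] by metis
qed

lemma bad_prefixes_extend:
  "u \<in> bad_prefixes P \<psi> \<Longrightarrow> v \<in> lists (Pow P) \<Longrightarrow> u @ v \<in> bad_prefixes P \<psi>"
  by (simp add: bad_prefixes_def flip: conc_conc) (metis range_conc)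

lemma good_prefixes_extend:
  "u \<in> good_prefixes P \<psi> \<Longrightarrow> v \<in> lists (Pow P) \<Longrightarrow> u @ v \<in> good_prefixes P \<psi>"
  by (simp add: good_prefixes_def flip: conc_conc) (metis range_conc)

lemma prefix_Suc: "prefix (Suc n) w = prefix n w @ [w n]"
  by (simp add: subsequence_def)

lemma prefix_split: "m \<le> n \<Longrightarrow> prefix n w = prefix m w @ map w [m..<n]"
  by (metis le0 upt_add_eq_append le_add_diff_inverse map_append subsequence_def)

section \<open>Runs and language of the product\<close>

lemma foldl_delta_states:
  assumes "det_automaton A" "u \<in> lists (alphabet A)"
  shows "foldl (delta A) (initial A) u \<in> states A"
  using assms(2)
  by (induction u rule: rev_induct) (use assms(1) in \<open>auto simp: det_automaton_def\<close>)

text \<open>\<open>absorb\<close> tests a state only after reading a letter. An accepted empty word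
  is therefore recorded one letter late, hence \<open>n > 0\<close>. Since the language is closed
  under extension, having been accepted once is the same as being accepted now.\<close>

lemma absorb_fold:
  assumes "det_automaton A" "range w \<subseteq> alphabet A"
    and ext: "\<And>u v. u \<in> dfa_language A \<Longrightarrow> v \<in> lists (alphabet A) \<Longrightarrow> u @ v \<in> dfa_language A"
  shows "n > 0 \<Longrightarrow> foldl (absorb A) (Some (initial A)) (prefix n w) =
    (if prefix n w \<in> dfa_language A then None
     else Some (foldl (delta A) (initial A) (prefix n w)))"
proof (induction n)
  case (Suc n)
  have P: "prefix m w \<in> lists (alphabet A)" for m using lists_prefix[OF assms(2)] .
  have S: "prefix (Suc n) w \<in> dfa_language A \<longleftrightarrow>
      delta A (foldl (delta A) (initial A) (prefix n w)) (w n) \<in> accepting A"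
    using P[of "Suc n"] unfolding prefix_Suc dfa_language_def by simp
  have E: "prefix n w \<in> dfa_language A \<Longrightarrow> prefix (Suc n) w \<in> dfa_language A"
    unfolding prefix_Suc using assms(2) by (intro ext) auto
  show ?case
  proof (cases "n = 0")
    case True
    then show ?thesis using S by (simp add: prefix_Suc absorb_def subsequence_def)
  next
    case False
    then show ?thesis using Suc.IH S E by (simp add: prefix_Suc absorb_def)
  qed
qed simp

lemma product_run:
  assumes "\<And>j. j < n \<Longrightarrow> e \<notin> w j"
  shows "run (product_dba e P As Ac Ag) w n =
    Prod (foldl (absorb As) (Some (initial As)) (prefix n w))
         (foldl (absorb Ac) (Some (initial Ac)) (prefix n w))
         (foldl (delta Ag) (initial Ag) (prefix n w))"
  using assms
proof (induction n)
  case 0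
  then show ?case by (simp add: product_dba_def subsequence_def)
next
  case (Suc n)
  then show ?case by (simp add: product_dba_def prefix_Suc)
qed

lemma run_Bot:
  assumes "run (product_dba e P As Ac Ag) w m = Bot"
  shows "run (product_dba e P As Ac Ag) w (m + n) = Bot"
  using assms by (induction n) (simp_all add: product_dba_def)

lemma run_Top:
  assumes "run (product_dba e P As Ac Ag) w m = Top" "\<And>j. m \<le> j \<Longrightarrow> e \<notin> w j"
  shows "run (product_dba e P As Ac Ag) w (m + n) = Top"
  using assms by (induction n) (simp_all add: product_dba_def)

lemma Bot_rejects:
  assumes "run (product_dba e P As Ac Ag) w m = Bot"
  shows "w \<notin> dba_language (product_dba e P As Ac Ag)"
proof
  assume "w \<in> dba_language (product_dba e P As Ac Ag)"
  then obtain n where "n \<ge> m" "run (product_dba e P As Ac Ag) w n \<in> accepting (product_dba e P As Ac Ag)"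
    unfolding dba_language_def INFM_nat_le by blast
  then show False using run_Bot[OF assms, of "n - m"] by (simp add: product_dba_def)
qed

text \<open>Without \<open>end\<close>, a state reached after at least one letter is accepting iff
  the prefix read is bad or not good. Being bad and being good persist under extension, so
  infinitely many accepting visits amount to a statement about the existence of such prefixes. With
  \<open>end\<close>, its first occurrence decides between \<open>Top\<close> and
  \<open>Bot\<close>, and a second one leads to \<open>Bot\<close>.\<close>

lemma product_language:
  assumes spec: "spec_with_dfas e X Y \<alpha>s \<alpha>c \<phi> As Ac Ag"
    and w: "range w \<subseteq> Pow (X \<union> Y \<union> {e})"
  shows "w \<in> dba_language (product_dba e (X \<union> Y) As Ac Ag) \<longleftrightarrow>
    (\<forall>i. e \<notin> w i) \<and> \<not> ltl_models w (LAnd \<alpha>s \<alpha>c) \<or>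
    (\<exists>i. e \<in> w i \<and> (\<forall>j. e \<in> w j \<longrightarrow> j = i) \<and>
         ltlf_models (map (\<lambda>\<theta>. \<theta> - {e}) (prefix (Suc i) w)) \<phi>)"
proof (cases "\<exists>i. e \<in> w i")
  case False
  let ?A = "product_dba e (X \<union> Y) As Ac Ag"
  have e: "e \<notin> w i" for i using False by blast
  have w': "range w \<subseteq> Pow (X \<union> Y)" using w e by fast
  have s: "det_automaton As" "alphabet As = Pow (X \<union> Y)" "dfa_language As = bad_prefixes (X \<union> Y) \<alpha>s"
    "det_automaton Ac" "alphabet Ac = Pow (X \<union> Y)" "dfa_language Ac = good_prefixes (X \<union> Y) \<alpha>c"
    "det_automaton Ag" "alphabet Ag = Pow (X \<union> Y)" "safe \<alpha>s" "cosafe \<alpha>c"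
    using spec by (auto simp: spec_with_dfas_def dfa_for_def)
  have P: "prefix n w \<in> lists (Pow (X \<union> Y))" for n using lists_prefix[OF w'] .
  have mono_bad: "prefix m w \<in> bad_prefixes (X \<union> Y) \<alpha>s \<Longrightarrow> m \<le> n \<Longrightarrow> prefix n w \<in> bad_prefixes (X \<union> Y) \<alpha>s" for m n
    using bad_prefixes_extend[of "prefix m w" "X \<union> Y" \<alpha>s "map w [m..<n]"] w'
    by (simp add: prefix_split image_subset_iff in_lists_conv_set)
  have mono_good: "prefix m w \<in> good_prefixes (X \<union> Y) \<alpha>c \<Longrightarrow> m \<le> n \<Longrightarrow> prefix n w \<in> good_prefixes (X \<union> Y) \<alpha>c" for m n
    using good_prefixes_extend[of "prefix m w" "X \<union> Y" \<alpha>c "map w [m..<n]"] w'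
    by (simp add: prefix_split image_subset_iff in_lists_conv_set)
  have acc: "run ?A w n \<in> accepting ?A \<longleftrightarrow>
      prefix n w \<in> bad_prefixes (X \<union> Y) \<alpha>s \<or> prefix n w \<notin> good_prefixes (X \<union> Y) \<alpha>c" if "n > 0" for n
  proof -
    have st: "foldl (delta As) (initial As) (prefix n w) \<in> states As"
      "foldl (delta Ac) (initial Ac) (prefix n w) \<in> states Ac"
      "foldl (delta Ag) (initial Ag) (prefix n w) \<in> states Ag"
      using s P foldl_delta_states by metis+
    have "foldl (absorb As) (Some (initial As)) (prefix n w) =
      (if prefix n w \<in> bad_prefixes (X \<union> Y) \<alpha>s then None else Some (foldl (delta As) (initial As) (prefix n w)))"
      by (rule absorb_fold[of As w n, unfolded s(2,3)]) (use s w' that in \<open>auto intro!: bad_prefixes_extend\<close>)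
    moreover have "foldl (absorb Ac) (Some (initial Ac)) (prefix n w) =
      (if prefix n w \<in> good_prefixes (X \<union> Y) \<alpha>c then None else Some (foldl (delta Ac) (initial Ac) (prefix n w)))"
      by (rule absorb_fold[of Ac w n, unfolded s(5,6)]) (use s w' that in \<open>auto intro!: good_prefixes_extend\<close>)
    ultimately show ?thesis
      using st e by (simp add: product_run) (simp add: product_dba_def)
  qed
  have "w \<in> dba_language ?A \<longleftrightarrow> (\<exists>\<^sub>\<infinity>n. run ?A w n \<in> accepting ?A)"
    using w by (auto simp: dba_language_def product_dba_def)
  also have "\<dots> \<longleftrightarrow> (\<exists>n. prefix n w \<in> bad_prefixes (X \<union> Y) \<alpha>s) \<or> (\<forall>n. prefix n w \<notin> good_prefixes (X \<union> Y) \<alpha>c)"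
  proof (intro iffI)
    assume inf: "\<exists>\<^sub>\<infinity>n. run ?A w n \<in> accepting ?A"
    show "(\<exists>n. prefix n w \<in> bad_prefixes (X \<union> Y) \<alpha>s) \<or> (\<forall>n. prefix n w \<notin> good_prefixes (X \<union> Y) \<alpha>c)"
    proof (rule ccontr)
      assume "\<not> ?thesis"
      then obtain m where m: "prefix m w \<in> good_prefixes (X \<union> Y) \<alpha>c"
        "\<And>n. prefix n w \<notin> bad_prefixes (X \<union> Y) \<alpha>s" by blast
      from inf obtain n where "n > m" "run ?A w n \<in> accepting ?A" unfolding INFM_nat by blast
      then show False using acc[of n] m mono_good[of m n] by simp
    qed
  next
    assume "(\<exists>n. prefix n w \<in> bad_prefixes (X \<union> Y) \<alpha>s) \<or> (\<forall>n. prefix n w \<notin> good_prefixes (X \<union> Y) \<alpha>c)"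
    then obtain m where "\<forall>n>m. run ?A w n \<in> accepting ?A"
      using acc mono_bad by (metis gr0I less_nat_zero_code less_imp_le)
    then show "\<exists>\<^sub>\<infinity>n. run ?A w n \<in> accepting ?A" unfolding INFM_nat by (metis lessI less_trans linorder_less_linear)
  qed
  also have "\<dots> \<longleftrightarrow> \<not> ltl_models w (LAnd \<alpha>s \<alpha>c)"
    using ex_bad_prefix[OF s(9) w'] ex_good_prefix[OF s(10) w'] by (auto simp: ltl_models_def)
  finally show ?thesis using False by blast
next
  case True
  let ?A = "product_dba e (X \<union> Y) As Ac Ag"
  define i where "i = (LEAST i. e \<in> w i)"
  have i: "e \<in> w i" "\<And>j. j < i \<Longrightarrow> e \<notin> w j"
    using True LeastI_ex[of "\<lambda>i. e \<in> w i"] not_less_Least by (auto simp: i_def)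
  let ?\<pi> = "map (\<lambda>\<theta>. \<theta> - {e}) (prefix (Suc i) w)"
  have s: "alphabet Ag = Pow (X \<union> Y)" "dfa_language Ag = ltlf_language (X \<union> Y) \<phi>" "e \<notin> X \<union> Y"
    using spec by (auto simp: spec_with_dfas_def dfa_for_def)
  have pi: "?\<pi> = prefix i w @ [w i - {e}]"
    using i(2) by (auto simp: prefix_Suc subsequence_def)
  have "w k - {e} \<subseteq> X \<union> Y" for k using w by auto
  then have L: "?\<pi> \<in> lists (Pow (X \<union> Y))" by (simp add: subsequence_def in_lists_conv_set)
  have "foldl (delta Ag) (initial Ag) ?\<pi> \<in> accepting Ag \<longleftrightarrow> ?\<pi> \<in> dfa_language Ag"
    using L s(1) unfolding dfa_language_def by blast
  also have "\<dots> \<longleftrightarrow> ltlf_models ?\<pi> \<phi>" using L unfolding s(2) ltlf_language_def by blast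
  finally have run: "run ?A w (Suc i) = (if ltlf_models ?\<pi> \<phi> then Top else Bot)"
    using i unfolding pi by (simp add: product_run) (simp add: product_dba_def)
  have uniq: "k = i" if "e \<in> w k" "\<forall>j. e \<in> w j \<longrightarrow> j = k" for k using that i(1) by blast
  show ?thesis
  proof (cases "ltlf_models ?\<pi> \<phi> \<and> (\<forall>j. e \<in> w j \<longrightarrow> j = i)")
    case T: True
    have top: "run ?A w (Suc i + n) = Top" for n
      using run T by (intro run_Top) auto
    have "run ?A w n \<in> accepting ?A" if "n \<ge> Suc i" for n
      using top[of "n - Suc i"] that by (simp add: product_dba_def)
    then have "\<exists>\<^sub>\<infinity>n. run ?A w n \<in> accepting ?A" unfolding INFM_nat_le by (metis nat_le_linear)
    then have "w \<in> dba_language ?A" using w by (auto simp: dba_language_def product_dba_def)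
    then show ?thesis using T i(1) by blast
  next
    case F: False
    have "\<exists>m. run ?A w m = Bot"
    proof (cases "ltlf_models ?\<pi> \<phi>")
      case False
      then have "run ?A w (Suc i) = Bot" using run by (simp only: if_False)
      then show ?thesis by blast
    next
      case True
      then obtain j where "e \<in> w j" "j \<noteq> i" using F by blast
      then have ex: "\<exists>j>i. e \<in> w j" using i(2) by (meson linorder_neqE_nat)
      \<comment> \<open>The first \<open>end\<close> after position \<open>i\<close>; up to it the
        run stays in \<open>Top\<close>.\<close>
      define j where "j = (LEAST j. j > i \<and> e \<in> w j)"
      have j: "j > i" "e \<in> w j" using LeastI_ex[OF ex] unfolding j_def by blast+
      have j3: "e \<notin> w k" if "i < k" "k < j" for k
        using not_less_Least[of k "\<lambda>j. j > i \<and> e \<in> w j"] that unfolding j_def by blast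
      have "run ?A w (Suc i + n) = Top" if "Suc i + n \<le> j" for n
        using that
      proof (induction n)
        case 0 then show ?case using run True by simp
      next
        case (Suc n)
        then have "run ?A w (Suc i + n) = Top" "e \<notin> w (Suc i + n)" using j3 by auto
        then show ?case by (simp add: product_dba_def)
      qed
      from this[of "j - Suc i"] j(1) have "run ?A w j = Top" by simp
      then have "run ?A w (Suc j) = Bot" using j(2) by (simp add: product_dba_def)
      then show ?thesis by blast
    qed
    then have "w \<notin> dba_language ?A" using Bot_rejects by metis
    then show ?thesis using F True uniq by blast
  qed
qed

text \<open>That \<open>end\<close> occurs at most once is a condition on strategies in the
  specification, but part of acceptance in the game. So the two sides are compared for each input
  word as the conjunction of uniqueness and success.\<close>

lemma game_strategy_iff_spec_strategy:
  assumes spec: "spec_with_dfas e X Y \<alpha>s \<alpha>c \<phi> As Ac Ag"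
  shows "game_winning_strategy X (Y \<union> {e}) (product_dba e (X \<union> Y) As Ac Ag) \<sigma> \<longleftrightarrow>
         spec_winning_strategy e X Y (LAnd \<alpha>s \<alpha>c) \<phi> \<sigma>"
proof (cases "strategy X (Y \<union> {e}) \<sigma>")
  case False
  then show ?thesis
    by (simp add: game_winning_strategy_def spec_winning_strategy_def constrained_strategy_def)
next
  case True
  have e: "e \<notin> X" using spec by (auto simp: spec_with_dfas_def)
  have eq: "induced \<sigma> \<xi> \<in> dba_language (product_dba e (X \<union> Y) As Ac Ag) \<longleftrightarrow>
      (\<exists>\<^sub>\<le>\<^sub>1 n. stops_at e \<sigma> \<xi> n) \<and>
      ((\<nexists>n. stops_at e \<sigma> \<xi> n) \<and> \<not> ltl_models (induced \<sigma> \<xi>) (LAnd \<alpha>s \<alpha>c) \<or>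
       (\<exists>n. stops_at e \<sigma> \<xi> n \<and> ltlf_models (induced_finite e \<sigma> \<xi> n) \<phi>))"
    if \<xi>: "range \<xi> \<subseteq> Pow X" for \<xi>
  proof -
    have 1: "range (induced \<sigma> \<xi>) \<subseteq> Pow (X \<union> Y \<union> {e})"
      using True lists_prefix[OF \<xi>] \<xi> by (fastforce simp: induced_def strategy_def)
    \<comment> \<open>Stopping indices start at 1 and letters at 0. Since
      \<open>e \<notin> X\<close>, an \<open>end\<close> in an induced letter can only come from the
      strategy.\<close>
    have 2: "stops_at e \<sigma> \<xi> n \<longleftrightarrow> (\<exists>i. n = Suc i \<and> e \<in> induced \<sigma> \<xi> i)" for n
      using \<xi> e by (cases n) (auto simp: stops_at_def induced_def)
    have 3: "(\<exists>\<^sub>\<le>\<^sub>1 n. stops_at e \<sigma> \<xi> n) \<longleftrightarrow> (\<forall>i j. e \<in> induced \<sigma> \<xi> i \<longrightarrow> e \<in> induced \<sigma> \<xi> j \<longrightarrow> i = j)"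
      unfolding 2 by (auto simp: Uniq_def)
    have 4: "(\<exists>n. stops_at e \<sigma> \<xi> n \<and> F n) \<longleftrightarrow> (\<exists>i. e \<in> induced \<sigma> \<xi> i \<and> F (Suc i))"
      "(\<exists>n. stops_at e \<sigma> \<xi> n) \<longleftrightarrow> (\<exists>i. e \<in> induced \<sigma> \<xi> i)" for F
      unfolding 2 by blast+
    show ?thesis
      unfolding product_language[OF spec 1] 3 4 induced_finite_def by blast
  qed
  have "(\<forall>\<xi>. range \<xi> \<subseteq> Pow X \<longrightarrow> induced \<sigma> \<xi> \<in> dba_language (product_dba e (X \<union> Y) As Ac Ag)) \<longleftrightarrow>
    (\<forall>\<xi>. range \<xi> \<subseteq> Pow X \<longrightarrow> (\<exists>\<^sub>\<le>\<^sub>1 n. stops_at e \<sigma> \<xi> n) \<and>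
      ((\<nexists>n. stops_at e \<sigma> \<xi> n) \<and> \<not> ltl_models (induced \<sigma> \<xi>) (LAnd \<alpha>s \<alpha>c) \<or>
       (\<exists>n. stops_at e \<sigma> \<xi> n \<and> ltlf_models (induced_finite e \<sigma> \<xi> n) \<phi>)))"
    by (rule all_cong1, rule imp_cong[OF refl eq])
  with True show ?thesis
    unfolding game_winning_strategy_def spec_winning_strategy_def constrained_strategy_def
    by (simp only: all_conj_distrib imp_conjR simp_thms)
qed

lemma realizable_iff_game_winning:
  assumes "spec_with_dfas e X Y \<alpha>s \<alpha>c \<phi> As Ac Ag"
  shows "realizable e X Y (LAnd \<alpha>s \<alpha>c) \<phi> \<longleftrightarrow>
         game_winning X (Y \<union> {e}) (product_dba e (X \<union> Y) As Ac Ag)"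
  using game_strategy_iff_spec_strategy[OF assms] by (auto simp: realizable_def game_winning_def)


section \<open>Solving the game\<close>

lemma iteration_stabilizes:
  fixes f :: "nat \<Rightarrow> 'b set"
  assumes "\<And>k. f k \<subseteq> f (Suc k)" "\<And>k. f k \<subseteq> S" "finite S" "card S \<le> n"
    and stable: "\<And>k. f k = f (Suc k) \<Longrightarrow> f (Suc k) = f (Suc (Suc k))"
  shows "f (Suc n) = f n"
proof -
  have mono: "mono f" using assms(1) by (simp add: mono_iff_le_Suc)
  have "finite (range f)" using assms(2,3) by (meson finite_Pow_iff finite_subset image_subsetI PowI)
  then have "f (card S) = (\<Union>n. f n)"
    using mono assms by (intro finite_mono_strict_prefix_implies_finite_fixpoint
        finite_mono_remains_stable_implies_strict_prefix) auto
  moreover have "f (card S) \<subseteq> f n" using mono assms(4) by (simp add: monoD)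
  ultimately have "f n = (\<Union>n. f n)" by blast
  then show ?thesis using assms(1)[of n] by blast
qed

definition controllable :: "('q \<Rightarrow> 'i \<Rightarrow> 'o \<Rightarrow> 'q) \<Rightarrow> 'i list \<Rightarrow> 'o list \<Rightarrow> 'q list \<Rightarrow> 'q \<Rightarrow> bool" where
  "controllable d Is Os Z q \<longleftrightarrow> (\<forall>I\<in>set Is. \<exists>U\<in>set Os. d q I U \<in> set Z)"

text \<open>One scheme for both fixpoints: members of \<open>A\<close> qualify outright, members of
  \<open>B\<close> if \<open>Z\<close> can be enforced. Reachability takes the won states for
  \<open>A\<close> and all states for \<open>B\<close>; the safety iteration takes \<open>R\<close>
  and the states that are not good.\<close>

definition attract ::
  "('q \<Rightarrow> 'i \<Rightarrow> 'o \<Rightarrow> 'q) \<Rightarrow> 'i list \<Rightarrow> 'o list \<Rightarrow> 'q list \<Rightarrow> 'q list \<Rightarrow> 'q list \<Rightarrow> 'q list \<Rightarrow> 'q list" where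
  "attract d Is Os Q A B Z = filter (\<lambda>q. q \<in> set A \<or> q \<in> set B \<and> controllable d Is Os Z q) Q"

text \<open>The second list is a unary counter, so that the program can iterate along the list of
  states. All approximants are kept because the strategy needs them as ranks.\<close>

fun stages :: "('z \<Rightarrow> 'z) \<Rightarrow> 'z \<Rightarrow> 'x list \<Rightarrow> 'z list" where
  "stages G Z [] = [Z]"
| "stages G Z (x # xs) = Z # stages G (G Z) xs"

lemma length_stages [simp]: "length (stages G Z xs) = Suc (length xs)"
  by (induction xs arbitrary: Z) auto

lemma nth_stages: "k \<le> length xs \<Longrightarrow> stages G Z xs ! k = (G ^^ k) Z"
proof (induction xs arbitrary: Z k)
  case (Cons x xs)
  then show ?case by (cases k) (auto simp: funpow_swap1)
qed simp

lemma stages_neq_Nil [simp]: "stages G Z xs \<noteq> []"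
  by (cases xs) auto

lemma last_stages: "last (stages G Z xs) = (G ^^ length xs) Z"
  by (simp add: last_conv_nth nth_stages)

lemma controllable_mono:
  "set Z \<subseteq> set Z' \<Longrightarrow> controllable d Is Os Z q \<Longrightarrow> controllable d Is Os Z' q"
  unfolding controllable_def by blast

lemma attract_mono: "set Z \<subseteq> set Z' \<Longrightarrow> set (attract d Is Os Q A B Z) \<subseteq> set (attract d Is Os Q A B Z')"
  unfolding attract_def using controllable_mono by fastforce

lemma attract_cong: "set Z = set Z' \<Longrightarrow> attract d Is Os Q A B Z = attract d Is Os Q A B Z'"
  unfolding attract_def controllable_def by simp

lemma attract_subset: "set (attract d Is Os Q A B Z) \<subseteq> set Q"
  unfolding attract_def by auto

lemma attract_up_mono:
  "set ((attract d Is Os Q A B ^^ k) []) \<subseteq> set ((attract d Is Os Q A B ^^ Suc k) [])"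
proof (induction k)
  case (Suc k)
  then show ?case using attract_mono by simp
qed simp

lemma attract_down_mono:
  "set ((attract d Is Os Q A B ^^ Suc k) Q) \<subseteq> set ((attract d Is Os Q A B ^^ k) Q)"
proof (induction k)
  case 0
  then show ?case using attract_subset by simp
next
  case (Suc k)
  then show ?case using attract_mono by simp
qed

lemma attract_up_stable:
  fixes Q A B :: "'q list" and d :: "'q \<Rightarrow> 'i \<Rightarrow> 'o \<Rightarrow> 'q" and Is Os
  defines "G \<equiv> attract d Is Os Q A B"
  shows "set (G ((G ^^ length Q) [])) = set ((G ^^ length Q) [])"
proof -
  let ?f = "\<lambda>k. set ((G ^^ k) [])"
  have "?f (Suc (length Q)) = ?f (length Q)"
  proof (rule iteration_stabilizes[of ?f "set Q"])
    show "?f k \<subseteq> ?f (Suc k)" for k unfolding G_def by (rule attract_up_mono)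
    show "?f k \<subseteq> set Q" for k by (cases k) (simp_all add: G_def attract_subset)
    show "?f (Suc k) = ?f (Suc (Suc k))" if "?f k = ?f (Suc k)" for k
      using attract_cong[OF that, of d Is Os Q A B] by (simp add: G_def)
  qed (auto simp: card_length)
  then show ?thesis by simp
qed

lemma attract_down_stable:
  fixes Q A B :: "'q list" and d :: "'q \<Rightarrow> 'i \<Rightarrow> 'o \<Rightarrow> 'q" and Is Os
  defines "G \<equiv> attract d Is Os Q A B"
  shows "set (G ((G ^^ length Q) Q)) = set ((G ^^ length Q) Q)"
proof -
  \<comment> \<open>The complements of a descending chain ascend, which reduces the claim to the
    same counting lemma.\<close>
  let ?f = "\<lambda>k. set Q - set ((G ^^ k) Q)"
  have sub: "set ((G ^^ k) Q) \<subseteq> set Q" for k by (cases k) (simp_all add: G_def attract_subset)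
  have "?f (Suc (length Q)) = ?f (length Q)"
  proof (rule iteration_stabilizes[of ?f "set Q"])
    show "?f k \<subseteq> ?f (Suc k)" for k unfolding G_def by (intro Diff_mono attract_down_mono order_refl)
    show "?f (Suc k) = ?f (Suc (Suc k))" if "?f k = ?f (Suc k)" for k
    proof -
      have "set ((G ^^ k) Q) = set ((G ^^ Suc k) Q)" using that sub by (metis double_diff order_refl)
      from attract_cong[OF this, of d Is Os Q A B] show ?thesis by (simp add: G_def)
    qed
  qed (auto simp: card_length)
  then show ?thesis using sub by (metis double_diff order_refl funpow.simps(2) comp_apply)
qed

lemma filter_in_subseqs: "filter P xs \<in> set (subseqs xs)"
  by (induction xs) (auto simp: Let_def)

lemma subseqs_subset: "ys \<in> set (subseqs xs) \<Longrightarrow> set ys \<subseteq> set xs"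
  using subseqs_powset[of xs] by blast

lemma Nil_in_subseqs: "[] \<in> set (subseqs xs)"
  by (induction xs) (auto simp: Let_def)

fun index_in :: "'q \<Rightarrow> 'q list \<Rightarrow> nat" where
  "index_in q [] = 0"
| "index_in q (x # xs) = (if q = x then 0 else Suc (index_in q xs))"

lemma index_in_less: "q \<in> set Q \<Longrightarrow> index_in q Q < length Q"
  by (induction Q) auto

lemma index_in_inject: "index_in q Q = index_in q' Q \<Longrightarrow> q \<in> set Q \<Longrightarrow> q' = q"
  by (induction Q) (auto split: if_splits)

section \<open>The game on truth tables for three given formulas\<close>

type_synonym 'a mstate = "('a ltl \<times> 'a ltl list) list"

locale synthesis =
  fixes e :: 'a and xs ys :: "'a list" and \<alpha>s \<alpha>c \<phi> :: "'a ltl"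
begin

definition C :: "'a ltl list" where
  "C = subformulas (LNext \<alpha>s) @ subformulas (LNext \<alpha>c) @ subformulas (LNext \<phi>)"

definition final :: "'a ltl list" where
  "final = filter is_release C"

text \<open>A state is the sublist of the rows answered positively. The fixed order of
  \<open>D\<close> makes this representation canonical.\<close>

definition D :: "('a ltl \<times> 'a ltl list) list" where
  "D = map (Pair (LNext \<alpha>s)) (subseqs C) @ map (Pair (LNext \<alpha>c)) (subseqs C) @
       map (Pair (LNext \<phi>)) (subseqs C)"

definition Q :: "'a mstate list" where "Q = subseqs D"
definition Is :: "'a list list" where "Is = subseqs xs"
definition Os :: "'a list list" where "Os = subseqs ys"

definition step :: "'a set \<Rightarrow> 'a mstate \<Rightarrow> 'a mstate" where
  "step a q = filter (\<lambda>(r, S). (r, pull C a S) \<in> set q) D"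

definition start :: "'a mstate" where
  "start = filter (\<lambda>(r, S). r \<in> set S) D"

definition monitor :: "'a set list \<Rightarrow> 'a mstate" where
  "monitor u = filter (\<lambda>(r, S). r \<in> set (pulls C u S)) D"

text \<open>The row consulted is the type assumed behind the last letter: the end of a finite trace
  here, everything true in \<open>bad\<close>, nothing true in \<open>good\<close>.\<close>

definition fulfilled :: "'a mstate \<Rightarrow> bool" where
  "fulfilled q \<longleftrightarrow> (LNext \<phi>, final) \<in> set q"

definition bad :: "'a mstate \<Rightarrow> bool" where
  "bad q \<longleftrightarrow> (LNext \<alpha>s, C) \<notin> set q"

definition good :: "'a mstate \<Rightarrow> bool" where
  "good q \<longleftrightarrow> (LNext \<alpha>c, []) \<in> set q"

definition won :: "'a mstate \<Rightarrow> bool" where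
  "won q \<longleftrightarrow> fulfilled q \<or> bad q"

definition move :: "'a mstate \<Rightarrow> 'a list \<Rightarrow> 'a list \<Rightarrow> 'a mstate" where
  "move q I U = step (set (I @ U)) q"

definition reach_step :: "'a mstate list \<Rightarrow> 'a mstate list" where
  "reach_step = attract move Is Os Q (filter won Q) Q"

definition reach_stages :: "'a mstate list list" where
  "reach_stages = stages reach_step [] Q"

definition R :: "'a mstate list" where "R = last reach_stages"

definition stay_step :: "'a mstate list \<Rightarrow> 'a mstate list" where
  "stay_step = attract move Is Os Q R (filter (\<lambda>q. \<not> good q) Q)"

definition V :: "'a mstate list" where "V = last (stages stay_step Q Q)"

definition Zs :: "'a mstate list list" where "Zs = reach_stages @ [V]"

definition target_set :: "'a mstate \<Rightarrow> 'a mstate list" where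
  "target_set q = (case find (\<lambda>Z. controllable move Is Os Z q) Zs of None \<Rightarrow> [] | Some Z \<Rightarrow> Z)"

definition choice :: "'a mstate \<Rightarrow> 'a list \<Rightarrow> 'a list" where
  "choice q I = (case find (\<lambda>U. move q I U \<in> set (target_set q)) Os of None \<Rightarrow> [] | Some U \<Rightarrow> U)"

text \<open>The state \<open>length Q\<close> has no outgoing transitions: the strategy is silent from then on.\<close>

definition trans :: "'a mstate \<Rightarrow> 'a list \<Rightarrow> 'a transition" where
  "trans q I = (let q' = move q I (choice q I) in
     \<lparr>source = index_in q Q, reads = I,
      writes = (if fulfilled q' then e # choice q I else choice q I),
      target = (if won q' then length Q else index_in q' Q)\<rparr>)"

definition machine :: "'a transducer" where
  "machine = (index_in start Q, concat (map (\<lambda>q. map (trans q) Is) Q))"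

abbreviation "Rk k \<equiv> (reach_step ^^ k) []"

lemma in_D: "(r, S) \<in> set D \<longleftrightarrow> r \<in> {LNext \<alpha>s, LNext \<alpha>c, LNext \<phi>} \<and> S \<in> set (subseqs C)"
  by (auto simp: D_def)

lemma pull_in_subseqs: "pull C a S \<in> set (subseqs C)"
  by (simp add: pull_def filter_in_subseqs)

lemma start_monitor: "start = monitor []"
  by (simp add: start_def monitor_def)

lemma monitor_snoc: "monitor (u @ [a]) = step a (monitor u)"
  unfolding monitor_def step_def by (rule filter_cong) (auto simp: in_D pull_in_subseqs)

lemma monitor_in_Q: "monitor u \<in> set Q"
  unfolding monitor_def Q_def by (rule filter_in_subseqs)

lemma step_in_Q: "step a q \<in> set Q"
  unfolding step_def Q_def by (rule filter_in_subseqs)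

lemma in_monitor:
  "(r, S) \<in> set (monitor u) \<longleftrightarrow>
     r \<in> {LNext \<alpha>s, LNext \<alpha>c, LNext \<phi>} \<and> S \<in> set (subseqs C) \<and> r \<in> set (pulls C u S)"
  unfolding monitor_def by (auto simp: in_D)

lemma fulfilled_monitor: "fulfilled (monitor u) \<longleftrightarrow> ltlf_models u \<phi>"
  unfolding fulfilled_def in_monitor
  using ltlf_monitor[of \<phi> C u] filter_in_subseqs[of is_release C]
  by (auto simp: final_def C_def)

lemma bad_monitor: "bad (monitor u) \<longleftrightarrow> LNext \<alpha>s \<notin> set (pulls C u C)"
  unfolding bad_def in_monitor by (auto simp: subseqs_refl)

lemma good_monitor: "good (monitor u) \<longleftrightarrow> LNext \<alpha>c \<in> set (pulls C u [])"
  unfolding good_def in_monitor by (auto simp: Nil_in_subseqs)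

text \<open>Before the first letter there is no finite trace yet, and the optimistic guess contains
  the root of \<alpha>s. So \<open>machine\<close> may start in the ordinary number of
  \<open>start\<close> without a test for the silent state.\<close>

lemma not_won_start: "\<not> won (monitor [])"
  by (auto simp: won_def fulfilled_monitor bad_monitor ltlf_models_def C_def)

lemma R_eq: "R = Rk (length Q)"
  by (simp add: R_def reach_stages_def last_stages)

lemma R_stable: "set (reach_step R) = set R"
  unfolding R_eq reach_step_def by (rule attract_up_stable)

lemma V_eq: "V = (stay_step ^^ length Q) Q"
  by (simp add: V_def last_stages)

lemma V_stable: "set (stay_step V) = set V"
  unfolding V_eq stay_step_def by (rule attract_down_stable)

lemma Rk_mono: "j \<le> k \<Longrightarrow> set (Rk j) \<subseteq> set (Rk k)"
  by (rule lift_Suc_mono_le[of "\<lambda>k. set (Rk k)"]) (simp_all only: reach_step_def attract_up_mono)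

lemma in_reach_step:
  "q \<in> set (reach_step Z) \<longleftrightarrow> q \<in> set Q \<and> (won q \<or> controllable move Is Os Z q)"
  by (auto simp: reach_step_def attract_def)

lemma in_stay_step:
  "q \<in> set (stay_step Z) \<longleftrightarrow> q \<in> set Q \<and> (q \<in> set R \<or> \<not> good q \<and> controllable move Is Os Z q)"
  by (auto simp: stay_step_def attract_def)

lemma in_R: "q \<in> set R \<longleftrightarrow> q \<in> set Q \<and> (won q \<or> controllable move Is Os R q)"
  using R_stable in_reach_step by blast

lemma in_V: "q \<in> set V \<longleftrightarrow> q \<in> set Q \<and> (q \<in> set R \<or> \<not> good q \<and> controllable move Is Os V q)"
  using V_stable in_stay_step by blast

lemma Zs_nth: "k \<le> length Q \<Longrightarrow> Zs ! k = Rk k"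
  by (simp add: Zs_def reach_stages_def nth_append nth_stages)

lemma Zs_subset_V: "Z \<in> set Zs \<Longrightarrow> set Z \<subseteq> set V"
proof -
  assume Z: "Z \<in> set Zs"
  have "set (Rk k) \<subseteq> set V" if "k \<le> length Q" for k
    using Rk_mono[OF that] in_V in_R by (auto simp: R_eq)
  moreover have "Z = V \<or> (\<exists>k\<le>length Q. Z = Rk k)" using Z
    by (auto simp: Zs_def reach_stages_def in_set_conv_nth nth_stages less_Suc_eq_le)
  ultimately show ?thesis by blast
qed

text \<open>The last claim is the progress measure. If \<open>q\<close> lies in approximant
  \<open>k + 1\<close> and is not won, then approximant \<open>k\<close> can be enforced from
  \<open>q\<close>; the first enforceable entry of \<open>Zs\<close> comes no later and is contained
  in it. So the chosen move lowers the rank.\<close>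

lemma choice_props:
  assumes q: "q \<in> set V" "\<not> won q" and I: "I \<in> set Is"
  shows "choice q I \<in> set Os" "move q I (choice q I) \<in> set V"
    "\<And>k. k < length Q \<Longrightarrow> q \<in> set (Rk (Suc k)) \<Longrightarrow> move q I (choice q I) \<in> set (Rk k)"
proof -
  have "\<exists>Z\<in>set Zs. controllable move Is Os Z q"
  proof (cases "q \<in> set R")
    case True
    then have "controllable move Is Os R q" using q(2) in_R by blast
    then show ?thesis by (auto simp: Zs_def R_def reach_stages_def)
  next
    case False
    then show ?thesis using q(1) in_V by (auto simp: Zs_def)
  qed
  then obtain Z where Z: "find (\<lambda>Z. controllable move Is Os Z q) Zs = Some Z"
    by (metis find_None_iff option.exhaust)
  then obtain i where i: "i < length Zs" "controllable move Is Os Z q" "Z = Zs ! i"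
    "\<And>j. j < i \<Longrightarrow> \<not> controllable move Is Os (Zs ! j) q"
    unfolding find_Some_iff by blast
  have T: "target_set q = Z" by (simp add: target_set_def Z)
  have "\<exists>U\<in>set Os. move q I U \<in> set Z" using i(2) I by (auto simp: controllable_def)
  then obtain U where U: "find (\<lambda>U. move q I U \<in> set Z) Os = Some U"
    by (metis (mono_tags, lifting) find_None_iff option.exhaust)
  then have U': "U \<in> set Os" "move q I U \<in> set Z" by (auto simp: find_Some_iff)
  have ch: "choice q I = U" by (simp add: choice_def T U)
  show "choice q I \<in> set Os" using U' ch by simp
  show "move q I (choice q I) \<in> set V" using U' ch Zs_subset_V[of Z] i by auto
  show "move q I (choice q I) \<in> set (Rk k)" if k: "k < length Q" "q \<in> set (Rk (Suc k))" for k
  proof -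
    have "controllable move Is Os (Rk k) q" using k(2) q(2) by (simp add: in_reach_step)
    then have "i \<le> k" using i(4)[of k] Zs_nth[of k] k(1) by (metis linorder_not_less less_imp_le)
    then have "Z = Rk i" using i(3) Zs_nth[of i] k(1) by simp
    then show ?thesis using Rk_mono[OF \<open>i \<le> k\<close>] U' ch by auto
  qed
qed

end

section \<open>From plays over all variables to moves on tables\<close>

locale synthesis_spec = synthesis +
  fixes X Y :: "'a set"
  assumes disjoint: "X \<inter> Y = {}" and e_fresh: "e \<notin> X \<union> Y"
    and atoms_XY: "atoms \<alpha>s \<union> atoms \<alpha>c \<union> atoms \<phi> \<subseteq> X \<union> Y"
    and safe_\<alpha>s: "safe \<alpha>s" and cosafe_\<alpha>c: "cosafe \<alpha>c"
    and enum: "enumerates_inputs X Y \<alpha>s \<alpha>c \<phi> xs ys"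
begin

lemma set_xs: "set xs = X \<inter> (atoms \<alpha>s \<union> atoms \<alpha>c \<union> atoms \<phi>)"
  and set_ys: "set ys = Y \<inter> (atoms \<alpha>s \<union> atoms \<alpha>c \<union> atoms \<phi>)"
  using enum by (auto simp: enumerates_inputs_def)

lemma atoms_C: "\<theta> \<in> set C \<Longrightarrow> atoms \<theta> \<subseteq> atoms \<alpha>s \<union> atoms \<alpha>c \<union> atoms \<phi>"
  using atoms_subformulas by (fastforce simp: C_def)

text \<open>Tables see only the variables that occur in the formulas. This justifies listing just
  these to the program, and it makes \<open>end\<close> invisible because \<open>e\<close> lies
  outside \<open>X \<union> Y\<close>.\<close>

lemma step_cong:
  assumes "a \<inter> (atoms \<alpha>s \<union> atoms \<alpha>c \<union> atoms \<phi>) = b \<inter> (atoms \<alpha>s \<union> atoms \<alpha>c \<union> atoms \<phi>)"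
  shows "step a q = step b q"
  unfolding step_def using pull_cong[OF atoms_C assms] by simp

lemma step_letter:
  assumes "I \<subseteq> X" "U \<subseteq> Y \<union> {e}" "set I' = I \<inter> set xs" "set U' = U \<inter> set ys"
  shows "step (I \<union> U) q = move q I' U'"
  unfolding move_def
  by (rule step_cong) (use assms disjoint e_fresh atoms_XY set_xs set_ys in auto)

lemma monitor_remove_end: "monitor (map (\<lambda>\<theta>. \<theta> - {e}) u) = monitor u"
proof (induction u rule: rev_induct)
  case (snoc a u)
  have "step (a - {e}) q = step a q" for q
    using e_fresh atoms_XY by (intro step_cong) auto
  then show ?case using snoc by (simp add: monitor_snoc)
qed simp

lemma input_letter: "\<exists>I'\<in>set Is. set I' = I \<inter> set xs"
  using subset_subseqs[of "I \<inter> set xs" xs] by (auto simp: Is_def)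

lemma output_letter: "\<exists>U'\<in>set Os. set U' = U \<inter> set ys"
  using subset_subseqs[of "U \<inter> set ys" ys] by (auto simp: Os_def)

lemma \<alpha>s_sat: "ltl_models w \<alpha>s \<longleftrightarrow> (\<forall>n. \<not> bad (monitor (prefix n w)))"
  unfolding bad_monitor using safe_monitor[OF safe_\<alpha>s, of C w] by (auto simp: C_def)

lemma \<alpha>s_refuted: "\<not> ltl_models w \<alpha>s \<Longrightarrow> \<exists>m. \<forall>n\<ge>m. bad (monitor (prefix n w))"
  unfolding bad_monitor by (rule safe_monitor_eventually[OF safe_\<alpha>s]) (auto simp: C_def)

lemma \<alpha>c_sat: "ltl_models w \<alpha>c \<longleftrightarrow> (\<exists>n. good (monitor (prefix n w)))"
  unfolding good_monitor using cosafe_monitor[OF cosafe_\<alpha>c, of C w] by (auto simp: C_def)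

end


context synthesis_spec begin

subsection \<open>A winning strategy puts the initial state into the winning region\<close>

definition outcome :: "('a set list \<Rightarrow> 'a set) \<Rightarrow> 'a set list \<Rightarrow> 'a set list" where
  "outcome \<sigma> u = map (\<lambda>i. u ! i \<union> \<sigma> (take (Suc i) u)) [0..<length u]"

lemma outcome_snoc: "outcome \<sigma> (u @ [I]) = outcome \<sigma> u @ [I \<union> \<sigma> (u @ [I])]"
  by (auto simp: outcome_def nth_append)

lemma outcome_prefix: "outcome \<sigma> (prefix n \<xi>) = prefix n (induced \<sigma> \<xi>)"
  by (induction n) (simp_all add: outcome_snoc prefix_Suc induced_def, simp add: outcome_def subsequence_def)

text \<open>Stopping depends on the finite history alone, but winning is defined on infinite inputs.
  The history is completed by empty input letters, and the unique stop of the resulting play is the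
  given one.\<close>

lemma spec_strategy_stop:
  assumes win: "spec_winning_strategy e X Y (LAnd \<alpha>s \<alpha>c) \<phi> \<sigma>"
    and u: "u \<in> lists (Pow X)" "I \<subseteq> X" and stop: "e \<in> \<sigma> (u @ [I])"
  shows "fulfilled (monitor (outcome \<sigma> (u @ [I])))"
proof -
  define \<xi> where "\<xi> = (u @ [I]) \<frown> (\<lambda>_. {})"
  have \<xi>: "range \<xi> \<subseteq> Pow X" unfolding \<xi>_def using u by (intro range_conc) auto
  have p: "prefix (Suc (length u)) \<xi> = u @ [I]"
    using prefix_conc_length[of "u @ [I]" "\<lambda>_. {}"] by (simp add: \<xi>_def)
  have "stops_at e \<sigma> \<xi> (Suc (length u))" using stop p by (simp add: stops_at_def)
  then have "ltlf_models (induced_finite e \<sigma> \<xi> (Suc (length u))) \<phi>"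
    using win \<xi> by (auto simp: spec_winning_strategy_def constrained_strategy_def Uniq_def) metis
  moreover have "induced_finite e \<sigma> \<xi> (Suc (length u)) = map (\<lambda>\<theta>. \<theta> - {e}) (outcome \<sigma> (u @ [I]))"
    using outcome_prefix[of \<sigma> \<xi> "Suc (length u)"] p by (simp add: induced_finite_def)
  ultimately show ?thesis using fulfilled_monitor monitor_remove_end by metis
qed

text \<open>Coinduction along the approximants: every history without a stop leads into each
  approximant of \<open>V\<close>. The crucial point is that such a state outside \<open>R\<close>
  cannot be good. Otherwise the environment could avoid \<open>R\<close> for ever, and with it both
  stopping and the falsity of \<alpha>s, although \<alpha>c is already satisfied.\<close>

lemma spec_strategy_in_V:
  assumes win: "spec_winning_strategy e X Y (LAnd \<alpha>s \<alpha>c) \<phi> \<sigma>"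
  shows "start \<in> set V"
proof -
  have strat: "\<sigma> u \<subseteq> Y \<union> {e}" if "u \<in> lists (Pow X)" for u
    using win that by (auto simp: spec_winning_strategy_def constrained_strategy_def strategy_def)
  define s where "s u = monitor (outcome \<sigma> u)" for u
  define live where "live u \<longleftrightarrow> u \<in> lists (Pow X) \<and> (\<forall>k. 1 \<le> k \<and> k \<le> length u \<longrightarrow> e \<notin> \<sigma> (take k u))" for u
  have live_snoc: "live (u @ [I])" if "live u" "I \<subseteq> X" "e \<notin> \<sigma> (u @ [I])" for u I
    using that unfolding live_def by (auto simp: le_Suc_eq)
  have sQ: "s u \<in> set Q" for u by (simp add: s_def monitor_in_Q)
  have stop: "s (u @ [I]) \<in> set R" if "live u" "I \<subseteq> X" "e \<in> \<sigma> (u @ [I])" for u I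
    using spec_strategy_stop[OF win, of u I] that sQ unfolding live_def
    by (auto simp: in_R won_def s_def)
  have s_snoc: "\<exists>U\<in>set Os. s (u @ [set I]) = move (s u) I U" if "live u" "I \<in> set Is" for u I
  proof -
    have I: "set I \<subseteq> set xs" using that(2) subseqs_subset by (auto simp: Is_def)
    then have IX: "set I \<subseteq> X" by (auto simp: set_xs)
    obtain U where U: "U \<in> set Os" "set U = \<sigma> (u @ [set I]) \<inter> set ys" using output_letter by blast
    have "\<sigma> (u @ [set I]) \<subseteq> Y \<union> {e}" using that IX by (intro strat) (auto simp: live_def)
    then have "step (set I \<union> \<sigma> (u @ [set I])) (s u) = move (s u) I U"
      using IX I U by (intro step_letter) auto
    then show ?thesis using U(1) by (auto simp: s_def outcome_snoc monitor_snoc)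
  qed
  have notgood: "\<not> good (s u)" if u: "live u" "s u \<notin> set R" for u
  proof
    assume good: "good (s u)"
    \<comment> \<open>The spoiling strategy of the environment: outside \<open>R\<close> there is an
      input that no output answers with a move into \<open>R\<close>.\<close>
    define nxt where "nxt v = set (SOME I. I \<in> set Is \<and> (\<forall>U\<in>set Os. move (s v) I U \<notin> set R))" for v
    have nxt: "live (v @ [nxt v]) \<and> s (v @ [nxt v]) \<notin> set R \<and> nxt v \<subseteq> X" if "live v" "s v \<notin> set R" for v
    proof -
      have "\<exists>I. I \<in> set Is \<and> (\<forall>U\<in>set Os. move (s v) I U \<notin> set R)"
        using that(2) sQ[of v] unfolding in_R[of "s v"] controllable_def by blast
      from someI_ex[OF this] obtain I where I: "I \<in> set Is" "\<forall>U\<in>set Os. move (s v) I U \<notin> set R" "nxt v = set I"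
        unfolding nxt_def by blast
      have "s (v @ [nxt v]) \<notin> set R" using s_snoc[OF that(1) I(1)] I by auto
      moreover have "nxt v \<subseteq> X" using I subseqs_subset[of I xs] by (auto simp: Is_def set_xs)
      ultimately show ?thesis using stop that(1) live_snoc by blast
    qed
    define v where "v n = ((\<lambda>v. v @ [nxt v]) ^^ n) u" for n
    have v_Suc: "v (Suc n) = v n @ [nxt (v n)]" and v_0: "v 0 = u" for n by (simp_all add: v_def)
    have v: "live (v n) \<and> s (v n) \<notin> set R" for n
      by (induction n) (use u nxt in \<open>auto simp: v_Suc v_0\<close>)
    have len: "length (v n) = length u + n" for n by (induction n) (auto simp: v_Suc v_0)
    define \<xi> where "\<xi> = u \<frown> (\<lambda>n. nxt (v n))"
    have pre: "prefix (length u + n) \<xi> = v n" for n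
    proof (induction n)
      case 0 then show ?case by (simp add: \<xi>_def v_0)
    next
      case (Suc n) then show ?case by (simp add: prefix_Suc v_Suc) (simp add: \<xi>_def conc_def)
    qed
    have \<xi>: "range \<xi> \<subseteq> Pow X" unfolding \<xi>_def
    proof (rule range_conc)
      show "u \<in> lists (Pow X)" using u(1) unfolding live_def by blast
      show "range (\<lambda>n. nxt (v n)) \<subseteq> Pow X" using v nxt by blast
    qed
    have nostop: "\<not> stops_at e \<sigma> \<xi> n" for n
    proof
      assume st: "stops_at e \<sigma> \<xi> n"
      have "take n (v n) = prefix n \<xi>" by (simp flip: pre)
      then show False using st v[of n] len[of n] unfolding live_def stops_at_def by auto
    qed
    have "ltl_models (induced \<sigma> \<xi>) \<alpha>s"
    proof (rule ccontr)
      assume "\<not> ltl_models (induced \<sigma> \<xi>) \<alpha>s"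
      then obtain m where "\<forall>n\<ge>m. bad (monitor (prefix n (induced \<sigma> \<xi>)))" using \<alpha>s_refuted by blast
      \<comment> \<open>The falsity shows at every length from \<open>m\<close> on, in particular at
        \<open>length u + m\<close>, where the input history is \<open>v m\<close>.\<close>
      then have "bad (s (v m))" unfolding s_def using outcome_prefix[of \<sigma> \<xi> "length u + m"] pre[of m] by simp
      then show False using v[of m] sQ in_R by (auto simp: won_def)
    qed
    moreover have "ltl_models (induced \<sigma> \<xi>) \<alpha>c"
      unfolding \<alpha>c_sat using good pre[of 0] outcome_prefix[of \<sigma> \<xi> "length u"] by (auto simp: s_def v_0)
    moreover have "\<not> ltl_models (induced \<sigma> \<xi>) (LAnd \<alpha>s \<alpha>c)"
      using win \<xi> nostop unfolding spec_winning_strategy_def by blast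
    ultimately show False by (simp add: ltl_models_def)
  qed
  have "s u \<in> set ((stay_step ^^ k) Q)" if "live u" for u k
    using that
  proof (induction k arbitrary: u)
    case 0 then show ?case by (simp add: sQ)
  next
    case (Suc k)
    \<comment> \<open>Stopping leads into \<open>R\<close>, and \<open>R\<close> is part of every
      approximant. So the next history may be either stopped or live.\<close>
    have R_sub: "set R \<subseteq> set ((stay_step ^^ k) Q)"
      using in_R by (cases k) (auto simp: in_stay_step)
    have "controllable move Is Os ((stay_step ^^ k) Q) (s u)"
      unfolding controllable_def
    proof
      fix I assume I: "I \<in> set Is"
      then have IX: "set I \<subseteq> X" using subseqs_subset[of I xs] by (auto simp: Is_def set_xs)
      have "s (u @ [set I]) \<in> set ((stay_step ^^ k) Q)"
        using stop[OF Suc.prems IX] live_snoc[OF Suc.prems IX] Suc.IH R_sub by blast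
      then show "\<exists>U\<in>set Os. move (s u) I U \<in> set ((stay_step ^^ k) Q)"
        using s_snoc[OF Suc.prems I] by auto
    qed
    then show ?case using notgood[OF Suc.prems] sQ by (auto simp: in_stay_step)
  qed
  from this[of "[]" "length Q"] show ?thesis
    by (simp add: live_def V_eq s_def start_monitor outcome_def)
qed

subsection \<open>The transducer wins from the winning region\<close>

abbreviation "\<sigma>M \<equiv> transducer_strategy (set xs) machine"

lemma trans_simps [simp]: "source (trans q I) = index_in q Q" "reads (trans q I) = I"
  by (simp_all add: trans_def Let_def)

text \<open>\<open>Q\<close> may list a state several times. \<open>index_in\<close> numbers it by
  its first occurrence, so whichever matching transition is found first belongs to the same
  state.\<close>

lemma transducer_step_state:
  assumes "q \<in> set Q"
  obtains I' where "I' \<in> set Is" "set I' = I \<inter> set xs"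
    "transducer_step (set xs) (snd machine) (index_in q Q) I =
       (set (writes (trans q I')), target (trans q I'))"
proof -
  let ?P = "\<lambda>\<tau>. source \<tau> = index_in q Q \<and> set (reads \<tau>) = I \<inter> set xs"
  obtain I0 where "I0 \<in> set Is" "set I0 = I \<inter> set xs" using input_letter by blast
  then have "trans q I0 \<in> set (snd machine)" "?P (trans q I0)"
    using assms by (auto simp: machine_def)
  then have "find ?P (snd machine) \<noteq> None" unfolding find_None_iff by blast
  then obtain \<tau> where \<tau>: "find ?P (snd machine) = Some \<tau>" by blast
  then have "\<tau> \<in> set (snd machine)" "?P \<tau>" by (auto simp: find_Some_iff)
  then obtain q' I' where q': "q' \<in> set Q" "I' \<in> set Is" "\<tau> = trans q' I'"
    "index_in q' Q = index_in q Q" "set I' = I \<inter> set xs"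
    by (auto simp: machine_def)
  then have "q' = q" using index_in_inject[of q Q q'] assms by simp
  then show ?thesis using that[of I'] q' \<tau> by (simp add: transducer_step_def)
qed

lemma transducer_step_dead:
  "transducer_step (set xs) (snd machine) (length Q) I = ({}, length Q)"
proof -
  have "find (\<lambda>\<tau>. source \<tau> = length Q \<and> set (reads \<tau>) = I \<inter> set xs) (snd machine) = None"
    unfolding find_None_iff machine_def using index_in_less by fastforce
  then show ?thesis by (simp add: transducer_step_def)
qed

lemma choice_subset: "set (choice q I) \<subseteq> set ys"
proof -
  have "choice q I = [] \<or> choice q I \<in> set Os"
    by (auto simp: choice_def find_Some_iff split: option.splits)
  then show ?thesis using subseqs_subset[of "choice q I" ys] by (auto simp: Os_def)
qed

lemma machine_strategy: "strategy X (Y \<union> {e}) \<sigma>M"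
proof -
  have w: "set (writes (trans q I)) \<subseteq> Y \<union> {e}" for q I
    using choice_subset[of q I] set_ys by (auto simp: trans_def Let_def)
  have "fst (transducer_step (set xs) (snd machine) p I) \<subseteq> Y \<union> {e}" for p I
  proof (cases "find (\<lambda>\<tau>. source \<tau> = p \<and> set (reads \<tau>) = I \<inter> set xs) (snd machine)")
    case (Some \<tau>)
    then have "\<tau> \<in> set (snd machine)" by (auto simp: find_Some_iff)
    then show ?thesis using w Some by (auto simp: transducer_step_def machine_def)
  qed (simp add: transducer_step_def)
  then have "\<sigma>M u \<subseteq> Y \<union> {e}" for u
    by (cases u rule: rev_cases) (simp_all add: transducer_strategy_def case_prod_beta)
  then show ?thesis by (simp add: strategy_def)
qed

text \<open>The invariant \<open>ok\<close> says that the transducer tracks the table, stays in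
  \<open>V\<close>, has met no won state and has not stopped. If it holds for ever, the play avoids
  \<open>R\<close>, because inside \<open>R\<close> the rank would fall to the empty approximant;
  then no state is good and \<alpha>c fails. If it breaks, it does so at a won state, where the play
  stops successfully or \<alpha>s is falsified.\<close>

lemma machine_wins:
  assumes V: "start \<in> set V"
  shows "spec_winning_strategy e X Y (LAnd \<alpha>s \<alpha>c) \<phi> \<sigma>M"
proof -
  have main: "(\<exists>\<^sub>\<le>\<^sub>1 n. stops_at e \<sigma>M \<xi> n) \<and>
      ((\<nexists>n. stops_at e \<sigma>M \<xi> n) \<and> \<not> ltl_models (induced \<sigma>M \<xi>) (LAnd \<alpha>s \<alpha>c) \<or>
       (\<exists>n. stops_at e \<sigma>M \<xi> n \<and> ltlf_models (induced_finite e \<sigma>M \<xi> n) \<phi>))"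
    if \<xi>: "range \<xi> \<subseteq> Pow X" for \<xi>
  proof -
    define c where "c n = foldl (\<lambda>(out, q) I. transducer_step (set xs) (snd machine) q I)
        ({}, fst machine) (prefix n \<xi>)" for n
    define w where "w = induced \<sigma>M \<xi>"
    define s where "s n = monitor (prefix n w)" for n
    have c_Suc: "c (Suc n) = transducer_step (set xs) (snd machine) (snd (c n)) (\<xi> n)" for n
      by (simp add: c_def prefix_Suc split: prod.splits)
    have \<sigma>_c: "\<sigma>M (prefix n \<xi>) = fst (c n)" for n by (simp add: transducer_strategy_def c_def)
    have w_n: "w n = \<xi> n \<union> fst (c (Suc n))" for n by (simp only: w_def induced_def \<sigma>_c)
    have s_Suc: "s (Suc n) = step (w n) (s n)" for n by (simp add: s_def prefix_Suc monitor_snoc)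
    have sQ: "s n \<in> set Q" for n by (simp add: s_def monitor_in_Q)
    have st: "stops_at e \<sigma>M \<xi> n \<longleftrightarrow> (\<exists>i. n = Suc i \<and> e \<in> fst (c (Suc i)))" for n
      unfolding stops_at_def \<sigma>_c by (cases n) auto
    have fin: "ltlf_models (induced_finite e \<sigma>M \<xi> n) \<phi> \<longleftrightarrow> fulfilled (s n)" for n
      using fulfilled_monitor monitor_remove_end by (simp add: induced_finite_def s_def w_def) metis
    define ok where "ok n \<longleftrightarrow> snd (c n) = index_in (s n) Q \<and> s n \<in> set V \<and> \<not> won (s n) \<and>
        (\<forall>i<n. e \<notin> fst (c (Suc i)))" for n
    have ok0: "ok 0"
      using V not_won_start by (simp add: ok_def s_def c_def machine_def start_monitor subsequence_def)
    have step: "s (Suc n) \<in> set V \<and> (e \<in> fst (c (Suc n)) \<longleftrightarrow> fulfilled (s (Suc n))) \<and>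
        snd (c (Suc n)) = (if won (s (Suc n)) then length Q else index_in (s (Suc n)) Q) \<and>
        (\<forall>k<length Q. s n \<in> set (Rk (Suc k)) \<longrightarrow> s (Suc n) \<in> set (Rk k))" if ok: "ok n" for n
    proof -
      obtain I where I: "I \<in> set Is" "set I = \<xi> n \<inter> set xs"
        and c': "c (Suc n) = (set (writes (trans (s n) I)), target (trans (s n) I))"
        using transducer_step_state[OF sQ[of n], of "\<xi> n"] ok c_Suc[of n] unfolding ok_def by metis
      have e_ys: "e \<notin> set (choice (s n) I)" using choice_subset[of "s n" I] e_fresh set_ys by auto
      have "s (Suc n) = move (s n) I (choice (s n) I)"
        unfolding s_Suc w_n c'
      proof (simp, rule step_letter)
        show "\<xi> n \<subseteq> X" using \<xi> by auto
        show "set (writes (trans (s n) I)) \<subseteq> Y \<union> {e}"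
          using choice_subset[of "s n" I] set_ys by (auto simp: trans_def Let_def)
        show "set (choice (s n) I) = set (writes (trans (s n) I)) \<inter> set ys"
          using choice_subset[of "s n" I] e_fresh set_ys by (auto simp: trans_def Let_def)
      qed (rule I(2))
      then show ?thesis
        using choice_props[OF _ _ I(1), of "s n"] ok e_ys c' unfolding ok_def
        by (simp add: trans_def Let_def)
    qed
    show ?thesis
    proof (cases "\<forall>n. ok n")
      case True
      have "s n \<notin> set (Rk k)" if "k \<le> length Q" for k n
        using that
      proof (induction k arbitrary: n)
        case (Suc k)
        then show ?case using step[of n] True by (meson Suc_le_lessD less_imp_le)
      qed simp
      then have "\<not> good (s n)" for n
        using True in_V[of "s n"] unfolding ok_def R_eq by blast
      then have "\<not> ltl_models w \<alpha>c" unfolding \<alpha>c_sat by (simp add: s_def)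
      moreover have "\<not> stops_at e \<sigma>M \<xi> n" for n
        using True unfolding st ok_def by blast
      ultimately show ?thesis by (simp add: w_def ltl_models_def Uniq_def)
    next
      case False
      then obtain n where n: "ok n" "\<not> ok (Suc n)" using ok0 by (metis nat_induct)
      have won: "won (s (Suc n))"
        using n step[OF n(1)] unfolding ok_def by (auto simp: less_Suc_eq won_def)
      \<comment> \<open>From the first won state on the transducer is silent, which excludes a
        second \<open>end\<close>.\<close>
      have dead: "snd (c (Suc n + k)) = length Q" for k
        by (induction k) (use won step[OF n(1)] in \<open>auto simp: c_Suc transducer_step_dead\<close>)
      have later: "e \<notin> fst (c (Suc i))" if "i > n" for i
        using dead[of "i - Suc n"] that by (simp add: c_Suc[of i] transducer_step_dead)
      have e_iff: "e \<in> fst (c (Suc i)) \<longleftrightarrow> i = n \<and> fulfilled (s (Suc n))" for i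
        using later[of i] n(1) step[OF n(1)] unfolding ok_def by (metis linorder_neqE_nat)
      then have uniq: "\<exists>\<^sub>\<le>\<^sub>1 n. stops_at e \<sigma>M \<xi> n" by (auto simp: st Uniq_def)
      show ?thesis
      proof (cases "fulfilled (s (Suc n))")
        case True
        then have "stops_at e \<sigma>M \<xi> (Suc n)" by (simp add: st e_iff)
        then show ?thesis using uniq True fin[of "Suc n"] by blast
      next
        case F: False
        then have "bad (s (Suc n))" using won by (simp add: won_def)
        then have "\<not> ltl_models w \<alpha>s" unfolding \<alpha>s_sat s_def by blast
        then show ?thesis using uniq F by (auto simp: st e_iff w_def ltl_models_def)
      qed
    qed
  qed
  then show ?thesis using machine_strategy
    unfolding spec_winning_strategy_def constrained_strategy_def by blast
qed

lemma realizable_iff_start: "realizable e X Y (LAnd \<alpha>s \<alpha>c) \<phi> \<longleftrightarrow> start \<in> set V"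
  using spec_strategy_in_V machine_wins unfolding realizable_def by blast

end


section \<open>Time-bounded execution\<close>

fun expr_size :: "expr \<Rightarrow> nat" and exprs_size :: "expr list \<Rightarrow> nat" where
  "expr_size (Var i) = 1"
| "expr_size ENil = 1"
| "expr_size (EPair a b) = expr_size a + expr_size b + 1"
| "expr_size (EFst a) = expr_size a + 1"
| "expr_size (ESnd a) = expr_size a + 1"
| "expr_size (EIsPair a) = expr_size a + 1"
| "expr_size (EEqAtom a b) = expr_size a + expr_size b + 1"
| "expr_size (EIf a b c) = expr_size a + expr_size b + expr_size c + 1"
| "expr_size (ELet a b) = expr_size a + expr_size b + 1"
| "expr_size (ECall f as) = exprs_size as + 1"
| "exprs_size [] = 0"
| "exprs_size (a # as) = expr_size a + exprs_size as"

text \<open>Calls stay opaque during symbolic execution: a recursive body is unfolded once, and the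
  known facts about its calls are then rewritten in.\<close>

definition exec_call :: "expr list \<Rightarrow> nat \<Rightarrow> 'a val list \<Rightarrow> ('a val \<Rightarrow> nat \<Rightarrow> bool) \<Rightarrow> bool" where
  "exec_call fs f us P \<longleftrightarrow> f < length fs \<and> (\<exists>v t. eval fs us (fs ! f) v t \<and> P v t)"

text \<open>Symbolic execution with a postcondition on the result and on the total time of the calls;
  the remaining evaluation steps are accounted for by the size of the expression.\<close>

fun exec :: "expr list \<Rightarrow> 'a val list \<Rightarrow> expr \<Rightarrow> ('a val \<Rightarrow> nat \<Rightarrow> bool) \<Rightarrow> bool"
  and execs :: "expr list \<Rightarrow> 'a val list \<Rightarrow> expr list \<Rightarrow> ('a val list \<Rightarrow> nat \<Rightarrow> bool) \<Rightarrow> bool" where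
  "exec fs \<rho> (Var i) P \<longleftrightarrow> i < length \<rho> \<and> P (\<rho> ! i) 0"
| "exec fs \<rho> ENil P \<longleftrightarrow> P VNil 0"
| "exec fs \<rho> (EPair a b) P \<longleftrightarrow> exec fs \<rho> a (\<lambda>u s. exec fs \<rho> b (\<lambda>v t. P (VPair u v) (s + t)))"
| "exec fs \<rho> (EFst a) P \<longleftrightarrow> exec fs \<rho> a (\<lambda>u s. P (val_fst u) s)"
| "exec fs \<rho> (ESnd a) P \<longleftrightarrow> exec fs \<rho> a (\<lambda>u s. P (val_snd u) s)"
| "exec fs \<rho> (EIsPair a) P \<longleftrightarrow> exec fs \<rho> a (\<lambda>u s. P (bool_val (\<exists>v w. u = VPair v w)) s)"
| "exec fs \<rho> (EEqAtom a b) P \<longleftrightarrow>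
     exec fs \<rho> a (\<lambda>u s. exec fs \<rho> b (\<lambda>v t. P (bool_val (\<exists>x. u = VAtom x \<and> v = VAtom x)) (s + t)))"
| "exec fs \<rho> (EIf c a b) P \<longleftrightarrow>
     exec fs \<rho> c (\<lambda>u s. if u = VNil then exec fs \<rho> b (\<lambda>v t. P v (s + t))
                        else exec fs \<rho> a (\<lambda>v t. P v (s + t)))"
| "exec fs \<rho> (ELet a b) P \<longleftrightarrow> exec fs \<rho> a (\<lambda>u s. exec fs (u # \<rho>) b (\<lambda>v t. P v (s + t)))"
| "exec fs \<rho> (ECall f as) P \<longleftrightarrow> execs fs \<rho> as (\<lambda>us s. exec_call fs f us (\<lambda>v t. P v (s + t)))"
| "execs fs \<rho> [] P \<longleftrightarrow> P [] 0"
| "execs fs \<rho> (a # as) P \<longleftrightarrow> exec fs \<rho> a (\<lambda>u s. execs fs \<rho> as (\<lambda>us t. P (u # us) (s + t)))"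

text \<open>An activation contains no loop, so each of its subexpressions is evaluated at most once.
  Hence the size of the expression pays for all steps outside the calls.\<close>

lemma exec_sound:
  "exec fs \<rho> a P \<Longrightarrow> \<exists>v t T. eval fs \<rho> a v t \<and> t \<le> expr_size a + T \<and> P v T"
  "execs fs \<rho> as P' \<Longrightarrow> \<exists>vs t T. evals fs \<rho> as vs t \<and> t \<le> exprs_size as + T \<and> P' vs T"
proof (induction fs \<rho> a P and fs \<rho> as P' rule: exec_execs.induct)
  case (1 fs \<rho> i P)
  then show ?case using eval_Var[of i \<rho> fs] by fastforce
next
  case (2 fs \<rho> P)
  then show ?case using eval_Nil[of fs \<rho>] by fastforce
next
  case (3 fs \<rho> a b P)
  then obtain u s S where 1: "eval fs \<rho> a u s" "s \<le> expr_size a + S"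
    "exec fs \<rho> b (\<lambda>v t. P (VPair u v) (S + t))" by auto
  with 3 obtain v t T where "eval fs \<rho> b v t" "t \<le> expr_size b + T" "P (VPair u v) (S + T)" by blast
  with 1 have "eval fs \<rho> (EPair a b) (VPair u v) (s + t + 1) \<and> s + t + 1 \<le> expr_size (EPair a b) + (S + T) \<and> P (VPair u v) (S + T)"
    using eval_Pair[of fs \<rho> a u s b v t] by simp
  then show ?case by blast
next
  case (4 fs \<rho> a P)
  then obtain u s S where "eval fs \<rho> a u s" "s \<le> expr_size a + S" "P (val_fst u) S" by auto
  then show ?case using eval_Fst[of fs \<rho> a u s] by fastforce
next
  case (5 fs \<rho> a P)
  then obtain u s S where "eval fs \<rho> a u s" "s \<le> expr_size a + S" "P (val_snd u) S" by auto
  then show ?case using eval_Snd[of fs \<rho> a u s] by fastforce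
next
  case (6 fs \<rho> a P)
  then obtain u s S where "eval fs \<rho> a u s" "s \<le> expr_size a + S"
    "P (bool_val (\<exists>v w. u = VPair v w)) S" by auto
  then show ?case using eval_IsPair[of fs \<rho> a u s] by fastforce
next
  case (7 fs \<rho> a b P)
  then obtain u s S where 1: "eval fs \<rho> a u s" "s \<le> expr_size a + S"
    "exec fs \<rho> b (\<lambda>v t. P (bool_val (\<exists>x. u = VAtom x \<and> v = VAtom x)) (S + t))" by auto
  with 7 obtain v t T where "eval fs \<rho> b v t" "t \<le> expr_size b + T"
    "P (bool_val (\<exists>x. u = VAtom x \<and> v = VAtom x)) (S + T)" by blast
  with 1 have "eval fs \<rho> (EEqAtom a b) (bool_val (\<exists>x. u = VAtom x \<and> v = VAtom x)) (s + t + 1) \<and> s + t + 1 \<le> expr_size (EEqAtom a b) + (S + T) \<and> P (bool_val (\<exists>x. u = VAtom x \<and> v = VAtom x)) (S + T)"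
    using eval_EqAtom[of fs \<rho> a u s b v t] by simp
  then show ?case by blast
next
  case (8 fs \<rho> c a b P)
  from "8.IH"(3) "8.prems" obtain u s S where 1: "eval fs \<rho> c u s" "s \<le> expr_size c + S"
    "if u = VNil then exec fs \<rho> b (\<lambda>v t. P v (S + t)) else exec fs \<rho> a (\<lambda>v t. P v (S + t))" by auto
  show ?case
  proof (cases "u = VNil")
    case True
    with 1 "8.IH"(1) obtain v t T where "eval fs \<rho> b v t" "t \<le> expr_size b + T" "P v (S + T)"
      by (metis (no_types, lifting))
    with 1 True have "eval fs \<rho> (EIf c a b) v (s + t + 1) \<and> s + t + 1 \<le> expr_size (EIf c a b) + (S + T) \<and> P v (S + T)"
      using eval_IfFalse[of fs \<rho> c s b v t a] by simp
    then show ?thesis by blast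
  next
    case False
    with 1 "8.IH"(2) obtain v t T where "eval fs \<rho> a v t" "t \<le> expr_size a + T" "P v (S + T)"
      by (metis (no_types, lifting))
    with 1 False have "eval fs \<rho> (EIf c a b) v (s + t + 1) \<and> s + t + 1 \<le> expr_size (EIf c a b) + (S + T) \<and> P v (S + T)"
      using eval_IfTrue[of fs \<rho> c u s a v t b] by simp
    then show ?thesis by blast
  qed
next
  case (9 fs \<rho> a b P)
  then obtain u s S where 1: "eval fs \<rho> a u s" "s \<le> expr_size a + S"
    "exec fs (u # \<rho>) b (\<lambda>v t. P v (S + t))" by auto
  with 9 obtain v t T where "eval fs (u # \<rho>) b v t" "t \<le> expr_size b + T" "P v (S + T)" by blast
  with 1 have "eval fs \<rho> (ELet a b) v (s + t + 1) \<and> s + t + 1 \<le> expr_size (ELet a b) + (S + T) \<and> P v (S + T)"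
    using eval_Let[of fs \<rho> a u s b v t] by simp
  then show ?case by blast
next
  case (10 fs \<rho> f as P)
  then obtain us s S where 1: "evals fs \<rho> as us s" "s \<le> exprs_size as + S"
    "exec_call fs f us (\<lambda>v t. P v (S + t))" by auto
  then obtain v t where "f < length fs" "eval fs us (fs ! f) v t" "P v (S + t)"
    by (auto simp: exec_call_def)
  with 1 have "eval fs \<rho> (ECall f as) v (s + t + 1) \<and> s + t + 1 \<le> expr_size (ECall f as) + (S + t) \<and> P v (S + t)"
    using eval_Call[of fs \<rho> as us s f v t] by simp
  then show ?case by blast
next
  case (11 fs \<rho> P)
  then show ?case using evals_Nil[of fs \<rho>] by fastforce
next
  case (12 fs \<rho> a as P)
  then obtain u s S where 1: "eval fs \<rho> a u s" "s \<le> expr_size a + S"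
    "execs fs \<rho> as (\<lambda>us t. P (u # us) (S + t))" by auto
  with 12 obtain us t T where "evals fs \<rho> as us t" "t \<le> exprs_size as + T" "P (u # us) (S + T)" by blast
  with 1 have "evals fs \<rho> (a # as) (u # us) (s + t) \<and> s + t \<le> exprs_size (a # as) + (S + T) \<and> P (u # us) (S + T)"
    using evals_Cons[of fs \<rho> a u s as us t] by simp
  then show ?case by blast
qed

definition call :: "expr list \<Rightarrow> nat \<Rightarrow> 'a val list \<Rightarrow> 'a val \<Rightarrow> nat \<Rightarrow> bool" where
  "call fs f us v T \<longleftrightarrow> f < length fs \<and> (\<exists>t\<le>T. eval fs us (fs ! f) v t)"

text \<open>Evaluation is deterministic, so the time of a call can be named exactly. Symbolic
  execution then yields a sum of such names, and their upper bounds are supplied afterwards as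
  linear inequalities.\<close>

definition call_time :: "expr list \<Rightarrow> nat \<Rightarrow> 'a val list \<Rightarrow> nat" where
  "call_time fs f us = (THE t. \<exists>v. eval fs us (fs ! f) v t)"

lemma callI:
  assumes "f < length fs"
    "exec fs us (fs ! f) (\<lambda>v' t. v' = v \<and> expr_size (fs ! f) + t \<le> T)"
  shows "call fs f us v T"
  using assms exec_sound(1)[OF assms(2)] unfolding call_def by (meson order_trans)

lemma call_mono: "call fs f us v T \<Longrightarrow> T \<le> T' \<Longrightarrow> call fs f us v T'"
  unfolding call_def by (meson order_trans)

lemma callD:
  assumes "call fs f us v T"
  shows "(\<forall>P. exec_call fs f us P = P v (call_time fs f us)) \<and> call_time fs f us \<le> T"
proof -
  from assms obtain t where t: "f < length fs" "t \<le> T" "eval fs us (fs ! f) v t"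
    unfolding call_def by blast
  then have uniq: "v' = v \<and> t' = t" if "eval fs us (fs ! f) v' t'" for v' t'
    using that eval_deterministic(1) by blast
  then have "call_time fs f us = t" unfolding call_time_def using t(3) by (intro the_equality) blast+
  then show ?thesis unfolding exec_call_def using t uniq by metis
qed

lemma call_exec: "call fs f us v T \<Longrightarrow> exec_call fs f us P = P v (call_time fs f us)"
  and call_time_le: "call fs f us v T \<Longrightarrow> call_time fs f us \<le> T"
  using callD by blast+

text \<open>Any value but \<open>VNil\<close> counts as true, so a search that returns what it has
  found can serve as a test.\<close>

definition callb :: "expr list \<Rightarrow> nat \<Rightarrow> 'a val list \<Rightarrow> bool \<Rightarrow> nat \<Rightarrow> bool" where
  "callb fs f us b T \<longleftrightarrow> (\<exists>v. call fs f us v T \<and> (v \<noteq> VNil \<longleftrightarrow> b))"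

lemma callb_bool_val: "call fs f us (bool_val b) T \<Longrightarrow> callb fs f us b T"
  unfolding callb_def by (intro exI[of _ "bool_val b"]) (simp add: bool_val_def)

abbreviation ETrue :: expr where "ETrue \<equiv> EPair ENil ENil"

lemma bool_val_simps [simp]: "bool_val True = VPair VNil VNil" "bool_val False = VNil"
  "bool_val b = VNil \<longleftrightarrow> \<not> b"
  by (simp_all add: bool_val_def)

section \<open>Loop schemes over encoded lists\<close>

definition filter_body :: "nat \<Rightarrow> nat \<Rightarrow> expr" where
  "filter_body f g = EIf (EIsPair (Var 0))
     (EIf (ECall g [EFst (Var 0), Var 1])
        (EPair (EFst (Var 0)) (ECall f [ESnd (Var 0), Var 1]))
        (ECall f [ESnd (Var 0), Var 1]))
     ENil"

definition map_body :: "nat \<Rightarrow> nat \<Rightarrow> expr" where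
  "map_body f g = EIf (EIsPair (Var 0))
     (EPair (ECall g [EFst (Var 0), Var 1]) (ECall f [ESnd (Var 0), Var 1]))
     ENil"

definition all_body :: "nat \<Rightarrow> nat \<Rightarrow> expr" where
  "all_body f g = EIf (EIsPair (Var 0))
     (EIf (ECall g [EFst (Var 0), Var 1]) (ECall f [ESnd (Var 0), Var 1]) ENil)
     ETrue"

definition find_body :: "nat \<Rightarrow> nat \<Rightarrow> expr" where
  "find_body f g = EIf (EIsPair (Var 0))
     (EIf (ECall g [EFst (Var 0), Var 1]) (EPair (EFst (Var 0)) ENil) (ECall f [ESnd (Var 0), Var 1]))
     ENil"

definition concat_map_body :: "nat \<Rightarrow> nat \<Rightarrow> nat \<Rightarrow> expr" where
  "concat_map_body f g h = EIf (EIsPair (Var 0))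
     (ECall h [ECall g [EFst (Var 0), Var 1], ECall f [ESnd (Var 0), Var 1]])
     ENil"

fun option_val :: "'a val option \<Rightarrow> 'a val" where
  "option_val None = VNil"
| "option_val (Some v) = VPair v VNil"

text \<open>Each entry costs one call of \<open>g\<close> and one activation of the loop body. The
  constant 20 is the size of \<open>filter_body\<close>, the largest of the five schemes, and one
  more round pays for the final test on the empty list.\<close>

lemma call_filter:
  assumes f: "f < length fs" "fs ! f = filter_body f g"
    and g: "\<And>x. x \<in> set l \<Longrightarrow> callb fs g [enc x, c] (P x) T"
  shows "call fs f [list_val (map enc l), c] (list_val (map enc (filter P l))) ((T + 20) * (length l + 1))"
  using g
proof (induction l)
  case Nil
  show ?case by (rule callI) (use f in \<open>simp_all add: filter_body_def\<close>)
next
  case (Cons x l)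
  then have IH: "call fs f [list_val (map enc l), c] (list_val (map enc (filter P l))) ((T + 20) * (length l + 1))"
    by simp
  obtain v where v: "call fs g [enc x, c] v T" "v \<noteq> VNil \<longleftrightarrow> P x"
    using Cons.prems[of x] by (auto simp: callb_def)
  show ?case
    by (rule callI) (use f callD[OF IH] callD[OF v(1)] v(2) in \<open>auto simp: filter_body_def algebra_simps\<close>)
qed

lemma call_map:
  assumes f: "f < length fs" "fs ! f = map_body f g"
    and g: "\<And>x. x \<in> set l \<Longrightarrow> call fs g [enc x, c] (h x) T"
  shows "call fs f [list_val (map enc l), c] (list_val (map h l)) ((T + 20) * (length l + 1))"
  using g
proof (induction l)
  case Nil
  show ?case by (rule callI) (use f in \<open>simp_all add: map_body_def\<close>)
next
  case (Cons x l)
  then have IH: "call fs f [list_val (map enc l), c] (list_val (map h l)) ((T + 20) * (length l + 1))"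
    by simp
  have v: "call fs g [enc x, c] (h x) T" using Cons.prems by simp
  show ?case
    by (rule callI) (use f callD[OF IH] callD[OF v] in \<open>auto simp: map_body_def algebra_simps\<close>)
qed

lemma call_all:
  assumes f: "f < length fs" "fs ! f = all_body f g"
    and g: "\<And>x. x \<in> set l \<Longrightarrow> callb fs g [enc x, c] (P x) T"
  shows "call fs f [list_val (map enc l), c] (bool_val (\<forall>x\<in>set l. P x)) ((T + 20) * (length l + 1))"
  using g
proof (induction l)
  case Nil
  show ?case by (rule callI) (use f in \<open>simp_all add: all_body_def\<close>)
next
  case (Cons x l)
  then have IH: "call fs f [list_val (map enc l), c] (bool_val (\<forall>x\<in>set l. P x)) ((T + 20) * (length l + 1))"
    by simp
  obtain v where v: "call fs g [enc x, c] v T" "v \<noteq> VNil \<longleftrightarrow> P x"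
    using Cons.prems[of x] by (auto simp: callb_def)
  show ?case
  proof (cases "P x")
    case True
    then show ?thesis
      by (intro callI) (use f callD[OF IH] callD[OF v(1)] v(2) in \<open>auto simp: all_body_def algebra_simps\<close>)
  next
    case False
    then show ?thesis
      by (intro callI) (use f callD[OF v(1)] v(2) in \<open>simp_all add: all_body_def algebra_simps\<close>)
  qed
qed

lemma call_find:
  assumes f: "f < length fs" "fs ! f = find_body f g"
    and g: "\<And>x. x \<in> set l \<Longrightarrow> callb fs g [enc x, c] (P x) T"
  shows "call fs f [list_val (map enc l), c] (option_val (map_option enc (find P l))) ((T + 20) * (length l + 1))"
  using g
proof (induction l)
  case Nil
  show ?case by (rule callI) (use f in \<open>simp_all add: find_body_def\<close>)
next
  case (Cons x l)
  then have IH: "call fs f [list_val (map enc l), c] (option_val (map_option enc (find P l))) ((T + 20) * (length l + 1))"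
    by simp
  obtain v where v: "call fs g [enc x, c] v T" "v \<noteq> VNil \<longleftrightarrow> P x"
    using Cons.prems[of x] by (auto simp: callb_def)
  show ?case
    by (rule callI) (use f callD[OF IH] callD[OF v(1)] v(2) in \<open>auto simp: find_body_def algebra_simps\<close>)
qed

lemma call_concat_map:
  assumes f: "f < length fs" "fs ! f = concat_map_body f g a"
    and g: "\<And>x. x \<in> set l \<Longrightarrow> call fs g [enc x, c] (list_val (h x)) T"
    and a: "\<And>x u. x \<in> set l \<Longrightarrow> call fs a [list_val (h x), list_val u] (list_val (h x @ u)) T"
  shows "call fs f [list_val (map enc l), c] (list_val (concat (map h l))) ((2 * T + 20) * (length l + 1))"
  using g a
proof (induction l)
  case Nil
  show ?case by (rule callI) (use f in \<open>simp_all add: concat_map_body_def\<close>)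
next
  case (Cons x l)
  then have IH: "call fs f [list_val (map enc l), c] (list_val (concat (map h l))) ((2 * T + 20) * (length l + 1))"
    by simp
  have v: "call fs g [enc x, c] (list_val (h x)) T"
    "call fs a [list_val (h x), list_val (concat (map h l))] (list_val (h x @ concat (map h l))) T"
    using Cons.prems by simp_all
  show ?case
    by (rule callI) (use f callD[OF IH] v[THEN callD] in \<open>auto simp: concat_map_body_def algebra_simps\<close>)
qed


section \<open>The synthesis program\<close>

datatype fn = FEq | FMem | FAppend | FCons | FMapCons | FSubseqs | FSub | FHolds | FBit | FPull
  | FStepP | FStep | FStartP | FStart | FMoveIn | FFindU | FCtrlI | FCtrl | FAttractP | FAttract
  | FStages | FLast | FWonP | FWon | FStayP | FStay | FReleaseP | FRelease | FIndex | FCtrlZ | FFindZ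
  | FTrans | FMapTrans | FTransQ | FAllTrans | FSetup | FReach | FRegion

definition fns :: "fn list" where
  "fns = [FEq, FMem, FAppend, FCons, FMapCons, FSubseqs, FSub, FHolds, FBit, FPull,
    FStepP, FStep, FStartP, FStart, FMoveIn, FFindU, FCtrlI, FCtrl, FAttractP, FAttract,
    FStages, FLast, FWonP, FWon, FStayP, FStay, FReleaseP, FRelease, FIndex, FCtrlZ, FFindZ,
    FTrans, FMapTrans, FTransQ, FAllTrans, FSetup, FReach, FRegion]"

definition ix :: "fn \<Rightarrow> nat" where "ix f = index_in f fns"

abbreviation CALL :: "fn \<Rightarrow> expr list \<Rightarrow> expr" where "CALL f as \<equiv> ECall (ix f) as"

abbreviation child1 :: "expr \<Rightarrow> expr" where "child1 v \<equiv> EFst (ESnd v)"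
abbreviation child2 :: "expr \<Rightarrow> expr" where "child2 v \<equiv> EFst (ESnd (ESnd v))"

text \<open>Constructor tags are unary numbers, so the case distinction peels off one pair per
  alternative.\<close>

fun dispatch :: "expr \<Rightarrow> expr list \<Rightarrow> expr" where
  "dispatch t [] = ENil"
| "dispatch t (b # bs) = EIf t (dispatch (ESnd t) bs) b"

text \<open>The first component is the unary tag 6 of \<open>LNext\<close>.\<close>

abbreviation ENext :: "expr \<Rightarrow> expr" where
  "ENext a \<equiv> EPair (EPair ENil (EPair ENil (EPair ENil (EPair ENil (EPair ENil (EPair ENil ENil))))))
     (EPair a ENil)"

text \<open>Components of the constant part of the contexts: states, table rows, closure, input letters,
  output letters, end, the three root formulas, and the row for the end of a finite trace.\<close>

abbreviation "gQ g \<equiv> EFst g"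
abbreviation "gD g \<equiv> EFst (ESnd g)"
abbreviation "gC g \<equiv> EFst (ESnd (ESnd g))"
abbreviation "gI g \<equiv> EFst (ESnd (ESnd (ESnd g)))"
abbreviation "gO g \<equiv> EFst (ESnd (ESnd (ESnd (ESnd g))))"
abbreviation "gE g \<equiv> EFst (ESnd (ESnd (ESnd (ESnd (ESnd g)))))"
abbreviation "gRs g \<equiv> EFst (ESnd (ESnd (ESnd (ESnd (ESnd (ESnd g))))))"
abbreviation "gRc g \<equiv> EFst (ESnd (ESnd (ESnd (ESnd (ESnd (ESnd (ESnd g)))))))"
abbreviation "gRg g \<equiv> EFst (ESnd (ESnd (ESnd (ESnd (ESnd (ESnd (ESnd (ESnd g))))))))"
abbreviation "gF g \<equiv> EFst (ESnd (ESnd (ESnd (ESnd (ESnd (ESnd (ESnd (ESnd (ESnd g)))))))))"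

text \<open>Every function takes a value and a context, so that \<open>filter_body\<close> and the other loop
  schemes apply uniformly.\<close>

fun body :: "fn \<Rightarrow> expr" where
  "body FEq = EIf (EIsPair (Var 0))
     (EIf (EIsPair (Var 1))
        (EIf (CALL FEq [EFst (Var 0), EFst (Var 1)]) (CALL FEq [ESnd (Var 0), ESnd (Var 1)]) ENil)
        ENil)
     (EIf (Var 0) (EEqAtom (Var 0) (Var 1)) (EIf (Var 1) ENil ETrue))"
| "body FMem = EIf (EIsPair (Var 1))
     (EIf (CALL FEq [Var 0, EFst (Var 1)]) ETrue (CALL FMem [Var 0, ESnd (Var 1)]))
     ENil"
| "body FAppend = EIf (EIsPair (Var 0))
     (EPair (EFst (Var 0)) (CALL FAppend [ESnd (Var 0), Var 1]))
     (Var 1)"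
| "body FCons = EPair (Var 1) (Var 0)"
| "body FMapCons = map_body (ix FMapCons) (ix FCons)"
| "body FSubseqs = EIf (EIsPair (Var 0))
     (ELet (CALL FSubseqs [ESnd (Var 0), ENil])
        (CALL FAppend [CALL FMapCons [Var 0, EFst (Var 1)], Var 0]))
     (EPair ENil ENil)"
| "body FSub = EIf (EIsPair (Var 0))
     (EPair (Var 0)
        (CALL FAppend [CALL FSub [child1 (Var 0), ENil], CALL FSub [child2 (Var 0), ENil]]))
     ENil"
| "body FHolds = (let h1 = CALL FHolds [child1 (Var 0), Var 1]; h2 = CALL FHolds [child2 (Var 0), Var 1];
       next = CALL FMem [Var 0, ESnd (Var 1)] in
     dispatch (EFst (Var 0))
       [ETrue, ENil, CALL FMem [child1 (Var 0), EFst (Var 1)],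
        EIf h1 ENil ETrue, EIf h1 h2 ENil, EIf h1 ETrue h2, next,
        EIf h2 ETrue (EIf h1 next ENil), EIf h2 (EIf h1 ETrue next) ENil])"
| "body FBit = (let h = CALL FHolds [Var 0, Var 1] in
     dispatch (EFst (Var 0)) [h, h, h, h, h, h, CALL FHolds [child1 (Var 0), Var 1], h, h])"
| "body FPull = filter_body (ix FPull) (ix FBit)"
| "body FStepP = CALL FMem
     [EPair (EFst (Var 0)) (CALL FPull [ESnd (ESnd (Var 1)), EPair (EFst (Var 1)) (ESnd (Var 0))]),
      EFst (ESnd (Var 1))]"
| "body FStep = filter_body (ix FStep) (ix FStepP)"
| "body FStartP = CALL FMem [EFst (Var 0), ESnd (Var 0)]"
| "body FStart = filter_body (ix FStart) (ix FStartP)"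
| "body FMoveIn = (let g = ESnd (ESnd (ESnd (Var 1))) in
     CALL FMem
       [CALL FStep [gD g, EPair (CALL FAppend [EFst (Var 1), Var 0]) (EPair (EFst (ESnd (Var 1))) (gC g))],
        EFst (ESnd (ESnd (Var 1)))])"
| "body FFindU = find_body (ix FFindU) (ix FMoveIn)"
| "body FCtrlI = CALL FFindU [gO (ESnd (ESnd (Var 1))), EPair (Var 0) (Var 1)]"
| "body FCtrl = all_body (ix FCtrl) (ix FCtrlI)"
| "body FAttractP = (let g = ESnd (ESnd (ESnd (Var 1))) in
     EIf (CALL FMem [Var 0, EFst (ESnd (Var 1))]) ETrue
       (EIf (CALL FMem [Var 0, EFst (ESnd (ESnd (Var 1)))])
          (CALL FCtrl [gI g, EPair (Var 0) (EPair (EFst (Var 1)) g)])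
          ENil))"
| "body FAttract = filter_body (ix FAttract) (ix FAttractP)"
| "body FStages = EPair (EFst (Var 1))
     (EIf (EIsPair (Var 0))
        (CALL FStages [ESnd (Var 0),
           EPair (CALL FAttract [gQ (ESnd (ESnd (ESnd (Var 1)))), Var 1]) (ESnd (Var 1))])
        ENil)"
| "body FLast = EIf (EIsPair (ESnd (Var 0))) (CALL FLast [ESnd (Var 0), ENil]) (EFst (Var 0))"
| "body FWonP = EIf (CALL FMem [EPair (gRg (Var 1)) (gF (Var 1)), Var 0]) ETrue
     (EIf (CALL FMem [EPair (gRs (Var 1)) (gC (Var 1)), Var 0]) ENil ETrue)"
| "body FWon = filter_body (ix FWon) (ix FWonP)"
| "body FStayP = EIf (CALL FMem [EPair (gRc (Var 1)) ENil, Var 0]) ENil ETrue"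
| "body FStay = filter_body (ix FStay) (ix FStayP)"
| "body FReleaseP = dispatch (EFst (Var 0)) [ENil, ENil, ENil, ENil, ENil, ENil, ENil, ENil, ETrue]"
| "body FRelease = filter_body (ix FRelease) (ix FReleaseP)"
| "body FIndex = EIf (EIsPair (Var 1))
     (EIf (CALL FEq [Var 0, EFst (Var 1)]) ENil (EPair ENil (CALL FIndex [Var 0, ESnd (Var 1)])))
     ENil"
| "body FCtrlZ = CALL FCtrl
     [gI (ESnd (Var 1)), EPair (EFst (Var 1)) (EPair (Var 0) (ESnd (Var 1)))]"
| "body FFindZ = find_body (ix FFindZ) (ix FCtrlZ)"
| "body FTrans =
     ELet (ESnd (ESnd (Var 1)))
    (ELet (EFst (Var 2))
    (ELet (EFst (CALL FFindZ [EFst (ESnd (Var 3)), EPair (Var 0) (Var 1)]))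
    (ELet (EFst (CALL FFindU [gO (Var 2), EPair (Var 3) (EPair (Var 1) (EPair (Var 0) (Var 2)))]))
    (ELet (CALL FStep [gD (Var 3), EPair (CALL FAppend [Var 4, Var 0]) (EPair (Var 2) (gC (Var 3)))])
    (EPair (CALL FIndex [Var 3, gQ (Var 4)])
    (EPair (Var 5)
    (EPair (EIf (CALL FMem [EPair (gRg (Var 4)) (gF (Var 4)), Var 0]) (EPair (gE (Var 4)) (Var 1)) (Var 1))
    (EPair (EIf (CALL FWonP [Var 0, Var 4])
              (CALL FIndex [gE (Var 4), gQ (Var 4)]) (CALL FIndex [Var 0, gQ (Var 4)]))
     ENil))))))))"
| "body FMapTrans = map_body (ix FMapTrans) (ix FTrans)"
| "body FTransQ = CALL FMapTrans [gI (ESnd (Var 1)), EPair (Var 0) (Var 1)]"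
| "body FAllTrans = concat_map_body (ix FAllTrans) (ix FTransQ) (ix FAppend)"
| "body FSetup =
     ELet (ENext (EFst (ESnd (ESnd (ESnd (Var 0))))))
    (ELet (ENext (EFst (ESnd (ESnd (ESnd (ESnd (Var 1)))))))
    (ELet (ENext (EFst (ESnd (ESnd (ESnd (ESnd (ESnd (Var 2))))))))
    (ELet (CALL FAppend [CALL FSub [Var 2, ENil],
             CALL FAppend [CALL FSub [Var 1, ENil], CALL FSub [Var 0, ENil]]])
    (ELet (CALL FSubseqs [Var 0, ENil])
    (ELet (CALL FAppend [CALL FMapCons [Var 0, Var 4],
             CALL FAppend [CALL FMapCons [Var 0, Var 3], CALL FMapCons [Var 0, Var 2]]])
    (EPair (CALL FSubseqs [Var 0, ENil])
    (EPair (Var 0)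
    (EPair (Var 2)
    (EPair (CALL FSubseqs [EFst (ESnd (Var 6)), ENil])
    (EPair (CALL FSubseqs [EFst (ESnd (ESnd (Var 6))), ENil])
    (EPair (EFst (Var 6))
    (EPair (Var 5) (EPair (Var 4) (EPair (Var 3)
    (EPair (CALL FRelease [Var 2, ENil]) ENil)))))))))))))))"
| "body FReach = CALL FStages [gQ (Var 0),
     EPair ENil (EPair (CALL FWon [gQ (Var 0), Var 0]) (EPair (gQ (Var 0)) (Var 0)))]"
| "body FRegion = CALL FLast [CALL FStages [gQ (Var 0),
     EPair (gQ (Var 0)) (EPair (Var 1) (EPair (CALL FStay [gQ (Var 0), Var 0]) (Var 0)))], ENil]"

definition FS :: "expr list" where "FS = map body fns"

lemma nth_index_in: "x \<in> set xs \<Longrightarrow> xs ! index_in x xs = x"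
  by (induction xs) auto

lemma in_fns: "f \<in> set fns"
  by (cases f) (simp_all add: fns_def)

lemma ix_less: "ix f < length FS"
  using in_fns by (simp add: ix_def FS_def index_in_less)

lemma FS_nth: "FS ! ix f = body f"
  using in_fns by (simp add: ix_def FS_def index_in_less nth_index_in)

abbreviation ran :: "fn \<Rightarrow> 'a val list \<Rightarrow> 'a val \<Rightarrow> nat \<Rightarrow> bool" where
  "ran f us v T \<equiv> call FS (ix f) us v T"

abbreviation ranb :: "fn \<Rightarrow> 'a val list \<Rightarrow> bool \<Rightarrow> nat \<Rightarrow> bool" where
  "ranb f us b T \<equiv> callb FS (ix f) us b T"

text \<open>A common bound spares the later time estimates the size of the individual body; it is
  the 300 that they charge for one activation.\<close>

lemma body_size: "expr_size (body f) \<le> 300"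
  by (cases f) (simp_all add: filter_body_def map_body_def all_body_def find_body_def
      concat_map_body_def Let_def)

lemma ranI:
  assumes "exec FS us (body f) (\<lambda>v' t. v' = v \<and> 300 + t \<le> T)"
  shows "ran f us v T"
  using exec_sound(1)[OF assms] ix_less[of f] body_size[of f]
  unfolding call_def FS_nth by (meson add_le_mono1 order_trans)

lemmas ran_filter = call_filter[OF ix_less, unfolded FS_nth]
lemmas ran_map = call_map[OF ix_less, unfolded FS_nth]
lemmas ran_all = call_all[OF ix_less, unfolded FS_nth]
lemmas ran_find = call_find[OF ix_less, unfolded FS_nth]
lemmas ran_concat_map = call_concat_map[OF ix_less, unfolded FS_nth]

section \<open>Size and injectivity of encodings; basic list functions\<close>

fun val_size :: "'a val \<Rightarrow> nat" where
  "val_size VNil = 1"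
| "val_size (VAtom x) = 1"
| "val_size (VPair u v) = val_size u + val_size v + 1"

lemma list_val_inject [simp]: "list_val l = list_val l' \<longleftrightarrow> l = l'"
proof (induction l arbitrary: l')
  case Nil
  then show ?case by (cases l') auto
next
  case (Cons v l)
  then show ?case by (cases l') auto
qed

lemma list_val_eq_Nil [simp]: "list_val l = VNil \<longleftrightarrow> l = []"
  by (cases l) auto

lemma nat_val_0 [simp]: "nat_val 0 = VNil"
  and nat_val_Suc [simp]: "nat_val (Suc n) = VPair VNil (nat_val n)"
  by (simp_all add: nat_val_def)

lemma nat_val_numeral [simp]: "nat_val (numeral k) = VPair VNil (nat_val (pred_numeral k))"
  by (simp add: numeral_eq_Suc)

lemma ltl_val_inject [simp]: "ltl_val \<psi> = ltl_val \<chi> \<longleftrightarrow> \<psi> = \<chi>"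
proof (induction \<psi> arbitrary: \<chi>)
  case LTrue then show ?case by (cases \<chi>) auto
next
  case LFalse then show ?case by (cases \<chi>) auto
next
  case (LProp p) then show ?case by (cases \<chi>) auto
next
  case (LNot \<psi>) then show ?case by (cases \<chi>) auto
next
  case (LAnd \<psi>1 \<psi>2) then show ?case by (cases \<chi>) auto
next
  case (LOr \<psi>1 \<psi>2) then show ?case by (cases \<chi>) auto
next
  case (LNext \<psi>) then show ?case by (cases \<chi>) auto
next
  case (LUntil \<psi>1 \<psi>2) then show ?case by (cases \<chi>) auto
next
  case (LRelease \<psi>1 \<psi>2) then show ?case by (cases \<chi>) auto
qed

lemma val_size_ltl_val: "val_size (ltl_val \<psi>) \<le> 30 * ltl_size \<psi>"
  by (induction \<psi>) auto

text \<open>The comparison descends into both values in parallel and ends where one of them is no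
  pair, so the size of the first value bounds it.\<close>

lemma ran_FEq: "ran FEq [u, v] (bool_val (u = v)) (300 * val_size u)"
proof (induction u arbitrary: v)
  case VNil
  show ?case by (rule ranI) (cases v; simp)
next
  case (VAtom x)
  show ?case by (rule ranI) (cases v; simp)
next
  case (VPair u1 u2)
  note IH = VPair.IH
  show ?case
  proof (cases v)
    case (VPair v1 v2)
    show ?thesis
      using call_time_le[OF IH(1)[of v1]] call_time_le[OF IH(2)[of v2]]
      by (intro ranI) (auto simp: VPair IH[THEN call_exec])
  qed (rule ranI, simp)+
qed

lemma ran_FMem_aux:
  "val_size x \<le> n \<Longrightarrow> ran FMem [x, list_val l] (bool_val (x \<in> set l)) ((300 * n + 300) * (length l + 1))"
proof (induction l)
  case Nil
  show ?case by (rule ranI) simp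
next
  case (Cons y l)
  show ?case
    using call_time_le[OF Cons.IH[OF Cons.prems]] call_time_le[OF ran_FEq[of x y]] Cons.prems
    by (intro ranI) (auto simp: call_exec[OF Cons.IH] call_exec[OF ran_FEq] algebra_simps)
qed

lemma ran_FIndex_aux:
  "val_size x \<le> n \<Longrightarrow> ran FIndex [x, list_val l] (nat_val (index_in x l)) ((300 * n + 300) * (length l + 1))"
proof (induction l)
  case Nil
  show ?case by (rule ranI) simp
next
  case (Cons y l)
  show ?case
    using call_time_le[OF Cons.IH[OF Cons.prems]] call_time_le[OF ran_FEq[of x y]] Cons.prems
    by (intro ranI) (auto simp: call_exec[OF Cons.IH] call_exec[OF ran_FEq] algebra_simps)
qed

lemma ran_FAppend_aux: "ran FAppend [list_val l, list_val l'] (list_val (l @ l')) (300 * (length l + 1))"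
proof (induction l)
  case Nil
  show ?case by (rule ranI) simp
next
  case (Cons y l)
  show ?case using call_time_le[OF Cons.IH]
    by (intro ranI) (auto simp: call_exec[OF Cons.IH] algebra_simps)
qed

lemma ran_FLast_aux: "l \<noteq> [] \<Longrightarrow> ran FLast [list_val l, c] (last l) (300 * length l)"
proof (induction l arbitrary: c)
  case (Cons y l)
  show ?case
  proof (cases l)
    case Nil
    show ?thesis by (rule ranI) (simp add: Nil)
  next
    case (Cons z l')
    show ?thesis by (rule ranI) (use callD[OF Cons.IH[of VNil]] Cons in auto)
  qed
qed simp

lemma ran_FCons: "ran FCons [s, x] (VPair x s) 300"
  by (rule ranI) simp

locale time_bound =
  fixes N :: nat
  assumes N_ge: "1000 \<le> N"
begin

text \<open>The powers of \<open>N\<close> are treated as atoms of linear arithmetic. Constant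
  factors and the steps of a single body disappear in the passage to the next power.\<close>

definition B :: "nat \<Rightarrow> nat" where "B k = N ^ k"

lemma B_Suc: "1000 * B k \<le> B (Suc k)"
  using N_ge by (simp add: B_def)

lemma B_Suc': "m = Suc k \<Longrightarrow> 1000 * B k \<le> B m"
  using B_Suc by simp

lemma B_mono: "j \<le> k \<Longrightarrow> B j \<le> B k"
  using N_ge by (simp add: B_def power_increasing)

lemma B_ge: "1000 \<le> B (Suc k)"
proof -
  have "B 1 \<le> B (Suc k)" by (rule B_mono) simp
  moreover have "B 1 = N" by (simp add: B_def)
  ultimately show ?thesis using N_ge by linarith
qed

lemma B_1: "B 1 = N"
  by (simp add: B_def)

lemma B_chain:
  "1000 \<le> B 1" "1000 * B 1 \<le> B 2"
  "1000 * B 2 \<le> B 3"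
  "1000 * B 3 \<le> B 4"
  "1000 * B 4 \<le> B 5"
  "1000 * B 5 \<le> B 6"
  "1000 * B 6 \<le> B 7"
  "1000 * B 7 \<le> B 8"
  "1000 * B 8 \<le> B 9"
  "1000 * B 9 \<le> B 10"
  "1000 * B 10 \<le> B 11"
  "1000 * B 11 \<le> B 12"
  "1000 * B 12 \<le> B 13"
  "1000 * B 13 \<le> B 14"
  "1000 * B 14 \<le> B 15"
  "1000 * B 15 \<le> B 16"
  "1000 * B 16 \<le> B 17"
  "1000 * B 17 \<le> B 18"
  "1000 * B 18 \<le> B 19"
  "1000 * B 19 \<le> B 20"
  "1000 * B 20 \<le> B 21"
  "1000 * B 21 \<le> B 22"
  "1000 * B 22 \<le> B 23"
  "1000 * B 23 \<le> B 24"
  "1000 * B 24 \<le> B 25"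
  "1000 * B 25 \<le> B 26"
  "1000 * B 26 \<le> B 27"
  "1000 * B 27 \<le> B 28"
  "1000 * B 28 \<le> B 29"
  "1000 * B 29 \<le> B 30"
  by (simp add: B_ge) (rule B_Suc', simp)+

text \<open>A loop raises the exponent by two: one power of \<open>N\<close> absorbs the constant,
  the other counts the rounds.\<close>

lemma loop_bound:
  assumes "a \<le> 500 * B k" "n < N" "k + 2 \<le> m"
  shows "a * (n + 1) \<le> B m"
proof -
  have "a \<le> B (k + 1)" using assms(1) B_Suc[of k] by simp
  then have "a * (n + 1) \<le> B (k + 1) * N" using assms(2) by (intro mult_mono) auto
  also have "\<dots> = B (k + 2)" by (simp add: B_def)
  also have "\<dots> \<le> B m" using assms(3) by (rule B_mono)
  finally show ?thesis .
qed

lemma B_pos: "1 \<le> B k"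
  using N_ge by (simp add: B_def)

lemma ran_filterB:
  assumes "body f = filter_body (ix f) (ix g)" "\<And>x. x \<in> set l \<Longrightarrow> ranb g [enc x, c] (P x) (B k)"
    "length l < N" "k + 2 \<le> m"
  shows "ran f [list_val (map enc l), c] (list_val (map enc (filter P l))) (B m)"
  by (rule call_mono[OF ran_filter[OF assms(1,2)] loop_bound[of _ k]])
    (use assms B_pos[of k] in auto)

lemma ran_mapB:
  assumes "body f = map_body (ix f) (ix g)" "\<And>x. x \<in> set l \<Longrightarrow> ran g [enc x, c] (h x) (B k)"
    "length l < N" "k + 2 \<le> m"
  shows "ran f [list_val (map enc l), c] (list_val (map h l)) (B m)"
  by (rule call_mono[OF ran_map[OF assms(1,2)] loop_bound[of _ k]])
    (use assms B_pos[of k] in auto)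

lemma ran_allB:
  assumes "body f = all_body (ix f) (ix g)" "\<And>x. x \<in> set l \<Longrightarrow> ranb g [enc x, c] (P x) (B k)"
    "length l < N" "k + 2 \<le> m"
  shows "ran f [list_val (map enc l), c] (bool_val (\<forall>x\<in>set l. P x)) (B m)"
  by (rule call_mono[OF ran_all[OF assms(1,2)] loop_bound[of _ k]])
    (use assms B_pos[of k] in auto)

lemma ran_findB:
  assumes "body f = find_body (ix f) (ix g)" "\<And>x. x \<in> set l \<Longrightarrow> ranb g [enc x, c] (P x) (B k)"
    "length l < N" "k + 2 \<le> m"
  shows "ran f [list_val (map enc l), c] (option_val (map_option enc (find P l))) (B m)"
  by (rule call_mono[OF ran_find[OF assms(1,2)] loop_bound[of _ k]])
    (use assms B_pos[of k] in auto)

lemma ran_concat_mapB: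
  assumes "body f = concat_map_body (ix f) (ix g) (ix a)"
    "\<And>x. x \<in> set l \<Longrightarrow> ran g [enc x, c] (list_val (h x)) (B k)"
    "\<And>x u. x \<in> set l \<Longrightarrow> ran a [list_val (h x), list_val u] (list_val (h x @ u)) (B k)"
    "length l < N" "k + 2 \<le> m"
  shows "ran f [list_val (map enc l), c] (list_val (concat (map h l))) (B m)"
  by (rule call_mono[OF ran_concat_map[OF assms(1-3)] loop_bound[of _ k]])
    (use assms B_pos[of k] in auto)

end


section \<open>Encoding of types, rows and states\<close>

definition formulas_val :: "'a ltl list \<Rightarrow> 'a val" where
  "formulas_val S = list_val (map ltl_val S)"

definition row_val :: "'a ltl \<times> 'a ltl list \<Rightarrow> 'a val" where
  "row_val x = VPair (ltl_val (fst x)) (formulas_val (snd x))"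

definition state_val :: "'a mstate \<Rightarrow> 'a val" where
  "state_val q = list_val (map row_val q)"

definition states_val :: "'a mstate list \<Rightarrow> 'a val" where
  "states_val Z = list_val (map state_val Z)"

lemma inj_VAtom: "inj VAtom" by (simp add: inj_def)
lemma inj_ltl_val: "inj ltl_val" by (simp add: inj_def)

lemma inj_list_val_map: "inj f \<Longrightarrow> inj (\<lambda>l. list_val (map f l))"
  by (simp add: inj_def)

lemma inj_row_val: "inj row_val"
  by (auto simp: inj_def row_val_def formulas_val_def prod_eq_iff
      dest: inj_list_val_map[OF inj_ltl_val, THEN injD])

lemma inj_state_val: "inj state_val"
  unfolding state_val_def by (rule inj_list_val_map[OF inj_row_val])

lemma row_val_simps [simp]: "val_fst (row_val x) = ltl_val (fst x)" "val_snd (row_val x) = formulas_val (snd x)"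
  by (simp_all add: row_val_def)

lemma index_in_map: "inj f \<Longrightarrow> index_in (f x) (map f l) = index_in x l"
  by (induction l) (auto dest: injD)

lemma length_in_subseqs: "s \<in> set (subseqs l) \<Longrightarrow> length s \<le> length l"
  by (induction l arbitrary: s) (auto simp: Let_def le_SucI)

text \<open>\<open>FSub\<close> visits two children whatever the constructor is. A missing child
  reads as \<open>VNil\<close> and a variable is no pair, so neither contributes a
  subformula.\<close>

lemma ran_FSub_leaf: "ran FSub [VNil, c] VNil 300" "ran FSub [VAtom p, c] VNil 300"
  by (rule ranI; simp)+

context time_bound begin

lemma ran_FMem:
  assumes "inj f" "val_size (f x) \<le> N" "length l < N"
  shows "ran FMem [f x, list_val (map f l)] (bool_val (x \<in> set l)) (B 4)"
proof -
  have "(300 * N + 300) * (length (map f l) + 1) \<le> B 4"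
    using assms(3) B_chain(1,2) B_1 by (intro loop_bound[of _ 2]) auto
  from call_mono[OF ran_FMem_aux[OF assms(2)] this] show ?thesis
    by (simp add: inj_image_mem_iff[OF assms(1)])
qed

lemma ran_FIndex:
  assumes "inj f" "val_size (f x) \<le> N" "length l < N"
  shows "ran FIndex [f x, list_val (map f l)] (nat_val (index_in x l)) (B 4)"
proof -
  have "(300 * N + 300) * (length (map f l) + 1) \<le> B 4"
    using assms(3) B_chain(1,2) B_1 by (intro loop_bound[of _ 2]) auto
  from call_mono[OF ran_FIndex_aux[OF assms(2)] this] show ?thesis
    by (simp add: index_in_map[OF assms(1)])
qed

text \<open>A vain search counts the entries of the list. Looking for the atom \<open>end\<close>
  among the states thus yields the number of the silent state.\<close>

lemma ran_FIndex_absent: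
  assumes "\<And>y. y \<in> set l \<Longrightarrow> f y \<noteq> VAtom x" "length l < N"
  shows "ran FIndex [VAtom x, list_val (map f l)] (nat_val (length l)) (B 4)"
proof -
  have "(300 * N + 300) * (length (map f l) + 1) \<le> B 4"
    using assms(2) B_chain(1,2) B_1 by (intro loop_bound[of _ 2]) auto
  moreover have "val_size (VAtom x) \<le> N" using N_ge by simp
  moreover have "index_in (VAtom x) (map f l) = length l" using assms(1)
    by (induction l) (auto simp: eq_commute)
  ultimately show ?thesis using call_mono[OF ran_FIndex_aux] by metis
qed

lemma ran_FAppend: "length l < N \<Longrightarrow> ran FAppend [list_val l, list_val l'] (list_val (l @ l')) (B 2)"
  by (rule call_mono[OF ran_FAppend_aux], rule loop_bound[of _ 0]) (auto simp: B_def)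

lemma ran_FAppend_Nil: "ran FAppend [VNil, VNil] VNil (B 2)"
  using ran_FAppend[of "[]" "[]"] N_ge by simp

lemma ran_FLast:
  assumes "l \<noteq> []" "length l < N"
  shows "ran FLast [list_val l, c] (last l) (B 2)"
proof -
  have "300 * length l \<le> 300 * (length l + 1)" by simp
  also have "\<dots> \<le> B 2" by (rule loop_bound[of _ 0]) (use assms in \<open>auto simp: B_def\<close>)
  finally show ?thesis using call_mono[OF ran_FLast_aux[OF assms(1)]] by blast
qed

lemma ran_FMapCons:
  assumes "length l < N"
  shows "ran FMapCons [list_val (map f l), x] (list_val (map (\<lambda>s. VPair x (f s)) l)) (B 3)"
  by (rule ran_mapB[of _ FCons _ _ _ _ 1])
    (use assms B_ge[of 0] in \<open>simp_all add: call_mono[OF ran_FCons]\<close>)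

text \<open>Each round handles lists of fewer than \<open>N\<close> sublists, for which
  \<open>B 4\<close> suffices. The recursive result is bound by \<open>ELet\<close> and shared, so
  there is one recursive call per round and the time is linear in the number of rounds.\<close>

lemma ran_FSubseqs_aux:
  assumes "2 ^ length l < N"
  shows "ran FSubseqs [list_val (map f l), c] (list_val (map (\<lambda>s. list_val (map f s)) (subseqs l)))
    (B 4 * (length l + 1))"
  using assms
proof (induction l arbitrary: c)
  case Nil
  show ?case
    by (intro ranI, simp)
      (use B_chain(1-4) in linarith)+
next
  case (Cons x l)
  let ?g = "\<lambda>s. list_val (map f s)"
  have len: "length (subseqs l) < N" using Cons.prems by (simp add: length_subseqs)
  have IH: "ran FSubseqs [list_val (map f l), c] (list_val (map ?g (subseqs l))) (B 4 * (length l + 1))" for c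
    using Cons by simp
  have 1: "ran FMapCons [list_val (map ?g (subseqs l)), f x]
      (list_val (map (\<lambda>s. VPair (f x) (?g s)) (subseqs l))) (B 3)"
    by (rule ran_FMapCons[OF len])
  have 2: "ran FAppend [list_val (map (\<lambda>s. VPair (f x) (?g s)) (subseqs l)), list_val (map ?g (subseqs l))]
      (list_val (map (\<lambda>s. VPair (f x) (?g s)) (subseqs l) @ map ?g (subseqs l))) (B 2)"
    using len by (intro ran_FAppend) simp
  show ?case
    by (intro ranI, simp add: call_exec[OF IH] call_exec[OF 1] call_exec[OF 2] Let_def comp_def add_mult_distrib)
      (use call_time_le[OF IH[of VNil], simplified] call_time_le[OF 1] call_time_le[OF 2] B_chain(1-4) in linarith)+
qed

lemma ran_FSubseqs:
  assumes "2 ^ length l < N"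
  shows "ran FSubseqs [list_val (map f l), c] (list_val (map (\<lambda>s. list_val (map f s)) (subseqs l))) (B 6)"
proof (rule call_mono[OF ran_FSubseqs_aux[OF assms]], rule loop_bound[of _ 4])
  show "length l < N" using assms by (metis less_exp less_trans)
qed simp_all

lemma ran_FSub_aux:
  fixes \<psi> :: "'a ltl"
  assumes "ltl_size \<psi> < N"
  shows "ran FSub [ltl_val \<psi>, c] (list_val (map ltl_val (subformulas \<psi>))) (ltl_size \<psi> * B 3)"
  using assms
proof (induction \<psi> arbitrary: c)
  case LTrue
  show ?case
    by (intro ranI, simp add: add_mult_distrib call_exec[OF ran_FSub_leaf(1)] call_exec[OF ran_FAppend_Nil])
      (use call_time_le[OF ran_FSub_leaf(1)[of "VNil :: 'a val"]] call_time_le[OF ran_FAppend_Nil[where 'a = 'a]] N_ge B_chain(1-3) in linarith)+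
next
  case LFalse
  show ?case
    by (intro ranI, simp add: add_mult_distrib call_exec[OF ran_FSub_leaf(1)] call_exec[OF ran_FAppend_Nil])
      (use call_time_le[OF ran_FSub_leaf(1)[of "VNil :: 'a val"]] call_time_le[OF ran_FAppend_Nil[where 'a = 'a]] N_ge B_chain(1-3) in linarith)+
next
  case (LProp p)
  show ?case
    by (intro ranI, simp add: add_mult_distrib call_exec[OF ran_FSub_leaf(1)] call_exec[OF ran_FSub_leaf(2)] call_exec[OF ran_FAppend_Nil])
      (use call_time_le[OF ran_FSub_leaf(1)[of "VNil :: 'a val"]] call_time_le[OF ran_FSub_leaf(2)[of p VNil]] call_time_le[OF ran_FAppend_Nil[where 'a = 'a]] N_ge B_chain(1-3) in linarith)+
next
  case (LNot \<psi>)
  have 1: "ran FSub [ltl_val \<psi>, VNil] (list_val (map ltl_val (subformulas \<psi>))) (ltl_size \<psi> * B 3)"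
    using LNot by simp
  have 2: "ran FAppend [list_val (map ltl_val (subformulas \<psi>)), VNil] (list_val (map ltl_val (subformulas \<psi>))) (B 2)"
    using ran_FAppend[of "map ltl_val (subformulas \<psi>)" "[]"] LNot.prems by (simp add: add_mult_distrib length_subformulas)
  show ?case
    by (intro ranI, simp add: add_mult_distrib call_exec[OF 1] call_exec[OF 2] call_exec[OF ran_FSub_leaf(1)])
      (use call_time_le[OF 1] call_time_le[OF 2] call_time_le[OF ran_FSub_leaf(1)[of "VNil :: 'a val"]] B_chain(1-3) in linarith)+
next
  case (LNext \<psi>)
  have 1: "ran FSub [ltl_val \<psi>, VNil] (list_val (map ltl_val (subformulas \<psi>))) (ltl_size \<psi> * B 3)"
    using LNext by simp
  have 2: "ran FAppend [list_val (map ltl_val (subformulas \<psi>)), VNil] (list_val (map ltl_val (subformulas \<psi>))) (B 2)"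
    using ran_FAppend[of "map ltl_val (subformulas \<psi>)" "[]"] LNext.prems by (simp add: add_mult_distrib length_subformulas)
  show ?case
    by (intro ranI, simp add: add_mult_distrib call_exec[OF 1] call_exec[OF 2] call_exec[OF ran_FSub_leaf(1)])
      (use call_time_le[OF 1] call_time_le[OF 2] call_time_le[OF ran_FSub_leaf(1)[of "VNil :: 'a val"]] B_chain(1-3) in linarith)+
next
  case (LAnd \<psi> \<chi>)
  have 1: "ran FSub [ltl_val \<psi>, VNil] (list_val (map ltl_val (subformulas \<psi>))) (ltl_size \<psi> * B 3)"
    "ran FSub [ltl_val \<chi>, VNil] (list_val (map ltl_val (subformulas \<chi>))) (ltl_size \<chi> * B 3)"
    using LAnd by simp_all
  have 2: "ran FAppend [list_val (map ltl_val (subformulas \<psi>)), list_val (map ltl_val (subformulas \<chi>))]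
      (list_val (map ltl_val (subformulas \<psi>) @ map ltl_val (subformulas \<chi>))) (B 2)"
    using LAnd.prems by (intro ran_FAppend) (simp add: add_mult_distrib length_subformulas)
  show ?case
    by (intro ranI, simp add: add_mult_distrib 1[THEN call_exec] call_exec[OF 2])
      (use 1[THEN call_time_le] call_time_le[OF 2] B_chain(1-3) in linarith)+
next
  case (LOr \<psi> \<chi>)
  have 1: "ran FSub [ltl_val \<psi>, VNil] (list_val (map ltl_val (subformulas \<psi>))) (ltl_size \<psi> * B 3)"
    "ran FSub [ltl_val \<chi>, VNil] (list_val (map ltl_val (subformulas \<chi>))) (ltl_size \<chi> * B 3)"
    using LOr by simp_all
  have 2: "ran FAppend [list_val (map ltl_val (subformulas \<psi>)), list_val (map ltl_val (subformulas \<chi>))]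
      (list_val (map ltl_val (subformulas \<psi>) @ map ltl_val (subformulas \<chi>))) (B 2)"
    using LOr.prems by (intro ran_FAppend) (simp add: add_mult_distrib length_subformulas)
  show ?case
    by (intro ranI, simp add: add_mult_distrib 1[THEN call_exec] call_exec[OF 2])
      (use 1[THEN call_time_le] call_time_le[OF 2] B_chain(1-3) in linarith)+
next
  case (LUntil \<psi> \<chi>)
  have 1: "ran FSub [ltl_val \<psi>, VNil] (list_val (map ltl_val (subformulas \<psi>))) (ltl_size \<psi> * B 3)"
    "ran FSub [ltl_val \<chi>, VNil] (list_val (map ltl_val (subformulas \<chi>))) (ltl_size \<chi> * B 3)"
    using LUntil by simp_all
  have 2: "ran FAppend [list_val (map ltl_val (subformulas \<psi>)), list_val (map ltl_val (subformulas \<chi>))]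
      (list_val (map ltl_val (subformulas \<psi>) @ map ltl_val (subformulas \<chi>))) (B 2)"
    using LUntil.prems by (intro ran_FAppend) (simp add: add_mult_distrib length_subformulas)
  show ?case
    by (intro ranI, simp add: add_mult_distrib 1[THEN call_exec] call_exec[OF 2])
      (use 1[THEN call_time_le] call_time_le[OF 2] B_chain(1-3) in linarith)+
next
  case (LRelease \<psi> \<chi>)
  have 1: "ran FSub [ltl_val \<psi>, VNil] (list_val (map ltl_val (subformulas \<psi>))) (ltl_size \<psi> * B 3)"
    "ran FSub [ltl_val \<chi>, VNil] (list_val (map ltl_val (subformulas \<chi>))) (ltl_size \<chi> * B 3)"
    using LRelease by simp_all
  have 2: "ran FAppend [list_val (map ltl_val (subformulas \<psi>)), list_val (map ltl_val (subformulas \<chi>))]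
      (list_val (map ltl_val (subformulas \<psi>) @ map ltl_val (subformulas \<chi>))) (B 2)"
    using LRelease.prems by (intro ran_FAppend) (simp add: add_mult_distrib length_subformulas)
  show ?case
    by (intro ranI, simp add: add_mult_distrib 1[THEN call_exec] call_exec[OF 2])
      (use 1[THEN call_time_le] call_time_le[OF 2] B_chain(1-3) in linarith)+
qed

lemma ran_FSub:
  assumes "ltl_size \<psi> < N"
  shows "ran FSub [ltl_val \<psi>, c] (list_val (map ltl_val (subformulas \<psi>))) (B 5)"
proof (rule call_mono[OF ran_FSub_aux[OF assms]])
  have "ltl_size \<psi> * B 3 \<le> B 3 * (ltl_size \<psi> + 1)" by simp
  also have "\<dots> \<le> B 5" using assms by (intro loop_bound[of _ 3]) auto
  finally show "ltl_size \<psi> * B 3 \<le> B 5" .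
qed

text \<open>On every branch a child is evaluated at most once, so the time is linear in the size of
  the formula instead of exponential in its depth.\<close>

lemma ran_FHolds_aux:
  assumes "30 * ltl_size \<psi> \<le> N" "length a < N" "length S < N"
  defines "ctx \<equiv> VPair (vars_val a) (formulas_val S)"
  shows "ran FHolds [ltl_val \<psi>, ctx] (bool_val (holds (set a) (set S) \<psi>)) (ltl_size \<psi> * B 5)"
  using assms(1)
proof (induction \<psi>)
  have mem: "ran FMem [ltl_val \<psi>, formulas_val S] (bool_val (\<psi> \<in> set S)) (B 4)" if "30 * ltl_size \<psi> \<le> N" for \<psi>
    unfolding formulas_val_def using that val_size_ltl_val[of \<psi>] assms(3)
    by (intro ran_FMem[OF inj_ltl_val]) auto
  {
    case LTrue
    show ?case
    by (intro ranI, auto simp: add_mult_distrib Let_def)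
      (use B_chain(1-5) in linarith)+
  next
    case LFalse
    show ?case
    by (intro ranI, auto simp: add_mult_distrib Let_def)
      (use B_chain(1-5) in linarith)+
  next
    case (LProp p)
    have 1: "ran FMem [VAtom p, vars_val a] (bool_val (p \<in> set a)) (B 4)"
      unfolding vars_val_def using assms(2) N_ge by (intro ran_FMem[OF inj_VAtom]) auto
    show ?case
    by (intro ranI, auto simp: add_mult_distrib Let_def ctx_def call_exec[OF 1])
      (use B_chain(1-5) call_time_le[OF 1] in linarith)+
  next
    case (LNot \<psi>)
    then have 1: "ran FHolds [ltl_val \<psi>, ctx] (bool_val (holds (set a) (set S) \<psi>)) (ltl_size \<psi> * B 5)" by simp
    show ?case
    by (intro ranI, auto simp: add_mult_distrib Let_def call_exec[OF 1])
      (use B_chain(1-5) call_time_le[OF 1] in linarith)+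
  next
    case (LNext \<psi>)
    have 1: "ran FMem [ltl_val (LNext \<psi>), formulas_val S] (bool_val (LNext \<psi> \<in> set S)) (B 4)"
      using mem LNext.prems by blast
    show ?case
    by (intro ranI, auto simp: add_mult_distrib Let_def ctx_def call_exec[OF 1, simplified])
      (use B_chain(1-5) call_time_le[OF 1, simplified] in linarith)+
  next
    case (LAnd \<psi> \<chi>)
    then have 1: "ran FHolds [ltl_val \<psi>, ctx] (bool_val (holds (set a) (set S) \<psi>)) (ltl_size \<psi> * B 5)"
      "ran FHolds [ltl_val \<chi>, ctx] (bool_val (holds (set a) (set S) \<chi>)) (ltl_size \<chi> * B 5)" by simp_all
    show ?case
    by (intro ranI, auto simp: add_mult_distrib Let_def 1[THEN call_exec])
      (use B_chain(1-5) 1[THEN call_time_le] in linarith)+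
  next
    case (LOr \<psi> \<chi>)
    then have 1: "ran FHolds [ltl_val \<psi>, ctx] (bool_val (holds (set a) (set S) \<psi>)) (ltl_size \<psi> * B 5)"
      "ran FHolds [ltl_val \<chi>, ctx] (bool_val (holds (set a) (set S) \<chi>)) (ltl_size \<chi> * B 5)" by simp_all
    show ?case
    by (intro ranI, auto simp: add_mult_distrib Let_def 1[THEN call_exec])
      (use B_chain(1-5) 1[THEN call_time_le] in linarith)+
  next
    case (LUntil \<psi> \<chi>)
    then have 1: "ran FHolds [ltl_val \<psi>, ctx] (bool_val (holds (set a) (set S) \<psi>)) (ltl_size \<psi> * B 5)"
      "ran FHolds [ltl_val \<chi>, ctx] (bool_val (holds (set a) (set S) \<chi>)) (ltl_size \<chi> * B 5)" by simp_all
    have 2: "ran FMem [ltl_val (LUntil \<psi> \<chi>), formulas_val S] (bool_val (LUntil \<psi> \<chi> \<in> set S)) (B 4)"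
      using mem LUntil.prems by blast
    show ?case
    by (intro ranI, auto simp: add_mult_distrib Let_def ctx_def call_exec[OF 2, simplified] 1[unfolded ctx_def, THEN call_exec])
      (use B_chain(1-5) 1[unfolded ctx_def, THEN call_time_le] call_time_le[OF 2, simplified] in linarith)+
  next
    case (LRelease \<psi> \<chi>)
    then have 1: "ran FHolds [ltl_val \<psi>, ctx] (bool_val (holds (set a) (set S) \<psi>)) (ltl_size \<psi> * B 5)"
      "ran FHolds [ltl_val \<chi>, ctx] (bool_val (holds (set a) (set S) \<chi>)) (ltl_size \<chi> * B 5)" by simp_all
    have 2: "ran FMem [ltl_val (LRelease \<psi> \<chi>), formulas_val S] (bool_val (LRelease \<psi> \<chi> \<in> set S)) (B 4)"
      using mem LRelease.prems by blast
    show ?case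
    by (intro ranI, auto simp: add_mult_distrib Let_def ctx_def call_exec[OF 2, simplified] 1[unfolded ctx_def, THEN call_exec])
      (use B_chain(1-5) 1[unfolded ctx_def, THEN call_time_le] call_time_le[OF 2, simplified] in linarith)+
  }
qed

lemma ran_FHolds:
  assumes "30 * ltl_size \<psi> \<le> N" "length a < N" "length S < N"
  shows "ran FHolds [ltl_val \<psi>, VPair (vars_val a) (formulas_val S)] (bool_val (holds (set a) (set S) \<psi>)) (B 7)"
proof (rule call_mono[OF ran_FHolds_aux[OF assms]])
  have "ltl_size \<psi> * B 5 \<le> B 5 * (ltl_size \<psi> + 1)" by simp
  also have "\<dots> \<le> B 7" using assms N_ge by (intro loop_bound[of _ 5]) auto
  finally show "ltl_size \<psi> * B 5 \<le> B 7" .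
qed

lemma ran_FBit:
  assumes "30 * ltl_size \<theta> \<le> N" "length a < N" "length S < N"
  shows "ran FBit [ltl_val \<theta>, VPair (vars_val a) (formulas_val S)]
    (bool_val (holds (set a) (set S) (obligation \<theta>))) (B 8)"
proof -
  have 1: "ran FHolds [ltl_val \<theta>, VPair (vars_val a) (formulas_val S)] (bool_val (holds (set a) (set S) \<theta>)) (B 7)"
    by (rule ran_FHolds[OF assms])
  show ?thesis
  proof (cases \<theta>)
    case (LNext \<psi>)
    then have 2: "ran FHolds [ltl_val \<psi>, VPair (vars_val a) (formulas_val S)] (bool_val (holds (set a) (set S) \<psi>)) (B 7)"
      using assms by (intro ran_FHolds) auto
    show ?thesis
    by (intro ranI, simp add: Let_def LNext call_exec[OF 2])
      (use call_time_le[OF 2] B_chain(1-8) in linarith)+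
  qed (intro ranI; use call_exec[OF 1] in \<open>simp add: Let_def\<close>;
      use call_time_le[OF 1] B_chain(1-8) in simp)+
qed

lemma ran_FPull:
  assumes "\<And>\<theta>. \<theta> \<in> set C \<Longrightarrow> 30 * ltl_size \<theta> \<le> N" "length C < N" "length a < N" "length S < N"
  shows "ran FPull [formulas_val C, VPair (vars_val a) (formulas_val S)] (formulas_val (pull C (set a) S)) (B 10)"
  unfolding pull_def formulas_val_def[of C] formulas_val_def[of "filter _ _"]
  by (rule ran_filterB[of _ FBit _ _ _ _ 8]) (use assms in \<open>auto intro!: callb_bool_val ran_FBit\<close>)

lemma ran_FReleaseP: "ran FReleaseP [ltl_val \<theta>, c] (bool_val (is_release \<theta>)) (B 1)"
  using B_chain(1) by (intro ranI; cases \<theta>; simp)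

lemma ran_FRelease:
  assumes "length C < N"
  shows "ran FRelease [formulas_val C, c] (formulas_val (filter is_release C)) (B 3)"
  unfolding formulas_val_def
  by (rule ran_filterB[of _ FReleaseP _ _ _ _ 1]) (use assms in \<open>auto intro!: callb_bool_val ran_FReleaseP[simplified]\<close>)

end


declare ltl_val.simps [simp del] subformulas.simps [simp del]

lemma next_val [simp]:
  "VPair (VPair VNil (VPair VNil (VPair VNil (VPair VNil (VPair VNil (VPair VNil VNil))))))
     (VPair (ltl_val \<psi>) VNil) = ltl_val (LNext \<psi>)"
  by (simp add: ltl_val.simps)

lemma encode_Nil [simp]: "vars_val [] = VNil" "formulas_val [] = VNil" "state_val [] = VNil" "states_val [] = VNil"
  by (simp_all add: vars_val_def formulas_val_def state_val_def states_val_def)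

text \<open>A failed search returns \<open>VNil\<close>, whose first component is again
  \<open>VNil\<close>, the code of the empty list. This produces the default case of
  \<open>target_set\<close> and \<open>choice\<close>.\<close>

lemma val_fst_option_val [simp]:
  "val_fst (option_val (map_option vars_val v)) = vars_val (case v of None \<Rightarrow> [] | Some U \<Rightarrow> U)"
  "val_fst (option_val (map_option states_val z)) = states_val (case z of None \<Rightarrow> [] | Some Z \<Rightarrow> Z)"
  by (cases v; simp) (cases z; simp)

lemma option_val_VNil: "option_val (map_option f v) \<noteq> VNil \<longleftrightarrow> v \<noteq> None"
  by (cases v) auto

lemma computes_withinI:
  assumes "exec (fst p) [input] (snd p) (\<lambda>v t. v = result \<and> expr_size (snd p) + t \<le> T)"
  shows "computes_within p input result T"
  using exec_sound(1)[OF assms] unfolding computes_within_def by (meson order_trans)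

definition decide_prog :: prog where
  "decide_prog = (FS,
     ELet (CALL FSetup [Var 0, ENil])
       (CALL FMem [CALL FStart [gD (Var 0), ENil],
          CALL FRegion [Var 0, CALL FLast [CALL FReach [Var 0, ENil], ENil]]]))"

definition construct_prog :: prog where
  "construct_prog = (FS,
     ELet (CALL FSetup [Var 0, ENil])
    (ELet (CALL FReach [Var 0, ENil])
    (ELet (CALL FRegion [Var 1, CALL FLast [Var 0, ENil]])
    (EPair (CALL FIndex [CALL FStart [gD (Var 2), ENil], gQ (Var 2)])
       (CALL FAllTrans [gQ (Var 2), EPair (CALL FAppend [Var 1, EPair (Var 0) ENil]) (Var 2)])))))"

section \<open>Running times when all objects are bounded by \<open>N\<close>\<close>

locale synthesis_time = synthesis e xs ys \<alpha>s \<alpha>c \<phi> + time_bound N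
  for e :: 'a and xs ys \<alpha>s \<alpha>c \<phi> N +
  assumes formula_small: "\<And>\<theta>. \<theta> \<in> set C \<Longrightarrow> 30 * ltl_size \<theta> \<le> N"
    \<comment> \<open>\<open>Zs\<close> has \<open>length Q + 2\<close> entries:
      \<open>length Q + 1\<close> approximants, starting with the empty one, and
      \<open>V\<close>.\<close>
    and length_Q: "length Q + 2 < N"
    and row_small: "\<And>x. x \<in> set D \<Longrightarrow> val_size (row_val x) \<le> N"
    and state_small: "\<And>q. q \<in> set Q \<Longrightarrow> val_size (state_val q) \<le> N"
    and letters_small: "2 ^ length xs < N" "2 ^ length ys < N" "length xs + length ys < N"
begin

definition context_val :: "'a val" where
  "context_val = list_val [states_val Q, state_val D, formulas_val C, list_val (map vars_val Is),
     list_val (map vars_val Os), VAtom e, ltl_val (LNext \<alpha>s), ltl_val (LNext \<alpha>c), ltl_val (LNext \<phi>),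
     formulas_val final]"

lemma context_val_simps [simp]:
  "val_fst context_val = states_val Q"
  "val_fst (val_snd context_val) = state_val D"
  "val_fst (val_snd (val_snd context_val)) = formulas_val C"
  "val_fst (val_snd (val_snd (val_snd context_val))) = list_val (map vars_val Is)"
  "val_fst (val_snd (val_snd (val_snd (val_snd context_val)))) = list_val (map vars_val Os)"
  "val_fst (val_snd (val_snd (val_snd (val_snd (val_snd context_val))))) = VAtom e"
  "val_fst (val_snd (val_snd (val_snd (val_snd (val_snd (val_snd context_val)))))) = ltl_val (LNext \<alpha>s)"
  "val_fst (val_snd (val_snd (val_snd (val_snd (val_snd (val_snd (val_snd context_val))))))) = ltl_val (LNext \<alpha>c)"
  "val_fst (val_snd (val_snd (val_snd (val_snd (val_snd (val_snd (val_snd (val_snd context_val)))))))) = ltl_val (LNext \<phi>)"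
  "val_fst (val_snd (val_snd (val_snd (val_snd (val_snd (val_snd (val_snd (val_snd (val_snd context_val))))))))) = formulas_val final"
  by (simp_all add: context_val_def)

lemma power_D: "2 ^ length D < N"
  using length_Q by (simp add: Q_def length_subseqs)

lemma length_D: "length D < N"
  using power_D by (metis less_exp less_trans)

lemma power_C: "2 ^ length C < N"
  using length_D by (simp add: D_def length_subseqs)

lemma length_C: "length C < N"
  using power_C by (metis less_exp less_trans)

lemma length_Is: "length Is < N" and length_Os: "length Os < N"
  using letters_small by (simp_all add: Is_def Os_def length_subseqs)

lemma length_state: "q \<in> set Q \<Longrightarrow> length q < N"
  using length_in_subseqs[of q D] length_D by (simp add: Q_def)

lemma length_letter: "I \<in> set Is \<Longrightarrow> U \<in> set Os \<Longrightarrow> length (I @ U) < N"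
  using length_in_subseqs[of I xs] length_in_subseqs[of U ys] letters_small(3) by (simp add: Is_def Os_def)

lemma length_row: "S \<in> set (subseqs C) \<Longrightarrow> length S < N"
  using length_in_subseqs[of S C] length_C by simp

lemma move_in_Q: "move q I U \<in> set Q"
  by (simp add: move_def step_in_Q)

lemma start_in_Q: "start \<in> set Q"
  by (simp add: start_monitor monitor_in_Q)

lemma ran_append_vars:
  "length l < N \<Longrightarrow> ran FAppend [vars_val l, vars_val l'] (vars_val (l @ l')) (B 2)"
  using ran_FAppend[of "map VAtom l" "map VAtom l'"] by (simp add: vars_val_def)

lemma ran_append_formulas:
  "length l < N \<Longrightarrow> ran FAppend [formulas_val l, formulas_val l'] (formulas_val (l @ l')) (B 2)"
  using ran_FAppend[of "map ltl_val l" "map ltl_val l'"] by (simp add: formulas_val_def)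

lemma ran_append_rows:
  "length l < N \<Longrightarrow> ran FAppend [state_val l, state_val l'] (state_val (l @ l')) (B 2)"
  using ran_FAppend[of "map row_val l" "map row_val l'"] by (simp add: state_val_def)

lemma ran_mem_row:
  assumes "(r, S) \<in> set D" "length q < N"
  shows "ran FMem [VPair (ltl_val r) (formulas_val S), state_val q] (bool_val ((r, S) \<in> set q)) (B 4)"
  using ran_FMem[OF inj_row_val, of "(r, S)" q] row_small[OF assms(1)] assms(2)
  by (simp add: state_val_def row_val_def)

lemma ran_mem_state:
  assumes "q \<in> set Q" "length Z < N"
  shows "ran FMem [state_val q, states_val Z] (bool_val (q \<in> set Z)) (B 4)"
  unfolding states_val_def by (rule ran_FMem[OF inj_state_val state_small[OF assms(1)] assms(2)])

lemma ran_FStepP: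
  assumes "(r, S) \<in> set D" "length q < N" "length a < N"
  shows "ran FStepP [row_val (r, S), VPair (vars_val a) (VPair (state_val q) (formulas_val C))]
    (bool_val ((r, pull C (set a) S) \<in> set q)) (B 11)"
proof -
  have 1: "ran FPull [formulas_val C, VPair (vars_val a) (formulas_val S)] (formulas_val (pull C (set a) S)) (B 10)"
    using assms formula_small length_C length_row by (intro ran_FPull) (auto simp: in_D)
  have 2: "ran FMem [VPair (ltl_val r) (formulas_val (pull C (set a) S)), state_val q]
      (bool_val ((r, pull C (set a) S) \<in> set q)) (B 4)"
    using assms by (intro ran_mem_row) (auto simp: in_D pull_in_subseqs)
  show ?thesis
    by (intro ranI, simp add: call_exec[OF 1] call_exec[OF 2])
      (use call_time_le[OF 1] call_time_le[OF 2] B_chain(1-11) in linarith)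
qed

lemma ran_FStep:
  assumes "length q < N" "length a < N"
  shows "ran FStep [state_val D, VPair (vars_val a) (VPair (state_val q) (formulas_val C))]
    (state_val (step (set a) q)) (B 13)"
  unfolding step_def state_val_def[of D] state_val_def[of "filter _ _"]
  by (rule ran_filterB[of _ FStepP _ _ _ _ 11])
    (use assms length_D in \<open>auto intro!: callb_bool_val ran_FStepP\<close>)

lemma ran_FStart: "ran FStart [state_val D, c] (state_val start) (B 7)"
  unfolding start_def state_val_def
proof (rule ran_filterB[of _ FStartP _ _ _ _ 5])
  fix x assume x: "x \<in> set D"
  then have r: "fst x \<in> set C" using self_in_subformulas
    by (auto simp: D_def C_def)
  have 1: "ran FMem [ltl_val (fst x), formulas_val (snd x)] (bool_val (fst x \<in> set (snd x))) (B 4)"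
    unfolding formulas_val_def
  proof (rule ran_FMem[OF inj_ltl_val])
    show "val_size (ltl_val (fst x)) \<le> N"
      using val_size_ltl_val[of "fst x"] formula_small[OF r] by simp
    show "length (snd x) < N" using x length_row[of "snd x"] in_D[of "fst x" "snd x"] by simp
  qed
  have "ran FStartP [row_val x, c] (bool_val (fst x \<in> set (snd x))) (B 5)"
    by (intro ranI, simp add: call_exec[OF 1]) (use call_time_le[OF 1] B_chain(1-5) in linarith)
  then show "ranb FStartP [row_val x, c] (case x of (r, S) \<Rightarrow> r \<in> set S) (B 5)"
    by (cases x) (simp add: callb_bool_val)
qed (simp_all add: length_D)

lemma ran_FMoveIn:
  assumes "I \<in> set Is" "U \<in> set Os" "q \<in> set Q" "length Z < N"
  shows "ran FMoveIn [vars_val U, VPair (vars_val I) (VPair (state_val q) (VPair (states_val Z) context_val))]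
    (bool_val (move q I U \<in> set Z)) (B 14)"
proof -
  have 1: "ran FAppend [vars_val I, vars_val U] (vars_val (I @ U)) (B 2)"
    using length_letter[OF assms(1,2)] by (intro ran_append_vars) simp
  have 2: "ran FStep [state_val D, VPair (vars_val (I @ U)) (VPair (state_val q) (formulas_val C))]
      (state_val (move q I U)) (B 13)"
    using ran_FStep[OF length_state[OF assms(3)] length_letter[OF assms(1,2)]] by (simp add: move_def)
  have 3: "ran FMem [state_val (move q I U), states_val Z] (bool_val (move q I U \<in> set Z)) (B 4)"
    by (rule ran_mem_state[OF move_in_Q assms(4)])
  show ?thesis
    by (intro ranI, simp add: Let_def call_exec[OF 1] call_exec[OF 2] call_exec[OF 3])
      (use call_time_le[OF 1] call_time_le[OF 2] call_time_le[OF 3] B_chain(1-14) in linarith)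
qed

lemma ran_FFindU:
  assumes "I \<in> set Is" "q \<in> set Q" "length Z < N"
  shows "ran FFindU [list_val (map vars_val Os),
      VPair (vars_val I) (VPair (state_val q) (VPair (states_val Z) context_val))]
    (option_val (map_option vars_val (find (\<lambda>U. move q I U \<in> set Z) Os))) (B 16)"
  by (rule ran_findB[of _ FMoveIn _ _ _ _ 14])
    (use assms length_Os in \<open>auto intro!: callb_bool_val ran_FMoveIn\<close>)

lemma ran_FCtrl:
  assumes "q \<in> set Q" "length Z < N"
  shows "ran FCtrl [list_val (map vars_val Is), VPair (state_val q) (VPair (states_val Z) context_val)]
    (bool_val (controllable move Is Os Z q)) (B 19)"
  unfolding controllable_def
proof (rule ran_allB[of _ FCtrlI _ _ _ _ 17])
  fix I assume I: "I \<in> set Is"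
  let ?v = "option_val (map_option vars_val (find (\<lambda>U. move q I U \<in> set Z) Os))"
  note 1 = ran_FFindU[OF I assms]
  have "ran FCtrlI [vars_val I, VPair (state_val q) (VPair (states_val Z) context_val)] ?v (B 17)"
    by (intro ranI, simp add: call_exec[OF 1]) (use call_time_le[OF 1] B_chain(1-17) in linarith)
  moreover have "?v \<noteq> VNil \<longleftrightarrow> (\<exists>U\<in>set Os. move q I U \<in> set Z)"
    unfolding option_val_VNil by (auto simp: find_None_iff)
  ultimately show "ranb FCtrlI [vars_val I, VPair (state_val q) (VPair (states_val Z) context_val)]
      (\<exists>U\<in>set Os. move q I U \<in> set Z) (B 17)"
    unfolding callb_def by blast
qed (simp_all add: length_Is)

lemma ran_FAttract:
  assumes "length Z < N" "length A < N" "length A' < N"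
  shows "ran FAttract [states_val Q,
      VPair (states_val Z) (VPair (states_val A) (VPair (states_val A') context_val))]
    (states_val (attract move Is Os Q A A' Z)) (B 22)"
  unfolding attract_def states_val_def[of Q] states_val_def[of "filter _ _"]
proof (rule ran_filterB[of _ FAttractP _ _ _ _ 20])
  fix q assume q: "q \<in> set Q"
  note 1 = ran_mem_state[OF q assms(2)] and 2 = ran_mem_state[OF q assms(3)] and 3 = ran_FCtrl[OF q assms(1)]
  have "ran FAttractP [state_val q, VPair (states_val Z) (VPair (states_val A) (VPair (states_val A') context_val))]
     (bool_val (q \<in> set A \<or> q \<in> set A' \<and> controllable move Is Os Z q)) (B 20)"
    by (intro ranI, auto simp: Let_def call_exec[OF 1] call_exec[OF 2] call_exec[OF 3])
      (use call_time_le[OF 1] call_time_le[OF 2] call_time_le[OF 3] B_chain(1-20) in linarith)+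
  then show "ranb FAttractP [state_val q, VPair (states_val Z) (VPair (states_val A) (VPair (states_val A') context_val))]
     (q \<in> set A \<or> q \<in> set A' \<and> controllable move Is Os Z q) (B 20)" by (rule callb_bool_val)
qed (use length_Q in simp_all)

lemma length_attract: "length (attract move Is Os Q A A' Z) \<le> length Q"
  by (simp add: attract_def)

lemma ran_FStages_aux:
  assumes "length Z < N" "length A < N" "length A' < N"
  shows "ran FStages [list_val l,
      VPair (states_val Z) (VPair (states_val A) (VPair (states_val A') context_val))]
    (list_val (map states_val (stages (attract move Is Os Q A A') Z l))) (B 23 * (length l + 1))"
  using assms(1)
proof (induction l arbitrary: Z)
  case Nil
  show ?case by (intro ranI, simp) (use B_chain(1-23) in linarith)
next
  case (Cons x l)
  let ?Z = "attract move Is Os Q A A' Z"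
  have 1: "ran FAttract [states_val Q,
      VPair (states_val Z) (VPair (states_val A) (VPair (states_val A') context_val))] (states_val ?Z) (B 22)"
    using Cons.prems assms by (intro ran_FAttract)
  have 2: "ran FStages [list_val l,
      VPair (states_val ?Z) (VPair (states_val A) (VPair (states_val A') context_val))]
    (list_val (map states_val (stages (attract move Is Os Q A A') ?Z l))) (B 23 * (length l + 1))"
    using length_attract[of A A' Z] length_Q by (intro Cons.IH) simp
  show ?case
    by (intro ranI, simp add: call_exec[OF 1] call_exec[OF 2])
      (use call_time_le[OF 1] call_time_le[OF 2, simplified] B_chain(1-23) in linarith)
qed

lemma ran_FStages:
  assumes "length Z < N" "length A < N" "length A' < N"
  shows "ran FStages [states_val Q,
      VPair (states_val Z) (VPair (states_val A) (VPair (states_val A') context_val))]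
    (list_val (map states_val (stages (attract move Is Os Q A A') Z Q))) (B 25)"
proof -
  \<comment> \<open>\<open>stages\<close> only counts along its list, so replacing the states by
    their codes does not change the result.\<close>
  have st: "stages G Z (map f l) = stages G Z l" for G :: "'a mstate list \<Rightarrow> 'a mstate list" and f l
    by (induction l arbitrary: Z) auto
  have "B 23 * (length (map state_val Q) + 1) \<le> B 25"
    using length_Q by (intro loop_bound[of _ 23]) auto
  from call_mono[OF ran_FStages_aux[OF assms] this] show ?thesis
    by (simp add: states_val_def[of Q] st)
qed

lemma final_in_subseqs: "final \<in> set (subseqs C)"
  by (simp add: final_def filter_in_subseqs)

lemma ran_FWonP:
  assumes "q \<in> set Q"
  shows "ran FWonP [state_val q, context_val] (bool_val (won q)) (B 5)"
proof -
  have 1: "ran FMem [VPair (ltl_val (LNext \<phi>)) (formulas_val final), state_val q] (bool_val (fulfilled q)) (B 4)"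
    unfolding fulfilled_def using length_state[OF assms] by (intro ran_mem_row) (auto simp: in_D final_in_subseqs)
  have 2: "ran FMem [VPair (ltl_val (LNext \<alpha>s)) (formulas_val C), state_val q] (bool_val (\<not> bad q)) (B 4)"
    unfolding bad_def not_not using length_state[OF assms] by (intro ran_mem_row) (auto simp: in_D subseqs_refl)
  show ?thesis
    by (intro ranI, auto simp: won_def call_exec[OF 1] call_exec[OF 2])
      (use call_time_le[OF 1] call_time_le[OF 2] B_chain(1-5) in linarith)+
qed

lemma ran_FWon: "ran FWon [states_val Q, context_val] (states_val (filter won Q)) (B 7)"
  unfolding states_val_def
  by (rule ran_filterB[of _ FWonP _ _ _ _ 5]) (use length_Q in \<open>auto intro!: callb_bool_val ran_FWonP\<close>)

lemma ran_FStay: "ran FStay [states_val Q, context_val] (states_val (filter (\<lambda>q. \<not> good q) Q)) (B 7)"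
  unfolding states_val_def
proof (rule ran_filterB[of _ FStayP _ _ _ _ 5])
  fix q assume q: "q \<in> set Q"
  have 1: "ran FMem [VPair (ltl_val (LNext \<alpha>c)) VNil, state_val q] (bool_val (good q)) (B 4)"
    using ran_mem_row[of "LNext \<alpha>c" "[]" q] length_state[OF q]
    by (simp add: good_def in_D Nil_in_subseqs)
  have "ran FStayP [state_val q, context_val] (bool_val (\<not> good q)) (B 5)"
    by (intro ranI, auto simp: call_exec[OF 1]) (use call_time_le[OF 1] B_chain(1-5) in linarith)+
  then show "ranb FStayP [state_val q, context_val] (\<not> good q) (B 5)" by (rule callb_bool_val)
qed (use length_Q in simp_all)

lemma ran_FReach:
  "ran FReach [context_val, c] (list_val (map states_val reach_stages)) (B 26)"
proof -
  note 1 = ran_FWon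
  have 2: "ran FStages [states_val Q, VPair VNil (VPair (states_val (filter won Q)) (VPair (states_val Q) context_val))]
    (list_val (map states_val reach_stages)) (B 25)"
    using ran_FStages[of "[]" "filter won Q" Q] length_Q length_filter_le[of won Q]
    by (simp add: reach_stages_def reach_step_def)
  show ?thesis
    by (intro ranI, simp add: call_exec[OF 1] call_exec[OF 2])
      (use call_time_le[OF 1] call_time_le[OF 2] B_chain(1-26) in linarith)
qed

lemma length_Rk: "length (Rk k) \<le> length Q"
  unfolding reach_step_def by (cases k) (simp_all add: length_attract)

lemma length_R: "length R \<le> length Q"
  unfolding R_eq by (rule length_Rk)

lemma length_V: "length V \<le> length Q"
proof -
  have "length ((stay_step ^^ k) Q) \<le> length Q" for k
    unfolding stay_step_def by (cases k) (simp_all add: length_attract)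
  then show ?thesis unfolding V_eq .
qed

lemma ran_FRegion: "ran FRegion [context_val, states_val R] (states_val V) (B 26)"
proof -
  let ?l = "stages stay_step Q Q"
  note 1 = ran_FStay
  have 2: "ran FStages [states_val Q,
      VPair (states_val Q) (VPair (states_val R) (VPair (states_val (filter (\<lambda>q. \<not> good q) Q)) context_val))]
    (list_val (map states_val ?l)) (B 25)"
    unfolding stay_step_def using length_Q length_R length_filter_le[of "\<lambda>q. \<not> good q" Q]
    by (intro ran_FStages) linarith+
  have 3: "ran FLast [list_val (map states_val ?l), VNil] (states_val V) (B 2)"
    using ran_FLast[of "map states_val ?l" VNil] length_Q by (simp add: V_def last_map)
  show ?thesis
    by (intro ranI, simp add: call_exec[OF 1] call_exec[OF 2] call_exec[OF 3])
      (use call_time_le[OF 1] call_time_le[OF 2] call_time_le[OF 3] B_chain(1-26) in linarith)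
qed

lemma ran_last_reach: "ran FLast [list_val (map states_val reach_stages), VNil] (states_val R) (B 2)"
  using ran_FLast[of "map states_val reach_stages" VNil] length_Q
  by (simp add: R_def reach_stages_def last_map)

lemma length_Zs: "Z \<in> set Zs \<Longrightarrow> length Z < N"
proof -
  assume "Z \<in> set Zs"
  then consider "Z = V" | k where "k \<le> length Q" "Z = Rk k"
    by (auto simp: Zs_def reach_stages_def in_set_conv_nth nth_stages less_Suc_eq_le)
  then show "length Z < N"
  proof cases
    case 1 then show ?thesis using length_V length_Q by simp
  next
    case (2 k)
    then show ?thesis using length_Rk[of k] length_Q by simp
  qed
qed

lemma ran_FFindZ:
  assumes "q \<in> set Q"
  shows "ran FFindZ [list_val (map states_val Zs), VPair (state_val q) context_val]
    (option_val (map_option states_val (find (\<lambda>Z. controllable move Is Os Z q) Zs))) (B 22)"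
proof (rule ran_findB[of _ FCtrlZ _ _ _ _ 20])
  fix Z assume "Z \<in> set Zs"
  then have 1: "ran FCtrl [list_val (map vars_val Is), VPair (state_val q) (VPair (states_val Z) context_val)]
    (bool_val (controllable move Is Os Z q)) (B 19)"
    using length_Zs by (intro ran_FCtrl[OF assms])
  have "ran FCtrlZ [states_val Z, VPair (state_val q) context_val] (bool_val (controllable move Is Os Z q)) (B 20)"
    by (intro ranI, simp add: call_exec[OF 1]) (use call_time_le[OF 1] B_chain(1-20) in linarith)
  then show "ranb FCtrlZ [states_val Z, VPair (state_val q) context_val] (controllable move Is Os Z q) (B 20)"
    by (rule callb_bool_val)
qed (use length_Q in \<open>simp_all add: Zs_def reach_stages_def\<close>)

lemma ran_index_state:
  assumes "q \<in> set Q"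
  shows "ran FIndex [state_val q, states_val Q] (nat_val (index_in q Q)) (B 4)"
  unfolding states_val_def using length_Q by (intro ran_FIndex[OF inj_state_val state_small[OF assms]]) simp

lemma ran_index_dead: "ran FIndex [VAtom e, states_val Q] (nat_val (length Q)) (B 4)"
  unfolding states_val_def
proof (rule ran_FIndex_absent)
  show "state_val q \<noteq> VAtom e" for q by (cases q) (simp_all add: state_val_def)
qed (use length_Q in simp)

lemma choice_in_Os: "choice q I \<in> set Os"
  using Nil_in_subseqs[of ys] by (auto simp: choice_def find_Some_iff Os_def split: option.splits)

lemma ran_FTrans:
  assumes q: "q \<in> set Q" and I: "I \<in> set Is"
  shows "ran FTrans [vars_val I, VPair (state_val q) (VPair (list_val (map states_val Zs)) context_val)]
    (transition_val (trans q I)) (B 23)"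
proof -
  let ?U = "choice q I" and ?Z = "target_set q"
  let ?q = "move q I ?U"
  have Z: "length ?Z < N"
    using length_Zs N_ge by (auto simp: target_set_def find_Some_iff split: option.splits)
  have U: "length (I @ ?U) < N" by (rule length_letter[OF I choice_in_Os])
  note 1 = ran_FFindZ[OF q] and 2 = ran_FFindU[OF I q Z]
  have 3: "ran FAppend [vars_val I, vars_val ?U] (vars_val (I @ ?U)) (B 2)"
    using U by (intro ran_append_vars) simp
  have 4: "ran FStep [state_val D, VPair (vars_val (I @ ?U)) (VPair (state_val q) (formulas_val C))]
      (state_val ?q) (B 13)"
    using ran_FStep[OF length_state[OF q] U] by (simp add: move_def)
  note 5 = ran_index_state[OF q] and 6 = ran_index_state[OF move_in_Q[of q I ?U]] and 7 = ran_index_dead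
  have 8: "ran FMem [VPair (ltl_val (LNext \<phi>)) (formulas_val final), state_val ?q] (bool_val (fulfilled ?q)) (B 4)"
    unfolding fulfilled_def using length_state[OF move_in_Q] by (intro ran_mem_row) (auto simp: in_D final_in_subseqs)
  note 9 = ran_FWonP[OF move_in_Q[of q I ?U]]
  have U': "(case find (\<lambda>U. move q I U \<in> set ?Z) Os of None \<Rightarrow> [] | Some U \<Rightarrow> U) = ?U"
    by (simp add: choice_def)
  have Z': "(case find (\<lambda>Z. controllable move Is Os Z q) Zs of None \<Rightarrow> [] | Some Z \<Rightarrow> Z) = ?Z"
    by (simp add: target_set_def)
  have w: "vars_val (e # u) = VPair (VAtom e) (vars_val u)" for u by (simp add: vars_val_def)
  show ?thesis
    by (intro ranI, auto simp: Z' U' call_exec[OF 1] call_exec[OF 2] call_exec[OF 3] call_exec[OF 4]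
        call_exec[OF 5] call_exec[OF 6] call_exec[OF 7] call_exec[OF 8] call_exec[OF 9]
        transition_val_def trans_def Let_def w)
      (use call_time_le[OF 1] call_time_le[OF 2] call_time_le[OF 3] call_time_le[OF 4]
        call_time_le[OF 5] call_time_le[OF 6] call_time_le[OF 7] call_time_le[OF 8] call_time_le[OF 9]
        B_chain(1-23) in linarith)+
qed

lemma ran_FAllTrans:
  "ran FAllTrans [states_val Q, VPair (list_val (map states_val Zs)) context_val]
    (list_val (map transition_val (snd machine))) (B 28)"
proof -
  let ?h = "\<lambda>q. map (\<lambda>I. transition_val (trans q I)) Is"
  have "ran FAllTrans [list_val (map state_val Q), VPair (list_val (map states_val Zs)) context_val]
    (list_val (concat (map ?h Q))) (B 28)"
  proof (rule ran_concat_mapB[of _ FTransQ FAppend _ _ _ _ 26])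
    fix q assume q: "q \<in> set Q"
    have 1: "ran FMapTrans [list_val (map vars_val Is),
        VPair (state_val q) (VPair (list_val (map states_val Zs)) context_val)] (list_val (?h q)) (B 25)"
      by (rule ran_mapB[of _ FTrans _ _ _ _ 23]) (use ran_FTrans[OF q] length_Is in auto)
    show "ran FTransQ [state_val q, VPair (list_val (map states_val Zs)) context_val] (list_val (?h q)) (B 26)"
      by (intro ranI, simp add: call_exec[OF 1]) (use call_time_le[OF 1] B_chain(1-26) in linarith)
    show "ran FAppend [list_val (?h q), list_val u] (list_val (?h q @ u)) (B 26)" for u
      by (rule call_mono[OF ran_FAppend B_mono]) (use length_Is in auto)
  qed (use length_Q in simp_all)
  then show ?thesis by (simp add: states_val_def machine_def map_concat comp_def)
qed

lemma ran_FSetup: "ran FSetup [spec_val e xs ys \<alpha>s \<alpha>c \<phi>, c] context_val (B 7)"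
proof -
  have root: "LNext \<alpha>s \<in> set C" "LNext \<alpha>c \<in> set C" "LNext \<phi> \<in> set C" by (auto simp: C_def)
  have size: "ltl_size (LNext \<psi>) < N" if "LNext \<psi> \<in> set C" for \<psi>
    using formula_small[OF that] by simp
  have sub: "ran FSub [ltl_val (LNext \<psi>), VNil] (formulas_val (subformulas (LNext \<psi>))) (B 5)"
    if "LNext \<psi> \<in> set C" for \<psi>
    unfolding formulas_val_def by (rule ran_FSub[OF size[OF that]])
  note s = sub[OF root(1)] sub[OF root(2)] sub[OF root(3)]
  have len: "length (subformulas (LNext \<alpha>s)) < N" "length (subformulas (LNext \<alpha>c)) < N"
    using length_C by (simp_all add: C_def)
  have a: "ran FAppend [formulas_val (subformulas (LNext \<alpha>c)), formulas_val (subformulas (LNext \<phi>))]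
      (formulas_val (subformulas (LNext \<alpha>c) @ subformulas (LNext \<phi>))) (B 2)"
    "ran FAppend [formulas_val (subformulas (LNext \<alpha>s)),
        formulas_val (subformulas (LNext \<alpha>c) @ subformulas (LNext \<phi>))] (formulas_val C) (B 2)"
    unfolding C_def using len by (intro ran_append_formulas; simp)+
  have sC: "ran FSubseqs [formulas_val C, VNil] (list_val (map formulas_val (subseqs C))) (B 6)"
    using ran_FSubseqs[OF power_C, of ltl_val VNil] by (simp add: formulas_val_def[abs_def])
  have rows: "ran FMapCons [list_val (map formulas_val (subseqs C)), ltl_val r]
      (state_val (map (Pair r) (subseqs C))) (B 3)" for r
    using ran_FMapCons[of "subseqs C" formulas_val "ltl_val r"] power_C
    by (simp add: state_val_def row_val_def length_subseqs comp_def)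
  have lenS: "length (map (Pair r) (subseqs C)) < N" for r using power_C by (simp add: length_subseqs)
  have d: "ran FAppend [state_val (map (Pair (LNext \<alpha>c)) (subseqs C)), state_val (map (Pair (LNext \<phi>)) (subseqs C))]
      (state_val (map (Pair (LNext \<alpha>c)) (subseqs C) @ map (Pair (LNext \<phi>)) (subseqs C))) (B 2)"
    "ran FAppend [state_val (map (Pair (LNext \<alpha>s)) (subseqs C)),
        state_val (map (Pair (LNext \<alpha>c)) (subseqs C) @ map (Pair (LNext \<phi>)) (subseqs C))] (state_val D) (B 2)"
    unfolding D_def using lenS by (intro ran_append_rows; simp)+
  have q: "ran FSubseqs [state_val D, VNil] (states_val Q) (B 6)"
    using ran_FSubseqs[OF power_D, of row_val VNil] by (simp add: state_val_def[abs_def] states_val_def Q_def)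
  have io: "ran FSubseqs [vars_val xs, VNil] (list_val (map vars_val Is)) (B 6)"
    "ran FSubseqs [vars_val ys, VNil] (list_val (map vars_val Os)) (B 6)"
    using ran_FSubseqs[OF letters_small(1), of VAtom VNil] ran_FSubseqs[OF letters_small(2), of VAtom VNil]
    by (simp_all add: vars_val_def[abs_def] Is_def Os_def)
  have f: "ran FRelease [formulas_val C, VNil] (formulas_val final) (B 3)"
    unfolding final_def by (rule ran_FRelease[OF length_C])
  show ?thesis
    by (intro ranI, simp add: spec_val_def s[THEN call_exec] a[THEN call_exec] call_exec[OF sC]
        call_exec[OF rows] d[THEN call_exec] call_exec[OF q] io[THEN call_exec] call_exec[OF f]
        context_val_def)
      (use s[THEN call_time_le] a[THEN call_time_le] call_time_le[OF sC] call_time_le[OF rows[of "LNext \<alpha>s"]]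
        call_time_le[OF rows[of "LNext \<alpha>c"]] call_time_le[OF rows[of "LNext \<phi>"]]
        d[THEN call_time_le] call_time_le[OF q] io[THEN call_time_le] call_time_le[OF f] B_chain(1-7) in linarith)
qed

lemma decide_computes:
  "computes_within decide_prog (spec_val e xs ys \<alpha>s \<alpha>c \<phi>) (bool_val (start \<in> set V)) (B 29)"
proof -
  note 1 = ran_FSetup[of VNil] and 2 = ran_FReach[of VNil] and 3 = ran_last_reach and 4 = ran_FRegion
    and 5 = ran_FStart[of VNil]
  have 6: "ran FMem [state_val start, states_val V] (bool_val (start \<in> set V)) (B 4)"
    using length_V length_Q by (intro ran_mem_state[OF start_in_Q]) simp
  show ?thesis
    by (intro computes_withinI, simp add: decide_prog_def call_exec[OF 1] call_exec[OF 2] call_exec[OF 3]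
        call_exec[OF 4] call_exec[OF 5] call_exec[OF 6])
      (use call_time_le[OF 1] call_time_le[OF 2] call_time_le[OF 3] call_time_le[OF 4] call_time_le[OF 5]
        call_time_le[OF 6] B_chain in linarith)
qed

lemma construct_computes:
  "computes_within construct_prog (spec_val e xs ys \<alpha>s \<alpha>c \<phi>) (transducer_val machine) (B 29)"
proof -
  note 1 = ran_FSetup[of VNil] and 2 = ran_FReach[of VNil] and 3 = ran_last_reach and 4 = ran_FRegion
    and 5 = ran_FStart[of VNil] and 6 = ran_index_state[OF start_in_Q] and 7 = ran_FAllTrans
  have 8: "ran FAppend [list_val (map states_val reach_stages), VPair (states_val V) VNil]
      (list_val (map states_val Zs)) (B 2)"
    using ran_FAppend[of "map states_val reach_stages" "[states_val V]"] length_Q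
    by (simp add: Zs_def) (simp add: reach_stages_def)
  show ?thesis
    by (intro computes_withinI, simp add: construct_prog_def call_exec[OF 1] call_exec[OF 2] call_exec[OF 3]
        call_exec[OF 4] call_exec[OF 5] call_exec[OF 6] call_exec[OF 7] call_exec[OF 8]
        transducer_val_def)
      (use call_time_le[OF 1] call_time_le[OF 2] call_time_le[OF 3] call_time_le[OF 4] call_time_le[OF 5]
        call_time_le[OF 6] call_time_le[OF 7] call_time_le[OF 8] B_chain in \<open>simp add: machine_def\<close>)
qed

end


section \<open>Doubly exponential bounds\<close>

lemma val_size_list_val:
  "(\<And>v. v \<in> set l \<Longrightarrow> val_size v \<le> m) \<Longrightarrow> val_size (list_val l) \<le> (m + 1) * length l + 1"
  by (induction l) force+

lemma finite_atoms: "finite (atoms \<psi>)"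
  by (induction \<psi>) auto

lemma card_atoms: "card (atoms \<psi>) \<le> ltl_size \<psi>"
proof (induction \<psi>)
  case (LAnd \<psi> \<chi>)
  then show ?case using card_Un_le[of "atoms \<psi>" "atoms \<chi>"] by simp
next
  case (LOr \<psi> \<chi>)
  then show ?case using card_Un_le[of "atoms \<psi>" "atoms \<chi>"] by simp
next
  case (LUntil \<psi> \<chi>)
  then show ?case using card_Un_le[of "atoms \<psi>" "atoms \<chi>"] by simp
next
  case (LRelease \<psi> \<chi>)
  then show ?case using card_Un_le[of "atoms \<psi>" "atoms \<chi>"] by simp
qed simp_all

lemma ltl_size_pos: "1 \<le> ltl_size \<psi>"
  by (cases \<psi>) auto

lemma length_le_atoms:
  assumes "distinct xs" "set xs \<subseteq> atoms \<alpha>s \<union> atoms \<alpha>c \<union> atoms \<phi>"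
  shows "length xs \<le> ltl_size \<alpha>s + ltl_size \<alpha>c + ltl_size \<phi>"
proof -
  have "length xs = card (set xs)" using assms(1) by (simp add: distinct_card)
  also have "\<dots> \<le> card (atoms \<alpha>s \<union> atoms \<alpha>c \<union> atoms \<phi>)"
    using assms(2) by (intro card_mono) (simp_all add: finite_atoms)
  also have "\<dots> \<le> card (atoms \<alpha>s) + card (atoms \<alpha>c) + card (atoms \<phi>)"
    by (meson card_Un_le add_le_mono1 order_trans)
  also have "\<dots> \<le> ltl_size \<alpha>s + ltl_size \<alpha>c + ltl_size \<phi>"
    by (intro add_mono card_atoms)
  finally show ?thesis .
qed

text \<open>The closure has \<open>n + 3\<close> entries, the three roots included. This gives
  \<open>3 * 2 ^ (n + 3) = 24 * 2 ^ n\<close> rows and \<open>2 ^ (24 * 2 ^ n)\<close> states. Both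
  this exponent and the size of a single state are of order at most \<open>n * n * 2 ^ n\<close>,
  which \<open>2 ^ (20 * n)\<close> dominates with its constants.\<close>

lemma synthesis_time_doubly_exponential:
  fixes \<alpha>s \<alpha>c \<phi> :: "'a ltl"
  assumes n: "n = ltl_size \<alpha>s + ltl_size \<alpha>c + ltl_size \<phi>"
    and xs: "length xs \<le> n" and ys: "length ys \<le> n"
  shows "synthesis_time xs ys \<alpha>s \<alpha>c \<phi> (2 ^ 2 ^ (20 * n))"
proof -
  interpret synthesis e xs ys \<alpha>s \<alpha>c \<phi> for e .
  define M :: nat where "M = 2 ^ (20 * n)"
  have n3: "3 \<le> n" using ltl_size_pos[of \<alpha>s] ltl_size_pos[of \<alpha>c] ltl_size_pos[of \<phi>] n by linarith
  have MN: "M < 2 ^ M" by (rule less_exp)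
  have n_exp: "n < 2 ^ n" by (rule less_exp)
  have pow: "2 ^ k \<le> M" if "k \<le> 20 * n" for k :: nat unfolding M_def using that by simp
  \<comment> \<open>\<open>8192 = 2 ^ 13\<close> exceeds the factor \<open>185 * 24 + 1\<close> that
    arises below for the size of a state.\<close>
  have small: "8192 * (n * n * 2 ^ n) \<le> M"
  proof -
    have "8192 * (n * n * 2 ^ n) \<le> 2 ^ 13 * (2 ^ n * 2 ^ n * 2 ^ n)"
      using n_exp by (intro mult_mono) auto
    also have "\<dots> = 2 ^ (13 + (n + n + n))" by (simp only: power_add mult.assoc)
    also have "\<dots> \<le> M" using n3 by (intro pow) simp
    finally show ?thesis .
  qed
  define K where "K = n * n * 2 ^ n"
  have K: "8192 * K \<le> M" "n \<le> K" "n * n \<le> K" using small by (simp_all add: K_def)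
  have lenC: "length C = n + 3" by (simp add: C_def length_subformulas n)
  have lenD: "length D = 24 * 2 ^ n" by (simp add: D_def length_subseqs lenC power_add)
  have size_C: "ltl_size \<theta> \<le> n + 1" if "\<theta> \<in> set C" for \<theta>
    using that ltl_size_subformulas[of \<theta> "LNext \<alpha>s"] ltl_size_subformulas[of \<theta> "LNext \<alpha>c"]
      ltl_size_subformulas[of \<theta> "LNext \<phi>"] n by (auto simp: C_def)
  have val_C: "val_size (ltl_val \<theta>) \<le> 60 * n" if "\<theta> \<in> set C" for \<theta>
    using val_size_ltl_val[of \<theta>] size_C[OF that] n3 by linarith
  have rows: "val_size (formulas_val S) \<le> 123 * (n * n)" if "S \<in> set (subseqs C)" for S
  proof -
    have "val_size (formulas_val S) \<le> (60 * n + 1) * length S + 1"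
      unfolding formulas_val_def
      using val_size_list_val[of "map ltl_val S" "60 * n"] val_C subseqs_subset[OF that] by auto
    \<comment> \<open>A type has at most \<open>n + 3\<close> entries, and
      \<open>n + 3 \<le> 2 * n\<close> since \<open>n \<ge> 3\<close>.\<close>
    also have "\<dots> \<le> (61 * n) * (2 * n) + n * n"
      using length_in_subseqs[OF that] lenC n3 by (intro add_mono mult_mono) auto
    finally show ?thesis by (simp add: algebra_simps)
  qed
  have root: "r \<in> set C" if "r \<in> {LNext \<alpha>s, LNext \<alpha>c, LNext \<phi>}" for r
    using that by (auto simp: C_def)
  have row: "val_size (row_val x) \<le> 184 * (n * n)" if "x \<in> set D" for x
  proof -
    have x: "fst x \<in> {LNext \<alpha>s, LNext \<alpha>c, LNext \<phi>}" "snd x \<in> set (subseqs C)"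
      using that in_D[of "fst x" "snd x"] by simp_all
    have "1 * n \<le> n * n" using n3 by (intro mult_le_mono1) simp
    then have "60 * n + 1 \<le> 61 * (n * n)" using n3 by linarith
    then show ?thesis using val_C[OF root[OF x(1)]] rows[OF x(2)] by (simp add: row_val_def)
  qed
  have state: "val_size (state_val q) \<le> M" if "q \<in> set Q" for q
  proof -
    have sub: "set q \<subseteq> set D" and len: "length q \<le> length D"
      using that subseqs_subset[of q D] length_in_subseqs[of q D] by (simp_all add: Q_def)
    have val: "val_size v \<le> 184 * (n * n)" if v: "v \<in> set (map row_val q)" for v
    proof -
      obtain x where "x \<in> set q" "v = row_val x" using v by auto
      then show ?thesis using row sub by blast
    qed
    have "val_size (state_val q) \<le> (184 * (n * n) + 1) * length q + 1"
      using val_size_list_val[of "map row_val q" "184 * (n * n)"] val by (simp add: state_val_def)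
    also have "\<dots> \<le> (185 * (n * n)) * (24 * 2 ^ n) + n * n * 2 ^ n"
      using len lenD n3 by (intro add_mono mult_mono) auto
    also have "\<dots> \<le> 8192 * (n * n * 2 ^ n)" by simp
    finally show ?thesis using small by linarith
  qed
  have lenQ: "length Q + 2 < 2 ^ M"
  proof -
    have "1 * 2 ^ n \<le> n * n * (2 :: nat) ^ n" using n3 by (intro mult_le_mono1) simp
    \<comment> \<open>The 2 added in the exponent is a factor 4 for the number of states, which
      makes room for the two additional entries of \<open>Zs\<close>.\<close>
    then have "24 * 2 ^ n + 2 \<le> 8192 * (n * n * 2 ^ n)" using n3 n_exp by linarith
    then have "2 ^ (24 * 2 ^ n + 2) \<le> (2 :: nat) ^ M" using small by (intro power_increasing) auto
    moreover have "(2 :: nat) ^ (24 * 2 ^ n + 2) = 4 * 2 ^ (24 * 2 ^ n)" by (simp add: power_add)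
    moreover have "(1 :: nat) \<le> 2 ^ (24 * 2 ^ n)" by simp
    ultimately have "2 ^ (24 * 2 ^ n) + 2 < (2 :: nat) ^ M" by linarith
    then show ?thesis by (simp add: Q_def length_subseqs lenD)
  qed
  have M: "1000 \<le> M" "30 * (n + 1) \<le> M" "184 * (n * n) \<le> M" "n + n < M"
    using pow[of 10] K n3 by simp_all
  have letters: "2 ^ k < (2 :: nat) ^ M" if "k \<le> n" for k
    using that M by (intro power_strict_increasing) linarith+
  show ?thesis
    unfolding M_def[symmetric]
  proof unfold_locales
    show "1000 \<le> (2 :: nat) ^ M" using M(1) MN by linarith
    show "30 * ltl_size \<theta> \<le> 2 ^ M" if "\<theta> \<in> set C" for \<theta>
      using mult_le_mono2[OF size_C[OF that], of 30] M(2) MN by linarith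
    show "length Q + 2 < 2 ^ M" by (rule lenQ)
    show "val_size (row_val x) \<le> 2 ^ M" if "x \<in> set D" for x
      using row[OF that] M(3) MN by linarith
    show "val_size (state_val q) \<le> 2 ^ M" if "q \<in> set Q" for q
      using state[OF that] MN by linarith
    show "2 ^ length xs < (2 :: nat) ^ M" "2 ^ length ys < (2 :: nat) ^ M"
      by (rule letters[OF xs]) (rule letters[OF ys])
    show "length xs + length ys < 2 ^ M" using xs ys M(4) MN by linarith
  qed
qed

text \<open>The outer exponent 29 becomes a factor of at most \<open>2 ^ 5\<close> one level up, and
  \<open>20 * n + 5 \<le> 27 * n \<le> n ^ 4\<close> for \<open>n \<ge> 3\<close>. Three is the
  least total size of three formulas.\<close>

lemma doubly_exponential_bound:
  assumes "3 \<le> (n :: nat)"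
  shows "((2 :: nat) ^ 2 ^ (20 * n)) ^ 29 \<le> 2 ^ 2 ^ (n ^ 4)"
proof -
  have "20 * n + 5 \<le> 27 * n" using assms by simp
  also have "\<dots> \<le> n ^ 3 * n" using power_mono[OF assms, of 3] by (intro mult_right_mono) simp_all
  also have "\<dots> = n ^ 4" by (simp add: eval_nat_numeral)
  finally have "(2 :: nat) ^ (20 * n + 5) \<le> 2 ^ n ^ 4" by (intro power_increasing) simp_all
  moreover have "2 ^ (20 * n) * 29 \<le> (2 :: nat) ^ (20 * n + 5)" by (simp add: power_add)
  ultimately have "2 ^ (20 * n) * 29 \<le> (2 :: nat) ^ n ^ 4" by linarith
  then show ?thesis by (simp only: power_mult[symmetric]) (intro power_increasing, simp_all)
qed

lemma computes_within_mono:
  "computes_within p input result T \<Longrightarrow> T \<le> T' \<Longrightarrow> computes_within p input result T'"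
  unfolding computes_within_def by (meson order_trans)

lemma spec_locales:
  assumes "spec_with_dfas e X Y \<alpha>s \<alpha>c \<phi> As Ac Ag" "enumerates_inputs X Y \<alpha>s \<alpha>c \<phi> xs ys"
  shows "synthesis_spec e xs ys \<alpha>s \<alpha>c \<phi> X Y"
    "synthesis_time xs ys \<alpha>s \<alpha>c \<phi> (2 ^ 2 ^ (20 * (ltl_size \<alpha>s + ltl_size \<alpha>c + ltl_size \<phi>)))"
proof -
  show "synthesis_spec e xs ys \<alpha>s \<alpha>c \<phi> X Y"
    using assms by unfold_locales (auto simp: spec_with_dfas_def)
  show "synthesis_time xs ys \<alpha>s \<alpha>c \<phi> (2 ^ 2 ^ (20 * (ltl_size \<alpha>s + ltl_size \<alpha>c + ltl_size \<phi>)))"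
    using assms(2) by (intro synthesis_time_doubly_exponential[OF refl] length_le_atoms)
      (auto simp: enumerates_inputs_def)
qed

theorem theorem9:
  shows "(\<forall>(e :: 'a) X Y \<alpha>s \<alpha>c \<phi>
            (As :: ('s, 'a set) automaton) (Ac :: ('c, 'a set) automaton)
            (Ag :: ('g, 'a set) automaton).
          spec_with_dfas e X Y \<alpha>s \<alpha>c \<phi> As Ac Ag \<longrightarrow>
            (realizable e X Y (LAnd \<alpha>s \<alpha>c) \<phi> \<longleftrightarrow>
               game_winning X (Y \<union> {e}) (product_dba e (X \<union> Y) As Ac Ag)) \<and>
            (\<forall>\<sigma>. game_winning_strategy X (Y \<union> {e}) (product_dba e (X \<union> Y) As Ac Ag) \<sigma> \<longleftrightarrow>
               spec_winning_strategy e X Y (LAnd \<alpha>s \<alpha>c) \<phi> \<sigma>))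
       \<and> (\<exists>(decide :: prog) k.
          \<forall>(e :: 'a) X Y \<alpha>s \<alpha>c \<phi>
            (As :: ('s, 'a set) automaton) (Ac :: ('c, 'a set) automaton)
            (Ag :: ('g, 'a set) automaton) xs ys.
          spec_with_dfas e X Y \<alpha>s \<alpha>c \<phi> As Ac Ag \<and> enumerates_inputs X Y \<alpha>s \<alpha>c \<phi> xs ys \<longrightarrow>
            computes_within decide (spec_val e xs ys \<alpha>s \<alpha>c \<phi>)
              (bool_val (game_winning X (Y \<union> {e}) (product_dba e (X \<union> Y) As Ac Ag)))
              (2 ^ (2 ^ ((ltl_size \<alpha>s + ltl_size \<alpha>c + ltl_size \<phi>) ^ k))))
       \<and> (\<exists>(construct :: prog) k.
          \<forall>(e :: 'a) X Y \<alpha>s \<alpha>c \<phi>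
            (As :: ('s, 'a set) automaton) (Ac :: ('c, 'a set) automaton)
            (Ag :: ('g, 'a set) automaton) xs ys.
          spec_with_dfas e X Y \<alpha>s \<alpha>c \<phi> As Ac Ag \<and> enumerates_inputs X Y \<alpha>s \<alpha>c \<phi> xs ys \<and>
          game_winning X (Y \<union> {e}) (product_dba e (X \<union> Y) As Ac Ag) \<longrightarrow>
            (\<exists>M. computes_within construct (spec_val e xs ys \<alpha>s \<alpha>c \<phi>) (transducer_val M)
                   (2 ^ (2 ^ ((ltl_size \<alpha>s + ltl_size \<alpha>c + ltl_size \<phi>) ^ k))) \<and>
                 game_winning_strategy X (Y \<union> {e}) (product_dba e (X \<union> Y) As Ac Ag)
                   (transducer_strategy (set xs) M)))"
proof (intro conjI)
  show "\<forall>(e :: 'a) X Y \<alpha>s \<alpha>c \<phi> (As :: ('s, 'a set) automaton) (Ac :: ('c, 'a set) automaton)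
      (Ag :: ('g, 'a set) automaton).
      spec_with_dfas e X Y \<alpha>s \<alpha>c \<phi> As Ac Ag \<longrightarrow>
        (realizable e X Y (LAnd \<alpha>s \<alpha>c) \<phi> \<longleftrightarrow>
           game_winning X (Y \<union> {e}) (product_dba e (X \<union> Y) As Ac Ag)) \<and>
        (\<forall>\<sigma>. game_winning_strategy X (Y \<union> {e}) (product_dba e (X \<union> Y) As Ac Ag) \<sigma> \<longleftrightarrow>
           spec_winning_strategy e X Y (LAnd \<alpha>s \<alpha>c) \<phi> \<sigma>)"
    by (intro allI impI conjI;
        (rule realizable_iff_game_winning | rule game_strategy_iff_spec_strategy); assumption)
next
  show "\<exists>(decide :: prog) k. \<forall>(e :: 'a) X Y \<alpha>s \<alpha>c \<phi> (As :: ('s, 'a set) automaton)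
      (Ac :: ('c, 'a set) automaton) (Ag :: ('g, 'a set) automaton) xs ys.
      spec_with_dfas e X Y \<alpha>s \<alpha>c \<phi> As Ac Ag \<and> enumerates_inputs X Y \<alpha>s \<alpha>c \<phi> xs ys \<longrightarrow>
        computes_within decide (spec_val e xs ys \<alpha>s \<alpha>c \<phi>)
          (bool_val (game_winning X (Y \<union> {e}) (product_dba e (X \<union> Y) As Ac Ag)))
          (2 ^ (2 ^ ((ltl_size \<alpha>s + ltl_size \<alpha>c + ltl_size \<phi>) ^ k)))"
  proof (intro exI[of _ decide_prog] exI[of _ 4] allI impI, elim conjE)
    fix e :: 'a and X Y \<alpha>s \<alpha>c \<phi> and As :: "('s, 'a set) automaton" and Ac :: "('c, 'a set) automaton"
      and Ag :: "('g, 'a set) automaton" and xs ys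
    assume a: "spec_with_dfas e X Y \<alpha>s \<alpha>c \<phi> As Ac Ag" "enumerates_inputs X Y \<alpha>s \<alpha>c \<phi> xs ys"
    let ?n = "ltl_size \<alpha>s + ltl_size \<alpha>c + ltl_size \<phi>"
    interpret S: synthesis_spec e xs ys \<alpha>s \<alpha>c \<phi> X Y by (rule spec_locales[OF a])
    interpret T: synthesis_time e xs ys \<alpha>s \<alpha>c \<phi> "2 ^ 2 ^ (20 * ?n)" by (rule spec_locales[OF a])
    have "T.B 29 \<le> 2 ^ 2 ^ (?n ^ 4)" unfolding T.B_def
      using ltl_size_pos[of \<alpha>s] ltl_size_pos[of \<alpha>c] ltl_size_pos[of \<phi>]
      by (intro doubly_exponential_bound) linarith
    then show "computes_within decide_prog (spec_val e xs ys \<alpha>s \<alpha>c \<phi>)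
        (bool_val (game_winning X (Y \<union> {e}) (product_dba e (X \<union> Y) As Ac Ag))) (2 ^ 2 ^ (?n ^ 4))"
      \<comment> \<open>Realizability does not mention the DFAs, so the verdict computed from the
        tables holds for every choice of them.\<close>
      unfolding realizable_iff_game_winning[OF a(1), symmetric] S.realizable_iff_start
      by (rule computes_within_mono[OF T.decide_computes])
  qed
next
  show "\<exists>(construct :: prog) k. \<forall>(e :: 'a) X Y \<alpha>s \<alpha>c \<phi> (As :: ('s, 'a set) automaton)
      (Ac :: ('c, 'a set) automaton) (Ag :: ('g, 'a set) automaton) xs ys.
      spec_with_dfas e X Y \<alpha>s \<alpha>c \<phi> As Ac Ag \<and> enumerates_inputs X Y \<alpha>s \<alpha>c \<phi> xs ys \<and>
      game_winning X (Y \<union> {e}) (product_dba e (X \<union> Y) As Ac Ag) \<longrightarrow>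
        (\<exists>M. computes_within construct (spec_val e xs ys \<alpha>s \<alpha>c \<phi>) (transducer_val M)
               (2 ^ (2 ^ ((ltl_size \<alpha>s + ltl_size \<alpha>c + ltl_size \<phi>) ^ k))) \<and>
             game_winning_strategy X (Y \<union> {e}) (product_dba e (X \<union> Y) As Ac Ag)
               (transducer_strategy (set xs) M))"
  proof (intro exI[of _ construct_prog] exI[of _ 4] allI impI, elim conjE)
    fix e :: 'a and X Y \<alpha>s \<alpha>c \<phi> and As :: "('s, 'a set) automaton" and Ac :: "('c, 'a set) automaton"
      and Ag :: "('g, 'a set) automaton" and xs ys
    assume a: "spec_with_dfas e X Y \<alpha>s \<alpha>c \<phi> As Ac Ag" "enumerates_inputs X Y \<alpha>s \<alpha>c \<phi> xs ys"
      and win: "game_winning X (Y \<union> {e}) (product_dba e (X \<union> Y) As Ac Ag)"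
    let ?n = "ltl_size \<alpha>s + ltl_size \<alpha>c + ltl_size \<phi>"
    interpret S: synthesis_spec e xs ys \<alpha>s \<alpha>c \<phi> X Y by (rule spec_locales[OF a])
    interpret T: synthesis_time e xs ys \<alpha>s \<alpha>c \<phi> "2 ^ 2 ^ (20 * ?n)" by (rule spec_locales[OF a])
    have "T.B 29 \<le> 2 ^ 2 ^ (?n ^ 4)" unfolding T.B_def
      using ltl_size_pos[of \<alpha>s] ltl_size_pos[of \<alpha>c] ltl_size_pos[of \<phi>]
      by (intro doubly_exponential_bound) linarith
    then have "computes_within construct_prog (spec_val e xs ys \<alpha>s \<alpha>c \<phi>) (transducer_val S.machine)
        (2 ^ 2 ^ (?n ^ 4))"
      by (rule computes_within_mono[OF T.construct_computes])
    moreover have "game_winning_strategy X (Y \<union> {e}) (product_dba e (X \<union> Y) As Ac Ag)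
        (transducer_strategy (set xs) S.machine)"
      using S.machine_wins S.realizable_iff_start realizable_iff_game_winning[OF a(1)] win
        game_strategy_iff_spec_strategy[OF a(1)] by blast
    ultimately show "\<exists>M. computes_within construct_prog (spec_val e xs ys \<alpha>s \<alpha>c \<phi>) (transducer_val M)
        (2 ^ 2 ^ (?n ^ 4)) \<and>
      game_winning_strategy X (Y \<union> {e}) (product_dba e (X \<union> Y) As Ac Ag) (transducer_strategy (set xs) M)"
      by blast
  qed
qed

end
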